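(* Let $(W,S)$ and $(W',S')$ be finite irreducible Coxeter systems such that $W$ folds to $W'$ via $\mathrm{fold}:S\to S'$ and $\mathrm{unfold}:W'\to W$. Let $c'$ be a bipartite Coxeter element of $W'$ and $c=\mathrm{unfold}(c')$ (a Coxeter element of $W$). Then for every $w'\in W'$ and every integer $k\ge 0$, \[\mathrm{unfold}\big(\mathsf{Pop}_{T'}^k(w',c')\big)=\mathsf{Pop}_T^k(\mathrm{unfold}(w'),c).\]
   Context: $W$ folds to $W'$ if there is a surjective map $\mathrm{fold}:S\to S'$ such that for each $s'\in S'$ the elements of $\mathrm{fold}^{-1}(s')$ pairwise commute, and an injective group homomorphism $\mathrm{unfold}:W'\to W$ with $\mathrm{unfold}(s')=\prod_{s\in\mathrm{fold}^{-1}(s')}s$ for all $s'\in S'$. A bipartite Coxeter element of $W'$ is $c'=c'_+c'_-$, where $S'=S'_+\sqcup S'_-$ with the elements of each part pairwise commuting and $c'_\pm$ the product of the elements of $S'_\pm$. $T$, $T'$ are the sets of reflections (conjugates of simple reflections) of $W$, $W'$. For a Coxeter group $G$ with reflections $R$ and Coxeter element $d$: $\ell_R(w)$ is the minimal number of reflections with product $w$; absolute order $v\le_R w$ iff $\ell_R(wv^{-1})=\ell_R(w)-\ell_R(v)$; $\mathrm{NC}(G,d)=[e,d]$ in absolute order, a lattice; $\pi_R(w,d)=\bigvee_{t\in R,\ t\le_R w}t$ (join in $\mathrm{NC}(G,d)$, empty join $=e$); $\mathsf{Pop}_R(w,d)=w\,\pi_R(w,d)^{-1}$. A Coxeter element is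 a regular element of order equal to the Coxeter number. *)

theory Defs
  imports "HOL-Algebra.Multiplicative_Group" "HOL-Algebra.Generated_Groups"
begin

subsection \<open>Coxeter systems\<close>

definition word_prod :: "('a, 'm) monoid_scheme \<Rightarrow> 'a list \<Rightarrow> 'a" where
  "word_prod G xs = foldr (\<lambda>x y. x \<otimes>\<^bsub>G\<^esub> y) xs \<one>\<^bsub>G\<^esub>"

text \<open>
  The congruence on words over \<open>S\<close> generated by the relations \<open>(s t)\<^sup>m = 1\<close>, where \<open>m\<close> is
  the order of \<open>s t\<close> in \<open>G\<close>. If \<open>s t\<close> has infinite order then \<^const>\<open>group.ord\<close> is \<open>0\<close> and the
  relation is void. For \<open>s = t\<close> the order is \<open>1\<close> (when \<open>s\<close> is an involution), so the relation
  reads \<open>s s = 1\<close>; hence formal inverses of letters are not needed, and the quotient of the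
  monoid of words is the group presented by these generators and relations.
\<close>

inductive coxeter_cong :: "('a, 'm) monoid_scheme \<Rightarrow> 'a set \<Rightarrow> 'a list \<Rightarrow> 'a list \<Rightarrow> bool"
  for G S where
    rel: "\<lbrakk>u \<in> lists S; v \<in> lists S; s \<in> S; t \<in> S\<rbrakk> \<Longrightarrow>
      coxeter_cong G S (u @ concat (replicate (group.ord G (s \<otimes>\<^bsub>G\<^esub> t)) [s, t]) @ v) (u @ v)"
  | refl: "u \<in> lists S \<Longrightarrow> coxeter_cong G S u u"
  | sym: "coxeter_cong G S u v \<Longrightarrow> coxeter_cong G S v u"
  | trans: "\<lbrakk>coxeter_cong G S u v; coxeter_cong G S v w\<rbrakk> \<Longrightarrow> coxeter_cong G S u w"

definition coxeter_system :: "('a, 'm) monoid_scheme \<Rightarrow> 'a set \<Rightarrow> bool" where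
  "coxeter_system G S \<longleftrightarrow>
     group G \<and> S \<subseteq> carrier G \<and> generate G S = carrier G \<and>
     (\<forall>s\<in>S. group.ord G s = 2) \<and>
     (\<forall>u\<in>lists S. \<forall>v\<in>lists S. word_prod G u = word_prod G v \<longrightarrow> coxeter_cong G S u v)"

text \<open>
  Distinct simple reflections are adjacent in the Coxeter graph iff the order of their product
  is at least \<open>3\<close> or infinite; since that order is never \<open>1\<close> and infinite order is encoded
  as \<open>0\<close>, this means that it differs from \<open>2\<close>.
\<close>

definition coxeter_graph :: "('a, 'm) monoid_scheme \<Rightarrow> 'a set \<Rightarrow> ('a \<times> 'a) set" where
  "coxeter_graph G S =
     {(s, t). s \<in> S \<and> t \<in> S \<and> s \<noteq> t \<and> group.ord G (s \<otimes>\<^bsub>G\<^esub> t) \<noteq> 2}"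

definition irreducible_coxeter_system :: "('a, 'm) monoid_scheme \<Rightarrow> 'a set \<Rightarrow> bool" where
  "irreducible_coxeter_system G S \<longleftrightarrow>
     coxeter_system G S \<and> S \<noteq> {} \<and> (\<forall>s\<in>S. \<forall>t\<in>S. (s, t) \<in> (coxeter_graph G S)\<^sup>*)"

definition reflections :: "('a, 'm) monoid_scheme \<Rightarrow> 'a set \<Rightarrow> 'a set" where
  "reflections G S = {g \<otimes>\<^bsub>G\<^esub> s \<otimes>\<^bsub>G\<^esub> inv\<^bsub>G\<^esub> g | g s. g \<in> carrier G \<and> s \<in> S}"

subsection \<open>Products of commuting elements, foldings, bipartite Coxeter elements\<close>

definition pairwise_commuting :: "('a, 'm) monoid_scheme \<Rightarrow> 'a set \<Rightarrow> bool" where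
  "pairwise_commuting G A \<longleftrightarrow> (\<forall>x\<in>A. \<forall>y\<in>A. x \<otimes>\<^bsub>G\<^esub> y = y \<otimes>\<^bsub>G\<^esub> x)"

text \<open>
  The constant \<^const>\<open>finprod\<close> is meant for commutative monoids, but its definition makes sense
  in any group as long as the factors pairwise commute; see \<open>commuting_prod_eq\<close> below.
\<close>

definition commuting_prod :: "('a, 'm) monoid_scheme \<Rightarrow> 'a set \<Rightarrow> 'a" where
  "commuting_prod G A = finprod G (\<lambda>x. x) A"

lemma commuting_prod_eq:
  assumes G: "group G" and A: "set xs \<subseteq> carrier G"
    and comm: "pairwise_commuting G (set xs)" and dist: "distinct xs"
  shows "commuting_prod G (set xs) = word_prod G xs"
proof -
  interpret group G by fact
  interpret LCD "set xs" "carrier G" "(\<otimes>\<^bsub>G\<^esub>)"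
  proof
    fix x y z assume xyz: "x \<in> set xs" "y \<in> set xs" "z \<in> carrier G"
    then have "x \<otimes>\<^bsub>G\<^esub> y = y \<otimes>\<^bsub>G\<^esub> x"
      using comm by (auto simp: pairwise_commuting_def)
    then show "x \<otimes>\<^bsub>G\<^esub> (y \<otimes>\<^bsub>G\<^esub> z) = y \<otimes>\<^bsub>G\<^esub> (x \<otimes>\<^bsub>G\<^esub> z)"
      using xyz A by (metis m_assoc subsetD)
  qed (use A in auto)
  have "foldD (carrier G) (\<otimes>\<^bsub>G\<^esub>) \<one>\<^bsub>G\<^esub> (set ys) = word_prod G ys"
    if "set ys \<subseteq> set xs" "distinct ys" for ys
    using that by (induction ys) (auto simp: word_prod_def foldD_insert)
  then show ?thesis
    using dist by (simp add: commuting_prod_def finprod_def comp_def)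
qed

definition folds_to ::
  "('a, 'm) monoid_scheme \<Rightarrow> 'a set \<Rightarrow> ('b, 'n) monoid_scheme \<Rightarrow> 'b set \<Rightarrow>
   ('a \<Rightarrow> 'b) \<Rightarrow> ('b \<Rightarrow> 'a) \<Rightarrow> bool" where
  "folds_to W S W' S' fld unfld \<longleftrightarrow>
     fld ` S = S' \<and>
     (\<forall>s'\<in>S'. pairwise_commuting W {s \<in> S. fld s = s'}) \<and>
     unfld \<in> hom W' W \<and> inj_on unfld (carrier W') \<and>
     (\<forall>s'\<in>S'. unfld s' = commuting_prod W {s \<in> S. fld s = s'})"

definition bipartite_coxeter_element :: "('a, 'm) monoid_scheme \<Rightarrow> 'a set \<Rightarrow> 'a \<Rightarrow> bool" where
  "bipartite_coxeter_element G S c \<longleftrightarrow>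
     (\<exists>Sp Sm. S = Sp \<union> Sm \<and> Sp \<inter> Sm = {} \<and>
        pairwise_commuting G Sp \<and> pairwise_commuting G Sm \<and>
        c = commuting_prod G Sp \<otimes>\<^bsub>G\<^esub> commuting_prod G Sm)"

subsection \<open>Absolute order, noncrossing partitions and the pop operator\<close>

definition reflection_length :: "('a, 'm) monoid_scheme \<Rightarrow> 'a set \<Rightarrow> 'a \<Rightarrow> nat" where
  "reflection_length G R w = (LEAST n. \<exists>rs\<in>lists R. length rs = n \<and> word_prod G rs = w)"

definition abs_le :: "('a, 'm) monoid_scheme \<Rightarrow> 'a set \<Rightarrow> 'a \<Rightarrow> 'a \<Rightarrow> bool" where
  "abs_le G R v w \<longleftrightarrow>
     int (reflection_length G R (w \<otimes>\<^bsub>G\<^esub> inv\<^bsub>G\<^esub> v)) =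
     int (reflection_length G R w) - int (reflection_length G R v)"

definition NC :: "('a, 'm) monoid_scheme \<Rightarrow> 'a set \<Rightarrow> 'a \<Rightarrow> 'a gorder" where
  "NC G R d = \<lparr>carrier = {x \<in> carrier G. abs_le G R x d}, eq = (=), le = abs_le G R\<rparr>"

definition pop_join :: "('a, 'm) monoid_scheme \<Rightarrow> 'a set \<Rightarrow> 'a \<Rightarrow> 'a \<Rightarrow> 'a" where
  "pop_join G R d w = \<Squnion>\<^bsub>NC G R d\<^esub> {t \<in> R. abs_le G R t w}"

definition Pop :: "('a, 'm) monoid_scheme \<Rightarrow> 'a set \<Rightarrow> 'a \<Rightarrow> 'a \<Rightarrow> 'a" where
  "Pop G R d w = w \<otimes>\<^bsub>G\<^esub> inv\<^bsub>G\<^esub> (pop_join G R d w)"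

end

theory Submission
  imports Defs Complex_Main "HOL-Library.Function_Algebras"
begin

text \<open>
  In the geometric representation with its positive definite form \<open>B\<close>, let \<open>Mov w\<close> be the image of
  \<open>w - 1\<close>. By Carter's lemma the reflection length of \<open>w\<close> is the dimension of \<open>Mov w\<close>, and a
  reflection lies below \<open>w\<close> iff its root lies in \<open>Mov w\<close>. The Coxeter element \<open>c\<close> carries a
  nonsymmetric form \<open>E\<close> with symmetrisation \<open>B\<close> and \<open>E f (c\<^sup>-\<^sup>1 g) = - E g f\<close>; it yields that on
  noncrossing elements the absolute order is inclusion of moved spaces, and that \<open>Mov y\<close> is the
  annihilator of \<open>Mov (c y\<^sup>-\<^sup>1)\<close>. Hence the join of the reflections below \<open>w\<close> is the noncrossing
  element \<open>x\<close> with the least \<open>Mov x\<close> containing \<open>Mov w\<close>, and it suffices to show that the unfolding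
  of this element is again least.

  Unfolding preserves positivity of roots, so averaging over the small group gives an equivariant map
  \<open>\<phi>\<close> between the geometric representations with positive coefficients. It takes a positive root \<open>\<rho>\<close>
  to a positive combination of the roots that the unfolding of its reflection negates, and a root \<open>\<sigma>\<close>
  of the big system with \<open>E (\<phi> \<rho>) \<sigma> = 0\<close> annihilates every one of these. A generic vector \<open>v\<close> in the
  cone of the positive roots whose images are annihilated by the annihilator of \<open>Mov (unfold w)\<close> is
  moved by a noncrossing \<open>x\<close>, found by alternately applying the two halves of \<open>c\<close> to \<open>v\<close> and
  stripping off coordinates that become negative. The same steps in the big system show that every root
  annihilating \<open>\<phi> v\<close> together with the positive roots it is composed of annihilates \<open>Mov (unfold x)\<close>;
  this is the minimality of the unfolded \<open>x\<close>.
\<close>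

text \<open>A folding need not come from a diagram automorphism (for instance \<open>A4\<close> onto
  the dihedral group of order 10), so the join in the big lattice cannot be recognised as a fixed
  point of a symmetry. Minimality therefore has to be tested against every noncrossing element of
  the big group, unfolded or not. Duality of moved spaces reduces this test to single roots
  \<open>\<sigma>\<close>, and the vectors annihilated by one root form a hyperplane; this is why
  all cone lemmas treat one \<open>\<sigma>\<close> at a time. For the same reason positivity of
  unfolding is obtained by counting: weighted inversion numbers of both systems agree at the longest
  element, because alternating products of the two halves gain as many inversions per step as
  possible, and the equality is then carried down to all elements. Cones rather than subspaces are
  needed because the decomposition of \<open>v\<close> depends on signs: a letter is stripped
  exactly when its coordinate turns negative. Since the coefficients of \<open>\<phi>\<close> are
  positive, this happens at once on the whole fibre of the letter, so both systems run through the
  same steps.\<close>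

instantiation "fun" :: (type, real_vector) real_vector
begin

definition scaleR_fun :: "real \<Rightarrow> ('a \<Rightarrow> 'b) \<Rightarrow> 'a \<Rightarrow> 'b" where
  "scaleR_fun r f = (\<lambda>x. r *\<^sub>R f x)"

instance
  by standard (auto simp: scaleR_fun_def fun_eq_iff scaleR_add_right scaleR_add_left)

end

lemma scaleR_fun_apply: "(r *\<^sub>R f) x = r *\<^sub>R f x"
  by (simp add: scaleR_fun_def)

lemma sum_fun_apply: "(\<Sum>a\<in>A. f a) x = (\<Sum>a\<in>A. f a x)"
  by (induction A rule: infinite_finite_induct) auto

lemmas fun_apply = plus_fun_apply zero_fun_apply minus_apply uminus_apply scaleR_fun_apply sum_fun_apply

text \<open>
  Under a binder the simplifier would turn a vector \<open>f + g\<close> into \<open>\<lambda>x. f x + g x\<close>, to which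
  the linearity lemmas below no longer apply; vectors are evaluated pointwise on request only.
\<close>

declare plus_fun_apply [simp del] zero_fun_apply [simp del] minus_apply [simp del] uminus_apply [simp del]

subsection \<open>Finite-dimensional subspaces\<close>

definition fin_dim :: "'v::real_vector set \<Rightarrow> bool" where
  "fin_dim A \<longleftrightarrow> (\<exists>F. finite F \<and> A \<subseteq> span F)"

lemma fin_dim_subset: "A \<subseteq> B \<Longrightarrow> fin_dim B \<Longrightarrow> fin_dim A"
  unfolding fin_dim_def by blast

lemma fin_dim_basis:
  assumes "fin_dim A"
  obtains B where "B \<subseteq> A" "independent B" "A \<subseteq> span B" "finite B" "card B = dim A"
proof -
  obtain F where F: "finite F" "A \<subseteq> span F" using assms by (auto simp: fin_dim_def)
  obtain B where B: "B \<subseteq> A" "independent B" "A \<subseteq> span B" "card B = dim A"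
    using real_vector.basis_exists by blast
  have "finite B" using real_vector.independent_span_bound[OF F(1) B(2)] B(1) F(2) by blast
  with B that show ?thesis by blast
qed

lemma card_independent_le_dim:
  assumes "fin_dim A" "independent B" "B \<subseteq> A"
  shows "finite B \<and> card B \<le> dim A"
proof -
  obtain C where C: "A \<subseteq> span C" "finite C" "card C = dim A"
    using fin_dim_basis[OF assms(1)] by metis
  then show ?thesis using real_vector.independent_span_bound[OF C(2) assms(2)] assms(3) by auto
qed

lemma dim_mono_fin: "A \<subseteq> B \<Longrightarrow> fin_dim B \<Longrightarrow> dim A \<le> dim B"
  by (metis fin_dim_basis order_trans real_vector.dim_le_card)

lemma dim_sum_le:
  assumes "fin_dim A" "fin_dim B" "\<And>x. x \<in> C \<Longrightarrow> \<exists>a\<in>A. \<exists>b\<in>B. x = a + b"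
  shows "dim C \<le> dim A + dim B"
proof -
  obtain X where X: "A \<subseteq> span X" "finite X" "card X = dim A"
    using fin_dim_basis[OF assms(1)] by metis
  obtain Y where Y: "B \<subseteq> span Y" "finite Y" "card Y = dim B"
    using fin_dim_basis[OF assms(2)] by metis
  have "C \<subseteq> span (X \<union> Y)"
    using assms(3) X(1) Y(1) by (fastforce simp: real_vector.span_Un)
  then have "dim C \<le> card (X \<union> Y)" using X Y by (intro real_vector.dim_le_card) auto
  then show ?thesis using card_Un_le[of X Y] X Y by simp
qed

lemma independent_Un_direct:
  assumes "independent X" "independent Y" "finite X" "finite Y" "span X \<inter> span Y \<subseteq> {0}"
  shows "independent (X \<union> Y) \<and> X \<inter> Y = {}"
proof
  show disj: "X \<inter> Y = {}"
  proof -
    have "x = 0" if "x \<in> X" "x \<in> Y" for x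
      using assms(5) that by (auto dest: real_vector.span_base)
    then show ?thesis using assms(1) real_vector.dependent_zero by blast
  qed
  show "independent (X \<union> Y)"
  proof (subst real_vector.independent_explicit_finite_subsets, intro allI impI ballI)
    fix A u v assume A: "A \<subseteq> X \<union> Y" "finite A" and s: "(\<Sum>v\<in>A. u v *\<^sub>R v) = 0" and v: "v \<in> A"
    have sp: "A = (A \<inter> X) \<union> (A \<inter> Y)" using A by blast
    have sum: "(\<Sum>v\<in>A. u v *\<^sub>R v) = (\<Sum>v\<in>A \<inter> X. u v *\<^sub>R v) + (\<Sum>v\<in>A \<inter> Y. u v *\<^sub>R v)"
      by (subst sp, rule sum.union_disjoint) (use A disj in auto)
    define x where "x = (\<Sum>v\<in>A \<inter> X. u v *\<^sub>R v)"
    define y where "y = (\<Sum>v\<in>A \<inter> Y. u v *\<^sub>R v)"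
    have xX: "x \<in> span X" unfolding x_def
      by (intro real_vector.span_sum real_vector.span_scale real_vector.span_base) auto
    have yY: "y \<in> span Y" unfolding y_def
      by (intro real_vector.span_sum real_vector.span_scale real_vector.span_base) auto
    have "x = - y" using s sum unfolding x_def y_def by (simp add: eq_neg_iff_add_eq_0)
    then have "x \<in> span Y" using yY real_vector.span_neg by blast
    then have x0: "x = 0" using xX assms(5) by blast
    then have y0: "y = 0" using \<open>x = - y\<close> by simp
    show "u v = 0"
    proof (cases "v \<in> X")
      case True
      then show ?thesis using assms(1) x0 v A unfolding real_vector.independent_explicit_finite_subsets x_def
        by (metis (no_types, lifting) Int_iff finite_Int inf_le2)
    next
      case False
      then have "v \<in> A \<inter> Y" using v A by blast
      then show ?thesis using assms(2) y0 A unfolding real_vector.independent_explicit_finite_subsets y_def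
        by (metis (no_types, lifting) finite_Int inf_le2)
    qed
  qed
qed

lemma dim_direct_le:
  assumes "subspace A" "subspace B" "A \<subseteq> C" "B \<subseteq> C" "fin_dim C" "A \<inter> B \<subseteq> {0}"
  shows "dim A + dim B \<le> dim C"
proof -
  have f: "fin_dim A" "fin_dim B" using assms fin_dim_subset by blast+
  obtain X where X: "X \<subseteq> A" "independent X" "A \<subseteq> span X" "finite X" "card X = dim A"
    using fin_dim_basis[OF f(1)] by metis
  obtain Y where Y: "Y \<subseteq> B" "independent Y" "B \<subseteq> span Y" "finite Y" "card Y = dim B"
    using fin_dim_basis[OF f(2)] by metis
  have "span X \<subseteq> A" "span Y \<subseteq> B"
    using X(1) Y(1) assms(1,2) real_vector.span_minimal by blast+
  then have "span X \<inter> span Y \<subseteq> {0}" using assms(6) by blast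
  then have i: "independent (X \<union> Y)" "X \<inter> Y = {}"
    using independent_Un_direct X Y by blast+
  have "card (X \<union> Y) \<le> dim C"
    using card_independent_le_dim[OF assms(5) i(1)] X(1) Y(1) assms(3,4) by blast
  then show ?thesis using card_Un_disjoint[OF X(4) Y(4) i(2)] X Y by simp
qed

lemma subspace_eq_of_dim:
  assumes "subspace A" "A \<subseteq> B" "fin_dim B" "dim B \<le> dim A"
  shows "A = B"
proof (rule ccontr)
  assume "A \<noteq> B"
  then obtain x where x: "x \<in> B" "x \<notin> A" using assms(2) by blast
  obtain X where X: "X \<subseteq> A" "independent X" "A \<subseteq> span X" "finite X" "card X = dim A"
    using fin_dim_basis fin_dim_subset[OF assms(2,3)] by metis
  have "span X \<subseteq> A" using X(1) assms(1) real_vector.span_minimal by blast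
  then have "x \<notin> span X" using x by blast
  then have i: "independent (insert x X)"
    using X(2) by (simp add: real_vector.independent_insert)
  have "insert x X \<subseteq> B" using x X(1) assms(2) by blast
  then have "card (insert x X) \<le> dim B" using card_independent_le_dim[OF assms(3) i] by blast
  moreover have "x \<notin> X" using x X(1) by blast
  ultimately show False using X assms(4) by simp
qed

text \<open>The sum of \<open>A\<close> and \<open>B\<close> has dimension at most
  \<open>dim A + dim B\<close>, so \<open>C\<close> fills it. This is how additivity of ranks is
  turned into inclusion of moved spaces.\<close>

lemma subset_of_dim_sum:
  assumes "subspace A" "subspace B" "fin_dim A" "fin_dim B" "subspace C"
    and sub: "\<And>x. x \<in> C \<Longrightarrow> \<exists>a\<in>A. \<exists>b\<in>B. x = a + b"
    and "dim A + dim B \<le> dim C"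
  shows "A \<subseteq> C \<and> B \<subseteq> C"
proof -
  let ?D = "{a + b | a b. a \<in> A \<and> b \<in> B}"
  have sD: "subspace ?D" using assms(1,2) by (rule real_vector.subspace_sums)
  have dD: "dim ?D \<le> dim A + dim B" by (rule dim_sum_le[OF assms(3,4)]) auto
  have fD: "fin_dim ?D"
  proof -
    obtain X Y where "finite X" "A \<subseteq> span X" "finite Y" "B \<subseteq> span Y"
      using assms(3,4) by (auto simp: fin_dim_def)
    then show ?thesis unfolding fin_dim_def
      by (intro exI[of _ "X \<union> Y"]) (fastforce simp: real_vector.span_Un)
  qed
  have "C \<subseteq> ?D" using sub by blast
  then have "C = ?D" using subspace_eq_of_dim[OF assms(5) _ fD] dD assms(7) by linarith
  moreover have "0 \<in> A" "0 \<in> B" using assms(1,2) real_vector.subspace_0 by blast+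
  then have "A \<subseteq> ?D" "B \<subseteq> ?D" by force+
  ultimately show ?thesis by blast
qed

subsection \<open>Convex cones\<close>

text \<open>Adding one ray at a time makes properties of a cone provable by induction over its
  generators, without naming coefficients.\<close>

inductive_set cone_hull :: "'v::real_vector set \<Rightarrow> 'v set" for A where
  zero: "0 \<in> cone_hull A"
| add: "x \<in> cone_hull A \<Longrightarrow> a \<in> A \<Longrightarrow> 0 \<le> r \<Longrightarrow> x + r *\<^sub>R a \<in> cone_hull A"

lemma cone_hull_base: "a \<in> A \<Longrightarrow> a \<in> cone_hull A"
  using cone_hull.add[OF cone_hull.zero, of a A 1] by simp

lemma cone_hull_add: "y \<in> cone_hull A \<Longrightarrow> x \<in> cone_hull A \<Longrightarrow> x + y \<in> cone_hull A"
  by (induction rule: cone_hull.induct) (auto simp: add.assoc[symmetric] intro: cone_hull.add)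

lemma cone_hull_scale: "x \<in> cone_hull A \<Longrightarrow> 0 \<le> r \<Longrightarrow> r *\<^sub>R x \<in> cone_hull A"
  by (induction rule: cone_hull.induct)
     (auto simp: scaleR_add_right intro: cone_hull.zero cone_hull.add)

lemma cone_hull_sum: "(\<And>i. i \<in> I \<Longrightarrow> f i \<in> cone_hull A) \<Longrightarrow> (\<Sum>i\<in>I. f i) \<in> cone_hull A"
  by (induction I rule: infinite_finite_induct) (auto intro: cone_hull.zero cone_hull_add)

lemma cone_hull_minimal:
  assumes "x \<in> cone_hull A" "A \<subseteq> cone_hull B"
  shows "x \<in> cone_hull B"
  using assms by (induction rule: cone_hull.induct)
    (auto intro: cone_hull.zero cone_hull_add cone_hull_scale)

lemma cone_hull_mono: "A \<subseteq> B \<Longrightarrow> cone_hull A \<subseteq> cone_hull B"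
  using cone_hull_minimal cone_hull_base by blast

lemma cone_hull_subset_span: "cone_hull A \<subseteq> span A"
proof
  fix x assume "x \<in> cone_hull A"
  then show "x \<in> span A" by induction
    (auto intro: real_vector.span_zero real_vector.span_add real_vector.span_scale real_vector.span_base)
qed

lemma cone_hull_image:
  assumes "x \<in> cone_hull A" "linear f" "f ` A \<subseteq> cone_hull B"
  shows "f x \<in> cone_hull B"
  using assms(1)
proof induction
  case zero
  then show ?case using assms(2) by (simp add: linear_0 cone_hull.zero)
next
  case (add x a r)
  then show ?case using assms(2,3)
    by (auto simp: linear_add linear_scale intro!: cone_hull_add cone_hull_scale)
qed

text \<open>Take \<open>v\<close> avoiding the earlier subspaces and \<open>u\<close> avoiding the
  new one. On the ray \<open>v + r u\<close> each subspace is met at most once, since two hits would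
  put both \<open>u\<close> and \<open>v\<close> into it; finitely many values of \<open>r\<close>
  are excluded.\<close>

lemma subspace_avoid:
  assumes "finite \<M>" "\<And>M. M \<in> \<M> \<Longrightarrow> subspace M" "\<And>M. M \<in> \<M> \<Longrightarrow> \<exists>x\<in>C. x \<notin> M"
    and "C \<noteq> {}" and closed: "\<And>x y r. x \<in> C \<Longrightarrow> y \<in> C \<Longrightarrow> 0 < r \<Longrightarrow> x + r *\<^sub>R y \<in> C"
  shows "\<exists>x\<in>C. \<forall>M\<in>\<M>. x \<notin> M"
  using assms(1-3)
proof (induction \<M> rule: finite_induct)
  case empty
  then show ?case using assms(4) by blast
next
  case (insert N \<M>)
  obtain v where v: "v \<in> C" "\<forall>M\<in>\<M>. v \<notin> M"
    using insert.IH insert.prems by (meson insertI2)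
  obtain u where u: "u \<in> C" "u \<notin> N" using insert.prems(2)[of N] by auto
  have one: "finite {r. 0 < r \<and> v + r *\<^sub>R u \<in> M}"
    if M: "M \<in> insert N \<M>" for M
  proof -
    have "r = r'" if r: "v + r *\<^sub>R u \<in> M" "v + r' *\<^sub>R u \<in> M" for r r'
    proof (rule ccontr)
      assume ne: "r \<noteq> r'"
      have sM: "subspace M" using insert.prems(1) M by blast
      have "(v + r *\<^sub>R u) - (v + r' *\<^sub>R u) \<in> M" using sM r by (rule real_vector.subspace_diff)
      then have "(r - r') *\<^sub>R u \<in> M" by (simp add: scaleR_diff_left)
      then have "(1 / (r - r')) *\<^sub>R (r - r') *\<^sub>R u \<in> M" using sM real_vector.subspace_scale by blast
      then have uM: "u \<in> M" using ne by simp
      then have "r *\<^sub>R u \<in> M" using sM real_vector.subspace_scale by blast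
      then have "(v + r *\<^sub>R u) - r *\<^sub>R u \<in> M" using sM r(1) real_vector.subspace_diff by blast
      then have "v \<in> M" by simp
      then show False using uM u v M by auto
    qed
    then have "\<exists>a. {r. 0 < r \<and> v + r *\<^sub>R u \<in> M} \<subseteq> {a}" by blast
    then show ?thesis using finite_subset by blast
  qed
  have "finite (\<Union>M\<in>insert N \<M>. {r. 0 < r \<and> v + r *\<^sub>R u \<in> M})"
    using one insert(1) by blast
  then have "infinite ({0<..} - (\<Union>M\<in>insert N \<M>. {r. 0 < r \<and> v + r *\<^sub>R u \<in> M}))"
    using infinite_Ioi Diff_infinite_finite by blast
  then have "\<exists>r::real. r \<in> {0<..} - (\<Union>M\<in>insert N \<M>. {r. 0 < r \<and> v + r *\<^sub>R u \<in> M})"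
    using infinite_imp_nonempty by blast
  then obtain r :: real where "0 < r" "\<forall>M\<in>insert N \<M>. v + r *\<^sub>R u \<notin> M" by auto
  then show ?case using closed[OF v(1) u(1)] by blast
qed

text \<open>Bolzano-Weierstrass, one coordinate at a time; it supplies the compactness of the unit
  sphere in \<open>exists_minimizer\<close>.\<close>

lemma convergent_subsequence_finite:
  fixes X :: "nat \<Rightarrow> 'a \<Rightarrow> real"
  assumes "finite S" "\<And>n s. s \<in> S \<Longrightarrow> \<bar>X n s\<bar> \<le> K"
  shows "\<exists>r. strict_mono r \<and> (\<forall>s\<in>S. convergent (\<lambda>n. X (r n) s))"
  using assms
proof (induction S rule: finite_induct)
  case empty
  then show ?case using strict_mono_id by blast
next
  case (insert a S)
  obtain r where r: "strict_mono r" "\<forall>s\<in>S. convergent (\<lambda>n. X (r n) s)" using insert by auto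
  obtain q where q: "strict_mono (q :: nat \<Rightarrow> nat)" "monoseq (\<lambda>n. X (r (q n)) a)"
    using seq_monosub[of "\<lambda>n. X (r n) a"] by auto
  have "Bseq (\<lambda>n. X (r (q n)) a)" using insert.prems by (intro BseqI'[of _ K]) auto
  then have "convergent (\<lambda>n. X (r (q n)) a)" using q(2) by (rule Bseq_monoseq_convergent)
  moreover have "convergent (\<lambda>n. X (r (q n)) s)" if "s \<in> S" for s
    using convergent_subseq_convergent[OF _ q(1), of "\<lambda>n. X (r n) s"] r(2) that by (simp add: comp_def)
  ultimately show ?case using strict_mono_o[OF r(1) q(1)]
    by (intro exI[of _ "r \<circ> q"]) (simp add: comp_def)
qed

subsection \<open>The geometric representation of a finite Coxeter system\<close>

definition simple_root :: "'a \<Rightarrow> 'a \<Rightarrow> real" where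
  "simple_root s = (\<lambda>t. if t = s then 1 else 0)"

lemma simple_root_apply: "simple_root s t = (if t = s then 1 else 0)"
  by (simp add: simple_root_def)

definition nonneg :: "('a \<Rightarrow> real) \<Rightarrow> bool" where
  "nonneg f \<longleftrightarrow> (\<forall>s. 0 \<le> f s)"

text \<open>The alternating word ending in \<open>t\<close>. The last letter is fixed rather than
  the first because words act on simple roots from the right end.\<close>

fun alt_word :: "'a \<Rightarrow> 'a \<Rightarrow> nat \<Rightarrow> 'a list" where
  "alt_word s t 0 = []"
| "alt_word s t (Suc n) = alt_word t s n @ [t]"

lemma length_alt_word [simp]: "length (alt_word s t n) = n"
  by (induction n arbitrary: s t) auto

lemma set_alt_word: "set (alt_word s t n) \<subseteq> {s, t}"
  by (induction n arbitrary: s t) fastforce+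

lemma alt_word_split:
  "n \<le> k \<Longrightarrow> \<exists>p. set p \<subseteq> {s, t} \<and> length p = k - n \<and> alt_word s t k = p @ alt_word s t n"
proof (induction n arbitrary: s t k)
  case 0
  then show ?case using set_alt_word by fastforce
next
  case (Suc n)
  obtain k' where k: "k = Suc k'" using Suc.prems by (cases k) auto
  then obtain p where "set p \<subseteq> {t, s}" "length p = k' - n" "alt_word t s k' = p @ alt_word t s n"
    using Suc.IH[of k' t s] Suc.prems by auto
  then show ?case using k by (intro exI[of _ p]) auto
qed

locale coxeter =
  fixes G :: "('a, 'm) monoid_scheme" (structure) and S :: "'a set"
  assumes coxeter: "coxeter_system G S" and finite_carrier: "finite (carrier G)"
begin

sublocale group G
  using coxeter by (simp add: coxeter_system_def)

abbreviation wp :: "'a list \<Rightarrow> 'a" where "wp \<equiv> word_prod G"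

lemma S_carrier: "S \<subseteq> carrier G"
  using coxeter by (simp add: coxeter_system_def)

lemma S_in [simp, intro]: "s \<in> S \<Longrightarrow> s \<in> carrier G"
  using S_carrier by blast

lemma finite_S [simp, intro]: "finite S"
  using S_carrier finite_carrier finite_subset by blast

lemma S_ord: "s \<in> S \<Longrightarrow> ord s = 2"
  using coxeter by (simp add: coxeter_system_def)

lemma S_sq [simp]: "s \<in> S \<Longrightarrow> s \<otimes> s = \<one>"
  using pow_ord_eq_1[of s] S_ord[of s] by (auto simp: numeral_2_eq_2)

lemma S_sq_cancel [simp]: "s \<in> S \<Longrightarrow> w \<in> carrier G \<Longrightarrow> w \<otimes> s \<otimes> s = w"
  by (simp add: m_assoc)

lemma S_sq_cancel_left [simp]: "s \<in> S \<Longrightarrow> w \<in> carrier G \<Longrightarrow> s \<otimes> (s \<otimes> w) = w"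
  by (simp add: m_assoc[symmetric])

lemma S_inv [simp]: "s \<in> S \<Longrightarrow> inv s = s"
  by (simp add: inv_equality)

lemma wp_Nil [simp]: "wp [] = \<one>"
  by (simp add: word_prod_def)

lemma wp_Cons [simp]: "wp (x # xs) = x \<otimes> wp xs"
  by (simp add: word_prod_def)

lemma wp_closed [simp, intro]: "set xs \<subseteq> S \<Longrightarrow> wp xs \<in> carrier G"
  by (induction xs) auto

lemma wp_append [simp]: "set xs \<subseteq> S \<Longrightarrow> set ys \<subseteq> S \<Longrightarrow> wp (xs @ ys) = wp xs \<otimes> wp ys"
  by (induction xs) (auto simp: m_assoc)

lemma wp_rev: "set xs \<subseteq> S \<Longrightarrow> wp (rev xs) = inv (wp xs)"
  by (induction xs) (auto simp: inv_mult_group)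

lemma wp_surj:
  assumes "w \<in> carrier G"
  shows "\<exists>xs. set xs \<subseteq> S \<and> wp xs = w"
proof -
  have "w \<in> generate G S" using assms coxeter by (simp add: coxeter_system_def)
  then show ?thesis
  proof induction
    case one
    show ?case by (intro exI[of _ "[]"]) simp
  next
    case (incl h)
    then show ?case by (intro exI[of _ "[h]"]) simp
  next
    case (inv h)
    then show ?case by (intro exI[of _ "[h]"]) simp
  next
    case (eng h1 h2)
    then obtain x y where "set x \<subseteq> S" "wp x = h1" "set y \<subseteq> S" "wp y = h2" by blast
    then show ?case by (intro exI[of _ "x @ y"]) simp
  qed
qed

text \<open>The diagonal needs no separate clause: for \<open>s = t\<close> the order is 1 and
  \<open>- cos pi = 1\<close>.\<close>

definition bm :: "'a \<Rightarrow> 'a \<Rightarrow> real" where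
  "bm s t = - cos (pi / real (ord (s \<otimes> t)))"

lemma ord_pos: "w \<in> carrier G \<Longrightarrow> 1 \<le> ord w"
  using finite_carrier ord_ge_1 by blast

lemma ord_S_sym:
  assumes "s \<in> S" "t \<in> S"
  shows "ord (s \<otimes> t) = ord (t \<otimes> s)"
proof -
  have "t \<otimes> s = inv (s \<otimes> t)" using assms by (simp add: inv_mult_group)
  then show ?thesis using assms by (simp add: ord_inv)
qed

lemma bm_sym: "s \<in> S \<Longrightarrow> t \<in> S \<Longrightarrow> bm s t = bm t s"
  by (simp add: bm_def ord_S_sym)

lemma bm_self [simp]: "s \<in> S \<Longrightarrow> bm s s = 1"
  by (simp add: bm_def)

lemma ord_ge_2:
  assumes "s \<in> S" "t \<in> S" "s \<noteq> t"
  shows "2 \<le> ord (s \<otimes> t)"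
proof (rule ccontr)
  assume "\<not> 2 \<le> ord (s \<otimes> t)"
  then have "ord (s \<otimes> t) = 1" using ord_pos[of "s \<otimes> t"] assms by auto
  then have "s \<otimes> t = \<one>" using assms ord_eq_1[of "s \<otimes> t"] by blast
  then have "s = inv t" using assms by (metis S_in inv_equality inv_inv inv_closed)
  then show False using assms by simp
qed

lemma bm_nonpos: "s \<in> S \<Longrightarrow> t \<in> S \<Longrightarrow> s \<noteq> t \<Longrightarrow> bm s t \<le> 0"
proof -
  assume st: "s \<in> S" "t \<in> S" "s \<noteq> t"
  have "pi / real (ord (s \<otimes> t)) \<le> pi / 2"
    using ord_ge_2[OF st] by (intro divide_left_mono) auto
  moreover have "0 \<le> pi / real (ord (s \<otimes> t))" by simp
  ultimately have "0 \<le> cos (pi / real (ord (s \<otimes> t)))" using pi_gt_zero by (intro cos_ge_zero) linarith+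
  then show ?thesis by (simp add: bm_def)
qed

lemma bm_eq_0_iff:
  assumes "s \<in> S" "t \<in> S" "s \<noteq> t"
  shows "bm s t = 0 \<longleftrightarrow> ord (s \<otimes> t) = 2"
proof
  assume "ord (s \<otimes> t) = 2"
  then show "bm s t = 0" by (simp add: bm_def)
next
  assume b: "bm s t = 0"
  show "ord (s \<otimes> t) = 2"
  proof (rule ccontr)
    assume "ord (s \<otimes> t) \<noteq> 2"
    then have "3 \<le> ord (s \<otimes> t)" using ord_ge_2[OF assms] by linarith
    then have "pi / real (ord (s \<otimes> t)) < pi / 2" by (simp add: divide_less_eq less_divide_eq)
    moreover have "0 \<le> pi / real (ord (s \<otimes> t))" by simp
    ultimately have "0 < cos (pi / real (ord (s \<otimes> t)))"
      using cos_gt_zero_pi[of "pi / real (ord (s \<otimes> t))"] pi_gt_zero by linarith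
    then show False using b by (simp add: bm_def)
  qed
qed

lemma bm_commute:
  assumes "s \<in> S" "t \<in> S" "s \<noteq> t" "s \<otimes> t = t \<otimes> s"
  shows "bm s t = 0"
proof -
  have "(s \<otimes> t) [^] (2::nat) = \<one>"
  proof -
    have "(s \<otimes> t) \<otimes> (s \<otimes> t) = (s \<otimes> t) \<otimes> (t \<otimes> s)" using assms(4) by simp
    also have "\<dots> = \<one>" using assms(1,2) by (simp add: m_assoc)
    finally show ?thesis using assms by (simp add: numeral_2_eq_2)
  qed
  then have "ord (s \<otimes> t) dvd 2" using assms pow_eq_id by auto
  then have "ord (s \<otimes> t) = 2" using ord_ge_2[OF assms(1-3)] by (auto dest: dvd_imp_le)
  then show ?thesis using bm_eq_0_iff assms by simp
qed

text \<open>Vectors are functions on the whole type; the support condition cuts out the span of the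
  simple roots of a standard parabolic subgroup. \<open>bf\<close> sees only coordinates in
  \<open>S\<close>, so definiteness and faithfulness are statements about
  \<open>V S\<close>.\<close>

definition V :: "'a set \<Rightarrow> ('a \<Rightarrow> real) set" where
  "V J = {f. \<forall>s. s \<notin> J \<longrightarrow> f s = 0}"

definition bf :: "('a \<Rightarrow> real) \<Rightarrow> ('a \<Rightarrow> real) \<Rightarrow> real" where
  "bf f g = (\<Sum>s\<in>S. \<Sum>t\<in>S. f s * g t * bm s t)"

lemma bf_add_left [simp]: "bf (f + g) h = bf f h + bf g h"
  by (simp add: bf_def fun_apply algebra_simps sum.distrib)

lemma bf_scale_left [simp]: "bf (r *\<^sub>R f) h = r * bf f h"
  by (simp add: bf_def fun_apply algebra_simps sum_distrib_left)

lemma bf_sym: "bf f g = bf g f"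
proof -
  have "bf f g = (\<Sum>t\<in>S. \<Sum>s\<in>S. f s * g t * bm s t)" unfolding bf_def by (rule sum.swap)
  also have "\<dots> = bf g f" unfolding bf_def
    by (intro sum.cong[OF HOL.refl]) (simp add: bm_sym mult.commute)
  finally show ?thesis .
qed

lemma bf_add_right [simp]: "bf f (g + h) = bf f g + bf f h"
  by (metis bf_sym bf_add_left)

lemma bf_scale_right [simp]: "bf f (r *\<^sub>R g) = r * bf f g"
  by (metis bf_sym bf_scale_left)

lemma bf_zero [simp]: "bf 0 f = 0" "bf f 0 = 0"
  by (simp_all add: bf_def fun_apply)

lemma bf_minus_left [simp]: "bf (- f) g = - bf f g"
  using bf_scale_left[of "-1" f g] by simp

lemma bf_minus_right [simp]: "bf f (- g) = - bf f g"
  using bf_scale_right[of f "-1" g] by simp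

lemma bf_diff_left [simp]: "bf (f - g) h = bf f h - bf g h"
  by (simp only: diff_conv_add_uminus bf_add_left bf_minus_left)

lemma bf_diff_right [simp]: "bf f (g - h) = bf f g - bf f h"
  by (simp only: diff_conv_add_uminus bf_add_right bf_minus_right)

lemma bf_sum_left [simp]: "bf (\<Sum>i\<in>I. f i) g = (\<Sum>i\<in>I. bf (f i) g)"
  using linear_sum[of "\<lambda>f. bf f g"] by (simp add: linear_iff)

lemma bf_sum_right [simp]: "bf g (\<Sum>i\<in>I. f i) = (\<Sum>i\<in>I. bf g (f i))"
  using linear_sum[of "bf g"] by (simp add: linear_iff)

lemma bf_simple_right: "s \<in> S \<Longrightarrow> bf f (simple_root s) = (\<Sum>t\<in>S. f t * bm t s)"
  unfolding bf_def by (intro sum.cong[OF HOL.refl])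
    (simp add: simple_root_def if_distrib[of "\<lambda>x. _ * x"] if_distrib[of "\<lambda>x. x * _"] cong: if_cong)

lemma bf_simple_simple [simp]: "s \<in> S \<Longrightarrow> t \<in> S \<Longrightarrow> bf (simple_root s) (simple_root t) = bm s t"
  by (simp add: bf_simple_right simple_root_apply if_distrib[of "\<lambda>x. x * _"] cong: if_cong)

definition refl :: "('a \<Rightarrow> real) \<Rightarrow> ('a \<Rightarrow> real) \<Rightarrow> ('a \<Rightarrow> real)" where
  "refl r f = f - (2 * bf f r) *\<^sub>R r"

lemma refl_add: "refl r (f + g) = refl r f + refl r g"
  by (simp add: refl_def algebra_simps)

lemma refl_scale: "refl r (k *\<^sub>R f) = k *\<^sub>R refl r f"
  by (simp add: refl_def scaleR_right_diff_distrib mult.left_commute)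

lemma bf_refl: "bf r r = 1 \<Longrightarrow> bf (refl r f) (refl r g) = bf f g"
  using bf_sym[of r g] by (simp add: refl_def algebra_simps)

lemma refl_refl: "bf r r = 1 \<Longrightarrow> refl r (refl r f) = f"
  by (simp add: refl_def algebra_simps)

abbreviation rf :: "'a \<Rightarrow> ('a \<Rightarrow> real) \<Rightarrow> ('a \<Rightarrow> real)" where
  "rf s \<equiv> refl (simple_root s)"

text \<open>The product of two simple reflections rotates their plane by \<open>2 * \<theta>\<close>
  and fixes its orthogonal complement, which explains the products of sines. Both corrections
  contain the factor \<open>sin (j * \<theta>)\<close>, which vanishes when \<open>j\<close> is the
  order of \<open>s \<otimes> t\<close>; this is the relation that the representation has to
  satisfy.\<close>

lemma dihedral_iterate:
  assumes st: "s \<in> S" "t \<in> S" "s \<noteq> t"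
  defines "\<theta> \<equiv> pi / real (ord (s \<otimes> t))"
  defines "x \<equiv> \<lambda>f. bf f (simple_root s)" and "y \<equiv> \<lambda>f. bf f (simple_root t)"
  shows "((rf s \<circ> rf t) ^^ j) f = f
     - (2 * sin (j * \<theta>) * (x f * sin (j * \<theta>) + y f * sin ((real j + 1) * \<theta>)) / (sin \<theta>)\<^sup>2) *\<^sub>R simple_root s
     - (2 * sin (j * \<theta>) * (x f * sin ((real j - 1) * \<theta>) + y f * sin (j * \<theta>)) / (sin \<theta>)\<^sup>2) *\<^sub>R simple_root t"
proof (induction j)
  case 0
  then show ?case by simp
next
  case (Suc j)
  define c where "c = cos \<theta>"
  have b: "bm s t = - c" "bm t s = - c" using st by (simp_all add: bm_def c_def \<theta>_def ord_S_sym)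
  have m: "2 \<le> ord (s \<otimes> t)" using ord_ge_2 st by blast
  then have "0 < \<theta>" "\<theta> < pi" by (auto simp: \<theta>_def field_simps)
  then have si: "sin \<theta> \<noteq> 0" using sin_gt_zero by force
  define D where "D = (sin \<theta>)\<^sup>2"
  have D: "D \<noteq> 0" using si by (simp add: D_def)
  define s0 s1 s2 sm where "s0 = sin (j * \<theta>)" "s1 = sin ((real j + 1) * \<theta>)"
    "s2 = sin ((real j + 2) * \<theta>)" "sm = sin ((real j - 1) * \<theta>)"
  note defs = s0_s1_s2_sm_def
  define C where "C = cos (j * \<theta>)"
  have e1: "s1 = s0 * c + C * sin \<theta>" by (simp add: defs C_def c_def algebra_simps sin_add)
  have em: "sm = s0 * c - C * sin \<theta>" by (simp add: defs C_def c_def algebra_simps sin_diff)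
  have e2: "s2 = s1 * c + cos ((real j + 1) * \<theta>) * sin \<theta>"
    using sin_add[of "(real j + 1) * \<theta>" \<theta>] by (simp add: defs c_def algebra_simps)
  have e0: "s0 = s1 * c - cos ((real j + 1) * \<theta>) * sin \<theta>"
    using sin_diff[of "(real j + 1) * \<theta>" \<theta>] by (simp add: defs c_def algebra_simps)
  have r1: "s1 + sm = 2 * c * s0" using e1 em by simp
  have r2: "s2 + s0 = 2 * c * s1" using e2 e0 by simp
  have CS: "C\<^sup>2 = 1 - s0\<^sup>2" "c\<^sup>2 = 1 - D"
    by (simp_all add: C_def defs c_def D_def cos_squared_eq)
  \<comment> \<open>Law of cosines for consecutive sines. It replaces the factor \<open>D\<close> in
    \<open>Y * D\<close> and \<open>X * D\<close> below, so that the new coefficients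
    factor.\<close>
  have I: "s1\<^sup>2 + s0\<^sup>2 - 2 * c * s0 * s1 = D"
  proof -
    have "s1\<^sup>2 + s0\<^sup>2 - 2 * c * s0 * s1 = s0\<^sup>2 * (1 - c\<^sup>2) + C\<^sup>2 * (sin \<theta>)\<^sup>2"
      unfolding e1 by (simp add: power2_eq_square algebra_simps)
    then show ?thesis using CS by (simp add: D_def algebra_simps)
  qed
  define X Y where "X = x f" "Y = y f"
  define p q where "p = - (2 * s0 * (X * s0 + Y * s1) / D)" "q = - (2 * s0 * (X * sm + Y * s0) / D)"
  \<comment> \<open>\<open>q'\<close> and \<open>p'\<close> are the coefficients after applying
    first \<open>rf t\<close> and then \<open>rf s\<close>.\<close>
  define q' where "q' = - q - 2 * Y + 2 * c * p"
  define p' where "p' = - p - 2 * X + 2 * c * q'"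
  have q': "q' = - (2 * s1 * (X * s0 + Y * s1) / D)"
  proof -
    have "q' * D = 2 * s0 * (X * sm + Y * s0) - 2 * Y * D - 4 * c * s0 * (X * s0 + Y * s1)"
      using D by (simp add: q'_def p_q_def field_simps)
    also have "\<dots> = - 2 * s1 * (X * s0 + Y * s1)"
      unfolding I[symmetric] eq_diff_eq[THEN iffD2, OF r1[unfolded add.commute[of s1]]]
      by (simp add: power2_eq_square algebra_simps)
    finally show ?thesis using D by (simp add: field_simps)
  qed
  have p': "p' = - (2 * s1 * (X * s1 + Y * s2) / D)"
  proof -
    have "p' * D = 2 * s0 * (X * s0 + Y * s1) - 2 * X * D - 4 * c * s1 * (X * s0 + Y * s1)"
      using D by (simp add: p'_def q' p_q_def field_simps)
    also have "\<dots> = - 2 * s1 * (X * s1 + Y * s2)"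
      unfolding I[symmetric] eq_diff_eq[THEN iffD2, OF r2]
      by (simp add: power2_eq_square algebra_simps)
    finally show ?thesis using D by (simp add: field_simps)
  qed
  have IH: "((rf s \<circ> rf t) ^^ j) f = f + p *\<^sub>R simple_root s + q *\<^sub>R simple_root t"
    unfolding Suc.IH by (simp add: p_q_def X_Y_def defs D_def)
  have t: "rf t (f + p *\<^sub>R simple_root s + q *\<^sub>R simple_root t) = f + p *\<^sub>R simple_root s + q' *\<^sub>R simple_root t"
  proof -
    have "bf (f + p *\<^sub>R simple_root s + q *\<^sub>R simple_root t) (simple_root t) = Y - c * p + q"
      using st b by (simp add: X_Y_def y_def)
    moreover define K where "K = 2 * (Y - c * p + q)"
    moreover have "q' = q - K" by (simp add: q'_def K_def)
    ultimately show ?thesis unfolding refl_def by (simp only: scaleR_diff_left) (simp add: algebra_simps)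
  qed
  have s: "rf s (f + p *\<^sub>R simple_root s + q' *\<^sub>R simple_root t) = f + p' *\<^sub>R simple_root s + q' *\<^sub>R simple_root t"
  proof -
    have "bf (f + p *\<^sub>R simple_root s + q' *\<^sub>R simple_root t) (simple_root s) = X + p - c * q'"
      using st b by (simp add: X_Y_def x_def)
    moreover define K where "K = 2 * (X + p - c * q')"
    moreover have "p' = p - K" by (simp add: p'_def K_def)
    ultimately show ?thesis unfolding refl_def by (simp only: scaleR_diff_left) (simp add: algebra_simps)
  qed
  have r: "real j + 1 + 1 = real j + 2" "real j + 1 - 1 = real j" "real (Suc j) = real j + 1"
    by simp_all
  have pA: "p' = - (2 * sin (real (Suc j) * \<theta>) * (x f * sin (real (Suc j) * \<theta>)
      + y f * sin ((real (Suc j) + 1) * \<theta>)) / (sin \<theta>)\<^sup>2)"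
    unfolding r p' X_Y_def defs D_def ..
  have qA: "q' = - (2 * sin (real (Suc j) * \<theta>) * (x f * sin ((real (Suc j) - 1) * \<theta>)
      + y f * sin (real (Suc j) * \<theta>)) / (sin \<theta>)\<^sup>2)"
    unfolding r q' X_Y_def defs D_def ..
  have "((rf s \<circ> rf t) ^^ Suc j) f = f + p' *\<^sub>R simple_root s + q' *\<^sub>R simple_root t"
    using IH s t by (simp only: funpow.simps o_apply)
  then show ?case unfolding pA qA by (simp only: scaleR_minus_left add_uminus_conv_diff)
qed

lemma dihedral_relation:
  assumes "s \<in> S" "t \<in> S"
  shows "((rf s \<circ> rf t) ^^ ord (s \<otimes> t)) f = f"
proof (cases "s = t")
  case True
  then show ?thesis using assms by (simp add: refl_refl)
next
  case False
  have "real (ord (s \<otimes> t)) \<noteq> 0" using ord_ge_2[OF assms False] by linarith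
  then show ?thesis using dihedral_iterate[OF assms False, of "ord (s \<otimes> t)" f] by simp
qed

section \<open>The action of the group on vectors\<close>

definition wact :: "'a list \<Rightarrow> ('a \<Rightarrow> real) \<Rightarrow> ('a \<Rightarrow> real)" where
  "wact xs = foldr rf xs"

lemma wact_Nil [simp]: "wact [] f = f"
  by (simp add: wact_def)

lemma wact_Cons [simp]: "wact (x # xs) f = rf x (wact xs f)"
  by (simp add: wact_def)

lemma wact_append [simp]: "wact (xs @ ys) f = wact xs (wact ys f)"
  by (simp add: wact_def)

lemma wact_replicate: "wact (concat (replicate n [s, t])) f = ((rf s \<circ> rf t) ^^ n) f"
  by (induction n) auto

lemma coxeter_cong_wact: "coxeter_cong G S u v \<Longrightarrow> wact u = wact v"
proof (induction rule: coxeter_cong.induct)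
  case (rel u v s t)
  then show ?case by (auto simp: fun_eq_iff wact_replicate dihedral_relation)
qed auto

text \<open>Every relator has even length. This is the sign character, and it rules out
  \<open>len (v \<otimes> s) = len v\<close>.\<close>

lemma coxeter_cong_parity: "coxeter_cong G S u v \<Longrightarrow> even (length u) = even (length v)"
proof (induction rule: coxeter_cong.induct)
  case (rel u v s t)
  have "length (concat (replicate n [s, t])) = 2 * n" for n by (induction n) auto
  then show ?case by auto
qed auto

lemma wp_eq_cong: "set u \<subseteq> S \<Longrightarrow> set v \<subseteq> S \<Longrightarrow> wp u = wp v \<Longrightarrow> coxeter_cong G S u v"
  using coxeter by (auto simp: coxeter_system_def lists_eq_set)

text \<open>The choice of the word is immaterial: words with equal product are congruent by the
  presentation, and congruent words act alike (\<open>coxeter_cong_wact\<close>).\<close>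

definition act :: "'a \<Rightarrow> ('a \<Rightarrow> real) \<Rightarrow> ('a \<Rightarrow> real)" where
  "act w = wact (SOME xs. set xs \<subseteq> S \<and> wp xs = w)"

lemma act_wp: "set xs \<subseteq> S \<Longrightarrow> act (wp xs) = wact xs"
  unfolding act_def
  by (rule someI2[of _ xs]) (auto intro: coxeter_cong_wact wp_eq_cong)

lemma act_S [simp]: "s \<in> S \<Longrightarrow> act s = rf s"
  using act_wp[of "[s]"] by (auto simp: fun_eq_iff)

lemma act_one [simp]: "act \<one> f = f"
  using act_wp[of "[]"] by simp

lemma act_mult [simp]:
  assumes "u \<in> carrier G" "v \<in> carrier G"
  shows "act (u \<otimes> v) f = act u (act v f)"
proof -
  obtain x y where "set x \<subseteq> S" "wp x = u" "set y \<subseteq> S" "wp y = v" using wp_surj assms by metis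
  then show ?thesis using act_wp[of x] act_wp[of y] act_wp[of "x @ y"] by simp
qed

lemma act_inv [simp]: "w \<in> carrier G \<Longrightarrow> act (inv w) (act w f) = f" "w \<in> carrier G \<Longrightarrow> act w (act (inv w) f) = f"
  by (metis act_mult act_one inv_closed l_inv, metis act_mult act_one inv_closed r_inv)

lemma group_induct [consumes 1, case_names one mult]:
  assumes "w \<in> carrier G" "P \<one>" "\<And>s w. s \<in> S \<Longrightarrow> w \<in> carrier G \<Longrightarrow> P w \<Longrightarrow> P (s \<otimes> w)"
  shows "P w"
proof -
  obtain xs where "set xs \<subseteq> S" "wp xs = w" using wp_surj assms(1) by blast
  moreover have "set xs \<subseteq> S \<Longrightarrow> P (wp xs)" for xs
    by (induction xs) (auto intro: assms)
  ultimately show ?thesis by blast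
qed

lemma act_linear: "w \<in> carrier G \<Longrightarrow> linear (act w)"
proof (induction rule: group_induct)
  case one
  then show ?case by (simp add: linear_iff)
next
  case (mult s w)
  then show ?case by (auto simp: linear_iff refl_add refl_scale)
qed

lemma act_add [simp]: "w \<in> carrier G \<Longrightarrow> act w (f + g) = act w f + act w g"
  by (rule linear_add[OF act_linear])

lemma act_scale [simp]: "w \<in> carrier G \<Longrightarrow> act w (r *\<^sub>R f) = r *\<^sub>R act w f"
  by (rule linear_scale[OF act_linear])

lemma act_diff [simp]: "w \<in> carrier G \<Longrightarrow> act w (f - g) = act w f - act w g"
  by (rule linear_diff[OF act_linear])

lemma act_minus [simp]: "w \<in> carrier G \<Longrightarrow> act w (- f) = - act w f"
  by (rule linear_neg[OF act_linear])

lemma act_zero [simp]: "w \<in> carrier G \<Longrightarrow> act w 0 = 0"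
  by (rule linear_0[OF act_linear])

lemma act_sum: "w \<in> carrier G \<Longrightarrow> act w (\<Sum>i\<in>I. h i) = (\<Sum>i\<in>I. act w (h i))"
  by (rule linear_sum[OF act_linear])

lemma bf_act [simp]: "w \<in> carrier G \<Longrightarrow> bf (act w f) (act w g) = bf f g"
  by (induction arbitrary: f g rule: group_induct) (auto simp: bf_refl)

lemma bf_act_left: "w \<in> carrier G \<Longrightarrow> bf (act w f) g = bf f (act (inv w) g)"
  by (metis act_inv(2) bf_act)

lemma V_subspace: "subspace (V J)"
  by (auto simp: V_def real_vector.subspace_def fun_apply)

lemma V_mono: "J \<subseteq> K \<Longrightarrow> V J \<subseteq> V K"
  by (auto simp: V_def)

lemma simple_root_V: "s \<in> J \<Longrightarrow> simple_root s \<in> V J"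
  by (auto simp: V_def simple_root_def)

lemma refl_V: "r \<in> V J \<Longrightarrow> f \<in> V J \<Longrightarrow> refl r f \<in> V J"
  by (auto simp: V_def refl_def fun_apply)

lemma act_V: "w \<in> carrier G \<Longrightarrow> f \<in> V S \<Longrightarrow> act w f \<in> V S"
  by (induction rule: group_induct) (auto intro: refl_V simple_root_V)

lemma V_expand:
  assumes "f \<in> V J" "finite J"
  shows "f = (\<Sum>s\<in>J. f s *\<^sub>R simple_root s)"
proof (rule ext)
  fix t
  show "f t = (\<Sum>s\<in>J. f s *\<^sub>R simple_root s) t"
  proof -
    have "(\<Sum>s\<in>J. f s *\<^sub>R simple_root s) t = (\<Sum>s\<in>J. if s = t then f t else 0)"
      unfolding fun_apply by (intro sum.cong) (auto simp: simple_root_apply)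
    then show ?thesis using assms by (auto simp: V_def)
  qed
qed

lemma V_subset_span: "finite J \<Longrightarrow> V J \<subseteq> span (simple_root ` J)"
proof (rule subsetI)
  fix f assume "finite J" "f \<in> V J"
  then have "f = (\<Sum>s\<in>J. f s *\<^sub>R simple_root s)" using V_expand by blast
  also have "\<dots> \<in> span (simple_root ` J)"
    by (intro real_vector.span_sum real_vector.span_scale real_vector.span_base) auto
  finally show "f \<in> span (simple_root ` J)" .
qed

lemma fin_dim_V: "finite J \<Longrightarrow> fin_dim (V J)"
  unfolding fin_dim_def using V_subset_span by blast

section \<open>Length, descents and the sign of roots\<close>

definition len :: "'a \<Rightarrow> nat" where
  "len w = (LEAST n. \<exists>xs. set xs \<subseteq> S \<and> length xs = n \<and> wp xs = w)"

lemma len_le: "set xs \<subseteq> S \<Longrightarrow> len (wp xs) \<le> length xs"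
  unfolding len_def by (rule Least_le) auto

lemma len_word:
  assumes "w \<in> carrier G"
  shows "\<exists>xs. set xs \<subseteq> S \<and> length xs = len w \<and> wp xs = w"
  unfolding len_def by (rule LeastI_ex) (use wp_surj[OF assms] in auto)

lemma len_mult_word_le:
  assumes "v \<in> carrier G" "set u \<subseteq> S"
  shows "len (v \<otimes> wp u) \<le> len v + length u"
proof -
  obtain xs where "set xs \<subseteq> S" "length xs = len v" "wp xs = v" using len_word assms by blast
  then show ?thesis using len_le[of "xs @ u"] assms(2) by simp
qed

lemma len_mult_le: "v \<in> carrier G \<Longrightarrow> s \<in> S \<Longrightarrow> len (v \<otimes> s) \<le> Suc (len v)"
  using len_mult_word_le[of v "[s]"] by simp

lemma len_mult_ne:
  assumes "v \<in> carrier G" "s \<in> S"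
  shows "len (v \<otimes> s) \<noteq> len v"
proof
  assume e: "len (v \<otimes> s) = len v"
  obtain xs where xs: "set xs \<subseteq> S" "length xs = len v" "wp xs = v" using len_word assms by blast
  obtain ys where ys: "set ys \<subseteq> S" "length ys = len (v \<otimes> s)" "wp ys = v \<otimes> s"
    using len_word assms by (meson S_in m_closed)
  have "coxeter_cong G S (xs @ [s]) ys" by (rule wp_eq_cong) (use xs ys assms in auto)
  then show False using coxeter_cong_parity xs ys e by fastforce
qed

lemma len_one [simp]: "len \<one> = 0"
  using len_le[of "[]"] by simp

lemma descent_exists:
  assumes "w \<in> carrier G" "w \<noteq> \<one>"
  shows "\<exists>t\<in>S. len (w \<otimes> t) < len w"
proof -
  obtain xs where xs: "set xs \<subseteq> S" "length xs = len w" "wp xs = w" using len_word assms by blast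
  then have "xs \<noteq> []" using assms(2) by auto
  then obtain ys t where yt: "xs = ys @ [t]" by (metis rev_exhaust)
  then have "wp ys = w \<otimes> t" "t \<in> S" using xs by auto
  moreover have "len (wp ys) \<le> length ys" "length ys < len w" using len_le[of ys] xs yt by auto
  ultimately show ?thesis by force
qed

lemma wact_add [simp]: "wact xs (f + g) = wact xs f + wact xs g"
  by (induction xs) (simp_all add: refl_add)

lemma wact_scale [simp]: "wact xs (k *\<^sub>R f) = k *\<^sub>R wact xs f"
  by (induction xs) (simp_all add: refl_scale)

lemma wact_minus [simp]: "wact xs (- f) = - wact xs f"
  using wact_scale[of xs "-1" f] by simp

lemma dihedral_angle:
  assumes "s \<in> S" "t \<in> S" "s \<noteq> t"
  shows "0 < pi / real (ord (s \<otimes> t))" "pi / real (ord (s \<otimes> t)) < pi"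
proof -
  have "2 \<le> real (ord (s \<otimes> t))" using ord_ge_2[OF assms] by simp
  then show "0 < pi / real (ord (s \<otimes> t))" "pi / real (ord (s \<otimes> t)) < pi"
    by (simp_all add: divide_less_eq)
qed

text \<open>The roots of a dihedral group lie on a circle at steps of \<open>\<theta>\<close>; the
  coefficients are Chebyshev values and obey a two-term recurrence, hence the induction in steps of
  two. Each further letter exchanges the roles of \<open>s\<close> and \<open>t\<close>, which
  accounts for the parity cases.\<close>

lemma alt_word_root:
  assumes "s \<in> S" "t \<in> S" "s \<noteq> t" "\<theta> = pi / real (ord (s \<otimes> t))"
  shows "wact (alt_word s t q) (simple_root s) =
    (sin ((real q + 1) * \<theta>) / sin \<theta>) *\<^sub>R simple_root (if even q then s else t) +
    (sin (real q * \<theta>) / sin \<theta>) *\<^sub>R simple_root (if even q then t else s)"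
  using assms
proof (induction q arbitrary: s t rule: induct_nat_012)
  case 0
  have "0 < \<theta>" "\<theta> < pi" using dihedral_angle[OF 0(1-3)] 0(4) by simp_all
  then have "sin \<theta> \<noteq> 0" using sin_gt_zero by force
  then show ?case by simp
next
  case 1
  have "0 < \<theta>" "\<theta> < pi" using dihedral_angle[OF 1(1-3)] 1(4) by simp_all
  then have si: "sin \<theta> \<noteq> 0" using sin_gt_zero by force
  have "bm s t = - cos \<theta>" using 1 by (simp add: bm_def)
  then have "rf t (simple_root s) = simple_root s + (2 * cos \<theta>) *\<^sub>R simple_root t"
    using 1 by (simp add: refl_def)
  moreover have "sin (2 * \<theta>) / sin \<theta> = 2 * cos \<theta>" using si by (simp add: sin_double)
  ultimately show ?case using si by (simp add: add.commute)
next
  case (ge2 n)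
  have "0 < \<theta>" "\<theta> < pi" using dihedral_angle[OF ge2(3-5)] ge2(6) by simp_all
  then have si: "sin \<theta> \<noteq> 0" using sin_gt_zero by force
  define X where "X = simple_root (if even n then s else t)"
  define Y where "Y = simple_root (if even n then t else s)"
  have b: "bm s t = - cos \<theta>" using ge2 by (simp add: bm_def)
  then have r: "rf t (simple_root s) = simple_root s + (2 * cos \<theta>) *\<^sub>R simple_root t"
    using ge2 by (simp add: refl_def)
  have r2: "rf s (simple_root s) = - simple_root s" using ge2 by (simp add: refl_def scaleR_2)
  have th: "\<theta> = pi / real (ord (t \<otimes> s))" using ge2(6) ord_S_sym[OF ge2(3,4)] by simp
  have A: "wact (alt_word s t n) (simple_root s) = (sin ((real n + 1) * \<theta>) / sin \<theta>) *\<^sub>R X + (sin (real n * \<theta>) / sin \<theta>) *\<^sub>R Y"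
    using ge2(1)[OF ge2(3-6)] by (simp add: X_def Y_def)
  have B: "wact (alt_word t s (Suc n)) (simple_root t) = (sin ((real n + 2) * \<theta>) / sin \<theta>) *\<^sub>R X + (sin ((real n + 1) * \<theta>) / sin \<theta>) *\<^sub>R Y"
    using ge2(2)[OF ge2(4,3) ge2(5)[symmetric] th]
    by (simp add: X_def Y_def add.commute)
  have s2: "sin ((real n + 2) * \<theta>) + sin (real n * \<theta>) = 2 * cos \<theta> * sin ((real n + 1) * \<theta>)"
    using sin_add[of "(real n + 1) * \<theta>" \<theta>] sin_diff[of "(real n + 1) * \<theta>" \<theta>] by (simp add: algebra_simps)
  have s3: "sin ((real n + 3) * \<theta>) + sin ((real n + 1) * \<theta>) = 2 * cos \<theta> * sin ((real n + 2) * \<theta>)"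
    using sin_add[of "(real n + 2) * \<theta>" \<theta>] sin_diff[of "(real n + 2) * \<theta>" \<theta>] by (simp add: algebra_simps)
  have s2': "2 * cos \<theta> * (sin ((real n + 1) * \<theta>) / sin \<theta>) - sin (real n * \<theta>) / sin \<theta> = sin ((real n + 2) * \<theta>) / sin \<theta>"
    using si s2 by (simp add: field_simps)
  have s3': "2 * cos \<theta> * (sin ((real n + 2) * \<theta>) / sin \<theta>) - sin ((real n + 1) * \<theta>) / sin \<theta> = sin ((real n + 3) * \<theta>) / sin \<theta>"
    using si s3 by (simp add: field_simps)
  have "alt_word s t (Suc (Suc n)) = alt_word t s (Suc n) @ [t]" by simp
  then have "wact (alt_word s t (Suc (Suc n))) (simple_root s) =
      wact (alt_word t s (Suc n)) (simple_root s) + (2 * cos \<theta>) *\<^sub>R wact (alt_word t s (Suc n)) (simple_root t)"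
    by (simp only: wact_append wact_Cons wact_Nil r wact_add wact_scale)
  also have "wact (alt_word t s (Suc n)) (simple_root s) = - wact (alt_word s t n) (simple_root s)"
    by (simp add: r2)
  also have "- wact (alt_word s t n) (simple_root s) + (2 * cos \<theta>) *\<^sub>R wact (alt_word t s (Suc n)) (simple_root t)
     = (2 * cos \<theta> * (sin ((real n + 2) * \<theta>) / sin \<theta>) - sin ((real n + 1) * \<theta>) / sin \<theta>) *\<^sub>R X
     + (2 * cos \<theta> * (sin ((real n + 1) * \<theta>) / sin \<theta>) - sin (real n * \<theta>) / sin \<theta>) *\<^sub>R Y"
    unfolding A B by (simp only: scaleR_diff_left scaleR_add_right scaleR_scaleR) simp
  also have "\<dots> = (sin ((real n + 3) * \<theta>) / sin \<theta>) *\<^sub>R X + (sin ((real n + 2) * \<theta>) / sin \<theta>) *\<^sub>R Y"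
    by (simp only: s2' s3')
  finally show ?case by (simp add: X_def Y_def add.commute)
qed

lemma alt_word_root_nonneg:
  assumes "s \<in> S" "t \<in> S" "s \<noteq> t" "q < ord (s \<otimes> t)"
  shows "\<exists>a b. 0 \<le> a \<and> 0 \<le> b \<and> wact (alt_word s t q) (simple_root s) = a *\<^sub>R simple_root s + b *\<^sub>R simple_root t"
proof -
  define \<theta> where "\<theta> = pi / real (ord (s \<otimes> t))"
  have m: "2 \<le> ord (s \<otimes> t)" using ord_ge_2[OF assms(1-3)] .
  have th: "0 < \<theta>" "\<theta> < pi" using dihedral_angle[OF assms(1-3)] by (simp_all add: \<theta>_def)
  have sn: "0 \<le> sin (real k * \<theta>)" if "k \<le> ord (s \<otimes> t)" for k
  proof (rule sin_ge_zero)
    show "0 \<le> real k * \<theta>" using th by simp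
    have "real k * \<theta> \<le> real (ord (s \<otimes> t)) * \<theta>" using that th by (intro mult_right_mono) auto
    also have "\<dots> = pi" using m by (simp add: \<theta>_def)
    finally show "real k * \<theta> \<le> pi" .
  qed
  have "0 \<le> sin (real q * \<theta>)" "0 \<le> sin ((real q + 1) * \<theta>)" "0 \<le> sin \<theta>"
    using sn[of q] sn[of "Suc q"] sn[of 1] assms(4) m by (auto simp: add.commute)
  then have nn: "0 \<le> sin (real q * \<theta>) / sin \<theta>" "0 \<le> sin ((real q + 1) * \<theta>) / sin \<theta>" by auto
  note f = alt_word_root[OF assms(1-3) \<theta>_def, of q]
  show ?thesis
  proof (cases "even q")
    case True
    then show ?thesis using f nn by auto
  next
    case False
    then have "wact (alt_word s t q) (simple_root s) = (sin (real q * \<theta>) / sin \<theta>) *\<^sub>R simple_root s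
       + (sin ((real q + 1) * \<theta>) / sin \<theta>) *\<^sub>R simple_root t"
      using f by (simp add: add.commute)
    then show ?thesis using nn by blast
  qed
qed

text \<open>A repeated letter would cancel and shorten the word, so the letters alternate.\<close>

lemma reduced_dihedral_word:
  assumes "s \<in> S" "t \<in> S" "set u \<subseteq> {s, t}"
    and "\<And>u'. set u' \<subseteq> {s, t} \<Longrightarrow> wp u' = wp u \<Longrightarrow> length u \<le> length u'"
  shows "u = alt_word s t (length u) \<or> u = alt_word t s (length u)"
  using assms(3,4)
proof (induction u rule: rev_induct)
  case Nil
  then show ?case by simp
next
  case (snoc r u)
  have uS: "set u \<subseteq> S" and rS: "r \<in> S" using snoc.prems(1) assms(1,2) by auto
  have "length u \<le> length u'" if u': "set u' \<subseteq> {s, t}" "wp u' = wp u" for u'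
  proof -
    have "set u' \<subseteq> S" using u'(1) assms(1,2) by auto
    then show ?thesis using snoc.prems(2)[of "u' @ [r]"] u' uS rS snoc.prems(1) by simp
  qed
  then have IH: "u = alt_word s t (length u) \<or> u = alt_word t s (length u)"
    using snoc.IH snoc.prems(1) by auto
  show ?case
  proof (cases "length u")
    case 0
    then show ?thesis using snoc.prems(1) by auto
  next
    case (Suc n)
    have *: "u @ [r] = alt_word y x (length (u @ [r]))"
      if u: "u = alt_word x y (length u)" and xy: "{x, y} = {s, t}" for x y
    proof -
      have ue: "u = alt_word y x n @ [y]" using u Suc by simp
      have "r \<noteq> y"
      proof
        assume "r = y"
        moreover have "set (alt_word y x n) \<subseteq> S" "y \<in> S"
          using ue uS by (metis set_append Un_subset_iff, metis set_append Un_subset_iff list.set_intros(1) subset_code(1))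
        ultimately have e: "wp (alt_word y x n) = wp (u @ [r])" using ue by simp
        have "set (alt_word y x n) \<subseteq> {s, t}" using set_alt_word[of y x n] xy by blast
        from snoc.prems(2)[OF this e] show False using Suc by simp
      qed
      then have "r = x" using snoc.prems(1) xy by auto
      then show ?thesis using u by simp
    qed
    show ?thesis using IH *[of s t] *[of t s] by (auto simp del: alt_word.simps)
  qed
qed

lemma wp_alt_word_double:
  assumes "s \<in> S" "t \<in> S"
  shows "wp (alt_word s t (2 * n)) = (s \<otimes> t) [^] n"
proof (induction n)
  case (Suc n)
  have "alt_word s t (2 * Suc n) = alt_word s t (2 * n) @ [s, t]" by simp
  moreover have "set (alt_word s t (2 * n)) \<subseteq> S" using set_alt_word[of s t] assms by blast
  ultimately show ?case using Suc assms by simp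
qed simp

text \<open>With \<open>m\<close> the order of \<open>s \<otimes> t\<close>, the alternating word of
  length \<open>2 * m\<close> is trivial, so its last \<open>m + 1\<close> letters equal the inverse
  of its first \<open>m - 1\<close>. Exchanging them in the word of length \<open>q + 1\<close>
  leaves \<open>q - 1\<close> letters.\<close>

lemma alt_word_shorten:
  assumes "s \<in> S" "t \<in> S" "s \<noteq> t" "ord (s \<otimes> t) \<le> q"
  shows "\<exists>u. set u \<subseteq> {s, t} \<and> length u < q \<and> wp u = wp (alt_word s t q) \<otimes> s"
proof -
  let ?m = "ord (s \<otimes> t)"
  have m: "2 \<le> ?m" using ord_ge_2[OF assms(1-3)] .
  have one: "wp (alt_word t s (2 * ?m)) = \<one>"
    using wp_alt_word_double[OF assms(2,1)] ord_S_sym[OF assms(1,2)] assms by simp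
  have inS: "set x \<subseteq> S" if "set x \<subseteq> {s, t}" for x using that assms by blast
  obtain p where p: "set p \<subseteq> {t, s}" "length p = 2 * ?m - Suc ?m" "alt_word t s (2 * ?m) = p @ alt_word t s (Suc ?m)"
    using alt_word_split[of "Suc ?m" "2 * ?m" t s] m by auto
  obtain p' where p': "set p' \<subseteq> {t, s}" "length p' = Suc q - Suc ?m" "alt_word t s (Suc q) = p' @ alt_word t s (Suc ?m)"
    using alt_word_split[of "Suc ?m" "Suc q" t s] assms(4) by auto
  have a: "set (alt_word t s (Suc ?m)) \<subseteq> S" using set_alt_word[of t s] assms by blast
  have pS: "set p \<subseteq> S" "set p' \<subseteq> S" using p(1) p'(1) assms by blast+
  have "wp p \<otimes> wp (alt_word t s (Suc ?m)) = \<one>" using one p(3) pS a by simp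
  then have "wp (alt_word t s (Suc ?m)) = inv (wp p)"
    using pS a by (metis inv_equality inv_inv inv_closed wp_closed)
  then have "wp (alt_word t s (Suc q)) = wp (p' @ rev p)"
    using p'(3) pS a by (simp add: wp_rev del: alt_word.simps)
  moreover have "wp (alt_word t s (Suc q)) = wp (alt_word s t q) \<otimes> s"
    using set_alt_word[of s t q] assms by (simp add: subset_trans[of _ "{s,t}" S])
  ultimately show ?thesis using p p' assms(4) m by (intro exI[of _ "p' @ rev p"]) auto
qed

lemma nonneg_combination:
  "nonneg f \<Longrightarrow> nonneg g \<Longrightarrow> 0 \<le> a \<Longrightarrow> 0 \<le> b \<Longrightarrow> nonneg (a *\<^sub>R f + b *\<^sub>R g)"
  by (simp add: nonneg_def fun_apply)

lemma nonneg_simple_root: "nonneg (simple_root s)"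
  by (simp add: nonneg_def simple_root_def)

text \<open>
  Tits' theorem. A maximal factorisation of \<open>w\<close> into \<open>v\<close> and a word in the two generators
  \<open>s\<close> and \<open>t\<close>, with \<open>t\<close> a descent of \<open>w\<close>, reduces the claim to \<open>v\<close> and the dihedral case.
\<close>

lemma len_less_imp_nonneg:
  assumes "w \<in> carrier G" "s \<in> S" "len w < len (w \<otimes> s)"
  shows "nonneg (act w (simple_root s))"
  using assms
proof (induction "len w" arbitrary: w s rule: less_induct)
  case (less w s)
  show ?case
  proof (cases "w = \<one>")
    case True
    then show ?thesis by (simp add: nonneg_simple_root)
  next
    case False
    obtain t where t: "t \<in> S" "len (w \<otimes> t) < len w" using descent_exists less.prems False by blast
    have st: "s \<noteq> t" using t less.prems by auto
    define X where "X = {n. \<exists>v u. v \<in> carrier G \<and> set u \<subseteq> {s, t} \<and> w = v \<otimes> wp u \<and> len v + length u = len w \<and> length u = n}"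
    have tX: "1 \<in> X"
    proof -
      have "len w \<le> Suc (len (w \<otimes> t))" using len_mult_le[of "w \<otimes> t" t] less.prems t by simp
      then have "len (w \<otimes> t) + length [t] = len w" using t by simp
      moreover have "w = (w \<otimes> t) \<otimes> wp [t]" using less.prems t by simp
      ultimately show ?thesis unfolding X_def using less.prems(1) t
        by (auto intro!: exI[of _ "w \<otimes> t"] exI[of _ "[t]"])
    qed
    have fX: "finite X" by (rule finite_subset[of _ "{..len w}"]) (auto simp: X_def)
    define n where "n = Max X"
    have n: "n \<in> X" "1 \<le> n" using Max_in[OF fX] Max_ge[OF fX tX] tX by (auto simp: n_def)
    obtain v u where vu: "v \<in> carrier G" "set u \<subseteq> {s, t}" "w = v \<otimes> wp u" "len v + length u = len w" "length u = n"
      using n(1) unfolding X_def by blast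
    have sub: "set x \<subseteq> S" if "set x \<subseteq> {s, t}" for x using that less.prems(2) t(1) by blast
    have lv: "len v < len w" using vu n by linarith
    \<comment> \<open>A descent \<open>r\<close> of \<open>v\<close> could be moved into the
      dihedral part, against the maximality of \<open>n\<close>.\<close>
    have up: "len v < len (v \<otimes> r)" if r: "r \<in> {s, t}" for r
    proof (rule ccontr)
      assume "\<not> len v < len (v \<otimes> r)"
      then have l: "len (v \<otimes> r) < len v" using len_mult_ne[OF vu(1), of r] r less.prems(2) t(1) by fastforce
      have rS: "r \<in> S" using r less.prems(2) t(1) by blast
      have w: "w = (v \<otimes> r) \<otimes> wp (r # u)" using vu rS sub[OF vu(2)] by (simp add: m_assoc)
      have "len w \<le> len (v \<otimes> r) + length (r # u)"
        using len_mult_word_le[of "v \<otimes> r" "r # u"] vu(1) rS sub[OF vu(2)] w by simp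
      then have le: "len (v \<otimes> r) + length (r # u) = len w" using l vu(4) by simp
      have "length (r # u) \<in> X" unfolding X_def mem_Collect_eq
        by (intro exI[of _ "v \<otimes> r"] exI[of _ "r # u"] conjI w le HOL.refl) (use vu(1,2) r rS in auto)
      then show False using Max_ge[OF fX] vu(5) unfolding n_def by fastforce
    qed
    have m1: "length u \<le> length u'" if "set u' \<subseteq> {s, t}" "wp u' = wp u" for u'
      using len_mult_word_le[OF vu(1) sub[OF that(1)]] that vu by simp
    \<comment> \<open>Here the ascent \<open>s\<close> of \<open>w\<close> enters. It prevents
      \<open>u\<close> from ending in \<open>s\<close> and from reaching the length
      \<open>ord (s \<otimes> t)\<close>, which is what the dihedral case requires.\<close>
    have m2: "length u < length u'" if u': "set u' \<subseteq> {s, t}" "wp u' = wp u \<otimes> s" for u'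
    proof -
      have "w \<otimes> s = v \<otimes> wp u'" using u' vu sub[OF vu(2)] less.prems(2) by (simp add: m_assoc)
      then show ?thesis using len_mult_word_le[OF vu(1) sub[OF u'(1)]] less.prems(3) vu by simp
    qed
    have "u \<noteq> alt_word t s (length u)"
    proof
      assume "u = alt_word t s (length u)"
      then have ue: "u = alt_word s t (n - 1) @ [s]" using vu(5) n(2) by (cases n) auto
      have a: "set (alt_word s t (n - 1)) \<subseteq> {s, t}" by (rule set_alt_word)
      then have "wp (alt_word s t (n - 1)) = wp u \<otimes> s" using ue sub[OF a] less.prems(2) by simp
      from m2[OF a this] show False using vu(5) by simp
    qed
    then have ua: "u = alt_word s t n" using reduced_dihedral_word[OF less.prems(2) t(1) vu(2) m1] vu(5) by blast
    have "n < ord (s \<otimes> t)"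
    proof (rule ccontr)
      assume "\<not> n < ord (s \<otimes> t)"
      then obtain u' where "set u' \<subseteq> {s, t}" "length u' < n" "wp u' = wp u \<otimes> s"
        using alt_word_shorten[OF less.prems(2) t(1) st, of n] ua by auto
      then show False using m2[of u'] vu(5) by simp
    qed
    then obtain a b where ab: "0 \<le> a" "0 \<le> b" "wact u (simple_root s) = a *\<^sub>R simple_root s + b *\<^sub>R simple_root t"
      using alt_word_root_nonneg[OF less.prems(2) t(1) st] ua by blast
    have "act w (simple_root s) = act v (wact u (simple_root s))"
      using vu sub[OF vu(2)] act_wp[OF sub[OF vu(2)]] by simp
    also have "\<dots> = a *\<^sub>R act v (simple_root s) + b *\<^sub>R act v (simple_root t)"
      using ab vu(1) by simp
    finally have e: "act w (simple_root s) = a *\<^sub>R act v (simple_root s) + b *\<^sub>R act v (simple_root t)" .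
    have "nonneg (act v (simple_root s))" "nonneg (act v (simple_root t))"
      using less.hyps[OF lv vu(1) less.prems(2)] less.hyps[OF lv vu(1) t(1)] up by blast+
    then show ?thesis unfolding e using nonneg_combination ab(1,2) by blast
  qed
qed

lemma len_greater_imp_nonpos:
  assumes "w \<in> carrier G" "s \<in> S" "len (w \<otimes> s) < len w"
  shows "nonneg (- act w (simple_root s))"
proof -
  have "nonneg (act (w \<otimes> s) (simple_root s))"
    by (rule len_less_imp_nonneg) (use assms in auto)
  moreover have "rf s (simple_root s) = - simple_root s" using assms by (simp add: refl_def scaleR_2)
  ultimately show ?thesis using assms by simp
qed

lemma act_faithful:
  assumes "w \<in> carrier G" "\<And>s. s \<in> S \<Longrightarrow> act w (simple_root s) = simple_root s"
  shows "w = \<one>"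
proof (rule ccontr)
  assume "w \<noteq> \<one>"
  then obtain t where t: "t \<in> S" "len (w \<otimes> t) < len w" using descent_exists assms by blast
  then have "nonneg (- simple_root t)" using len_greater_imp_nonpos[OF assms(1), of t] assms(2) by simp
  then show False by (auto simp: nonneg_def simple_root_def fun_apply dest: spec[of _ t])
qed

lemma act_inj:
  assumes "u \<in> carrier G" "w \<in> carrier G" "\<And>f. f \<in> V S \<Longrightarrow> act u f = act w f"
  shows "u = w"
proof -
  have "inv w \<otimes> u = \<one>" by (rule act_faithful) (use assms simple_root_V in auto)
  then show ?thesis using assms by (metis inv_equality inv_inv inv_closed)
qed

end

section \<open>Positive definiteness of the form\<close>

locale irreducible_coxeter = coxeter +
  assumes irreducible: "irreducible_coxeter_system G S"
begin

lemma S_nonempty: "S \<noteq> {}"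
  using irreducible by (simp add: irreducible_coxeter_system_def)

lemma refl_simple_root [simp]: "s \<in> S \<Longrightarrow> rf s (simple_root s) = - simple_root s"
  by (simp add: refl_def scaleR_2)

lemma refl_minus [simp]: "refl r (- f) = - refl r f"
  using refl_scale[of r "-1" f] by simp

lemma graph_connected: "s \<in> S \<Longrightarrow> t \<in> S \<Longrightarrow> (s, t) \<in> (coxeter_graph G S)\<^sup>*"
  using irreducible by (simp add: irreducible_coxeter_system_def)

text \<open>An invariant form that is visibly positive definite on \<open>V S\<close>.
  Irreducibility makes it a positive multiple of \<open>bf\<close>, which is how
  \<open>bf_pos\<close> is obtained.\<close>

definition avg :: "('a \<Rightarrow> real) \<Rightarrow> ('a \<Rightarrow> real) \<Rightarrow> real" where
  "avg f g = (\<Sum>w\<in>carrier G. \<Sum>t\<in>S. act w f t * act w g t)"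

lemma avg_sym: "avg f g = avg g f"
  by (simp add: avg_def mult.commute)

lemma avg_linear: "linear (\<lambda>g. avg f g)"
  by (auto simp: linear_iff avg_def fun_apply algebra_simps sum.distrib sum_distrib_left)

lemma avg_act:
  assumes "u \<in> carrier G"
  shows "avg (act u f) (act u g) = avg f g"
  unfolding avg_def
  by (rule sum.reindex_bij_witness[of _ "\<lambda>w. w \<otimes> inv u" "\<lambda>w. w \<otimes> u"])
     (use assms in \<open>auto simp: m_assoc\<close>)

lemma avg_pos:
  assumes "f \<in> V S" "f \<noteq> 0"
  shows "0 < avg f f"
proof -
  obtain t where t: "f t \<noteq> 0" using assms(2) by (auto simp: fun_eq_iff fun_apply)
  then have tS: "t \<in> S" using assms(1) by (auto simp: V_def)
  have "0 < (\<Sum>t\<in>S. act \<one> f t * act \<one> f t)"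
    by (rule sum_pos2[of _ t]) (use t tS in \<open>auto simp: zero_less_mult_iff\<close>)
  then show ?thesis unfolding avg_def
    by (rule sum_pos2[OF finite_carrier one_closed]) (rule sum_nonneg, simp)
qed

lemma simple_root_ne_0: "simple_root s \<noteq> 0"
  by (auto simp: fun_eq_iff fun_apply simple_root_apply)

text \<open>The reflection \<open>rf s\<close> preserves \<open>avg\<close> and negates its simple
  root; expanding \<open>avg (rf s f) (simple_root s)\<close> in both ways gives the proportionality
  with \<open>bf\<close>.\<close>

lemma avg_simple:
  assumes "s \<in> S"
  shows "avg f (simple_root s) = bf f (simple_root s) * avg (simple_root s) (simple_root s)"
proof -
  have "rf s (simple_root s) = - simple_root s" using assms by (simp add: refl_def scaleR_2)
  then have "avg (rf s f) (simple_root s) = - avg f (simple_root s)"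
    using avg_act[of s f "- simple_root s"] assms linear_neg[OF avg_linear, of f "simple_root s"] by simp
  moreover have "avg (rf s f) (simple_root s) = avg f (simple_root s) - 2 * bf f (simple_root s) * avg (simple_root s) (simple_root s)"
    using avg_sym[of "rf s f" "simple_root s"] avg_sym[of f "simple_root s"]
    by (simp add: refl_def linear_diff[OF avg_linear] linear_scale[OF avg_linear])
  ultimately show ?thesis by simp
qed

text \<open>Along an edge of the Coxeter graph \<open>bm y z\<close> is nonzero, and symmetry of
  \<open>avg\<close> forces equal norms; connectedness does the rest.\<close>

lemma avg_norm_const:
  assumes "s \<in> S" "t \<in> S"
  shows "avg (simple_root s) (simple_root s) = avg (simple_root t) (simple_root t)"
  using graph_connected[OF assms]
proof induction
  case (step y z)
  then have yz: "y \<in> S" "z \<in> S" "y \<noteq> z" "ord (y \<otimes> z) \<noteq> 2" by (auto simp: coxeter_graph_def)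
  have "bm y z * avg (simple_root z) (simple_root z) = bm z y * avg (simple_root y) (simple_root y)"
    using avg_simple[OF yz(1), of "simple_root z"] avg_simple[OF yz(2), of "simple_root y"] yz(1,2)
    by (simp add: avg_sym)
  moreover have "bm z y = bm y z" "bm y z \<noteq> 0" using bm_sym bm_eq_0_iff yz by auto
  ultimately show ?case using step.IH by simp
qed simp

lemma bf_pos:
  assumes "f \<in> V S" "f \<noteq> 0"
  shows "0 < bf f f"
proof -
  obtain s0 where s0: "s0 \<in> S" using S_nonempty by blast
  define n where "n = avg (simple_root s0) (simple_root s0)"
  have n: "0 < n" unfolding n_def by (rule avg_pos) (auto simp: s0 simple_root_V simple_root_ne_0)
  have fe: "f = (\<Sum>s\<in>S. f s *\<^sub>R simple_root s)" using V_expand assms(1) by blast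
  have "avg f f = (\<Sum>s\<in>S. f s * avg f (simple_root s))"
    by (subst (2) fe) (simp add: linear_sum[OF avg_linear] linear_scale[OF avg_linear])
  also have "\<dots> = (\<Sum>s\<in>S. f s * (bf f (simple_root s) * n))"
  proof (rule sum.cong[OF HOL.refl])
    fix s assume "s \<in> S"
    then show "f s * avg f (simple_root s) = f s * (bf f (simple_root s) * n)"
      using avg_simple[of s f] avg_norm_const[OF _ s0, of s] by (simp add: n_def)
  qed
  also have "\<dots> = n * (\<Sum>s\<in>S. f s * bf f (simple_root s))" by (simp add: sum_distrib_left algebra_simps)
  also have "(\<Sum>s\<in>S. f s * bf f (simple_root s)) = bf f f"
    by (subst (4) fe) simp
  finally show ?thesis using avg_pos[OF assms] n by (simp add: zero_less_mult_iff)
qed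

lemma bf_self_eq_0: "f \<in> V S \<Longrightarrow> bf f f = 0 \<Longrightarrow> f = 0"
  using bf_pos by fastforce

subsection \<open>Roots\<close>

definition roots :: "('a \<Rightarrow> real) set" where
  "roots = {act w (simple_root s) | w s. w \<in> carrier G \<and> s \<in> S}"

lemma rootsE:
  assumes "\<rho> \<in> roots"
  obtains w s where "w \<in> carrier G" "s \<in> S" "\<rho> = act w (simple_root s)"
  using assms by (auto simp: roots_def)

lemma simple_root_roots [simp]: "s \<in> S \<Longrightarrow> simple_root s \<in> roots"
  unfolding roots_def by (metis (mono_tags, lifting) act_one mem_Collect_eq one_closed)

lemma roots_V: "\<rho> \<in> roots \<Longrightarrow> \<rho> \<in> V S"
  by (elim rootsE) (simp add: act_V simple_root_V)

lemma roots_norm [simp]: "\<rho> \<in> roots \<Longrightarrow> bf \<rho> \<rho> = 1"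
  by (elim rootsE) simp

lemma act_roots [simp]: "\<rho> \<in> roots \<Longrightarrow> w \<in> carrier G \<Longrightarrow> act w \<rho> \<in> roots"
  unfolding roots_def by (auto simp: act_mult[symmetric] simp del: act_mult) (metis m_closed)

lemma uminus_roots [simp]: "\<rho> \<in> roots \<Longrightarrow> - \<rho> \<in> roots"
proof (elim rootsE)
  fix w s assume *: "w \<in> carrier G" "s \<in> S" "\<rho> = act w (simple_root s)"
  then have "- \<rho> = act w (act s (simple_root s))" by (simp add: refl_def scaleR_2)
  then show ?thesis using * by (simp only: act_roots simple_root_roots S_in)
qed

lemma finite_roots: "finite roots"
proof -
  have "roots = (\<lambda>(w, s). act w (simple_root s)) ` (carrier G \<times> S)" by (auto simp: roots_def)
  then show ?thesis using finite_carrier by simp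
qed

lemma roots_ne_0: "\<rho> \<in> roots \<Longrightarrow> \<rho> \<noteq> 0"
  using roots_norm by fastforce

lemma root_pos_or_neg:
  assumes "\<rho> \<in> roots"
  shows "nonneg \<rho> \<or> nonneg (- \<rho>)"
proof -
  obtain w s where w: "w \<in> carrier G" "s \<in> S" "\<rho> = act w (simple_root s)" using assms rootsE by blast
  then show ?thesis using len_less_imp_nonneg len_greater_imp_nonpos len_mult_ne
    by (metis linorder_neqE_nat)
qed

lemma nonneg_antisym: "nonneg f \<Longrightarrow> nonneg (- f) \<Longrightarrow> f = 0"
  by (auto simp: nonneg_def fun_eq_iff fun_apply intro: order_antisym)

lemma root_not_both: "\<rho> \<in> roots \<Longrightarrow> nonneg \<rho> \<Longrightarrow> \<not> nonneg (- \<rho>)"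
  using nonneg_antisym roots_ne_0 by blast

definition pos_roots :: "('a \<Rightarrow> real) set" where
  "pos_roots = {\<rho> \<in> roots. nonneg \<rho>}"

lemma pos_roots_roots: "\<rho> \<in> pos_roots \<Longrightarrow> \<rho> \<in> roots"
  by (simp add: pos_roots_def)

lemma pos_roots_nonneg: "\<rho> \<in> pos_roots \<Longrightarrow> nonneg \<rho>"
  by (simp add: pos_roots_def)

lemma roots_cases: "\<rho> \<in> roots \<Longrightarrow> \<rho> \<in> pos_roots \<or> - \<rho> \<in> pos_roots"
  using root_pos_or_neg by (auto simp: pos_roots_def)

lemma pos_root_uminus: "\<rho> \<in> pos_roots \<Longrightarrow> - \<rho> \<notin> pos_roots"
  using root_not_both by (auto simp: pos_roots_def)

lemma simple_root_pos_roots [simp]: "s \<in> S \<Longrightarrow> simple_root s \<in> pos_roots"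
  by (simp add: pos_roots_def nonneg_simple_root)

lemma root_positive_of_coord:
  assumes "\<rho> \<in> roots" "0 < \<rho> t"
  shows "\<rho> \<in> pos_roots"
  using roots_cases[OF assms(1)] assms(2)
  by (auto simp: pos_roots_def nonneg_def fun_apply dest: spec[of _ t])

lemma pos_root_support:
  assumes "\<rho> \<in> pos_roots" "\<And>t. t \<noteq> s \<Longrightarrow> \<rho> t = 0"
  shows "\<rho> = simple_root s"
proof -
  have r: "\<rho> \<in> roots" "nonneg \<rho>" using assms(1) by (auto simp: pos_roots_def)
  have e: "\<rho> = \<rho> s *\<^sub>R simple_root s"
    using assms(2) by (auto simp: fun_eq_iff fun_apply simple_root_apply)
  have ne: "\<rho> s \<noteq> 0" using e roots_ne_0[OF r(1)] by force
  then have "s \<in> S" using roots_V[OF r(1)] by (auto simp: V_def)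
  then have "bf \<rho> \<rho> = \<rho> s * \<rho> s" by (subst e, subst (2) e) simp
  then have "\<rho> s * \<rho> s = 1" using r(1) by simp
  then have "\<rho> s = 1" using r(2) by (auto simp: nonneg_def square_eq_1_iff dest: spec[of _ s])
  then show ?thesis using e by simp
qed

text \<open>\<open>rf s\<close> changes only the coordinate at \<open>s\<close>, and some other
  coordinate of the root is positive. Coordinates of a root never have mixed signs.\<close>

lemma refl_pos_root:
  assumes "\<rho> \<in> pos_roots" "s \<in> S" "\<rho> \<noteq> simple_root s"
  shows "rf s \<rho> \<in> pos_roots"
proof -
  obtain t where t: "t \<noteq> s" "\<rho> t \<noteq> 0" using pos_root_support assms by blast
  then have "0 < \<rho> t" using pos_roots_nonneg[OF assms(1)] by (auto simp: nonneg_def less_le)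
  then have "0 < rf s \<rho> t" using t by (simp add: refl_def fun_apply simple_root_apply)
  moreover have "rf s \<rho> \<in> roots" using act_roots[of \<rho> s] pos_roots_roots[OF assms(1)] assms(2) by simp
  ultimately show ?thesis using root_positive_of_coord by blast
qed

text \<open>The action is faithful, so the choice is unique; \<open>rt_unique\<close> needs the
  equation on \<open>V S\<close> only.\<close>

definition rt :: "('a \<Rightarrow> real) \<Rightarrow> 'a" where
  "rt \<rho> = (SOME g. g \<in> reflections G S \<and> act g = refl \<rho>)"

lemma reflections_carrier: "t \<in> reflections G S \<Longrightarrow> t \<in> carrier G"
  by (auto simp: reflections_def)

lemma act_conj_refl:
  assumes "w \<in> carrier G" "s \<in> S"
  shows "act (w \<otimes> s \<otimes> inv w) = refl (act w (simple_root s))"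
proof
  fix f
  show "act (w \<otimes> s \<otimes> inv w) f = refl (act w (simple_root s)) f"
    using assms bf_act_left[OF assms(1), of "simple_root s" f]
    by (simp add: refl_def bf_sym)
qed

lemma rt_props:
  assumes "\<rho> \<in> roots"
  shows "rt \<rho> \<in> reflections G S \<and> act (rt \<rho>) = refl \<rho>"
proof -
  obtain w s where w: "w \<in> carrier G" "s \<in> S" "\<rho> = act w (simple_root s)" using assms rootsE by blast
  show ?thesis unfolding rt_def
    by (rule someI[of _ "w \<otimes> s \<otimes> inv w"]) (use w act_conj_refl in \<open>auto simp: reflections_def\<close>)
qed

lemma rt_reflections [simp]: "\<rho> \<in> roots \<Longrightarrow> rt \<rho> \<in> reflections G S"
  using rt_props by blast

lemma rt_carrier [simp]: "\<rho> \<in> roots \<Longrightarrow> rt \<rho> \<in> carrier G"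
  using rt_props reflections_carrier by blast

lemma act_rt [simp]: "\<rho> \<in> roots \<Longrightarrow> act (rt \<rho>) = refl \<rho>"
  using rt_props by blast

lemma rt_unique:
  assumes "\<rho> \<in> roots" "g \<in> carrier G" "\<And>f. f \<in> V S \<Longrightarrow> act g f = refl \<rho> f"
  shows "rt \<rho> = g"
  by (rule act_inj) (use assms in auto)

lemma rt_simple [simp]: "s \<in> S \<Longrightarrow> rt (simple_root s) = s"
  by (rule rt_unique) auto

lemma rt_uminus [simp]: "\<rho> \<in> roots \<Longrightarrow> rt (- \<rho>) = rt \<rho>"
  by (rule rt_unique) (auto simp: refl_def)

lemma rt_act:
  assumes "\<rho> \<in> roots" "w \<in> carrier G"
  shows "rt (act w \<rho>) = w \<otimes> rt \<rho> \<otimes> inv w"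
proof (rule rt_unique)
  fix f
  show "act (w \<otimes> rt \<rho> \<otimes> inv w) f = refl (act w \<rho>) f"
    using assms bf_act_left[OF assms(2), of \<rho> f] by (simp add: refl_def bf_sym)
qed (use assms in auto)

lemma rt_sq [simp]: "\<rho> \<in> roots \<Longrightarrow> rt \<rho> \<otimes> rt \<rho> = \<one>"
  by (rule act_inj) (auto simp: refl_refl)

lemma rt_inv [simp]: "\<rho> \<in> roots \<Longrightarrow> inv (rt \<rho>) = rt \<rho>"
  by (simp add: inv_equality)

lemma reflection_is_rt:
  assumes "t \<in> reflections G S"
  shows "\<exists>\<rho>\<in>pos_roots. t = rt \<rho>"
proof -
  obtain w s where w: "w \<in> carrier G" "s \<in> S" "t = w \<otimes> s \<otimes> inv w"
    using assms by (auto simp: reflections_def)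
  then have "t = rt (act w (simple_root s))" by (simp add: rt_act)
  then show ?thesis using roots_cases[of "act w (simple_root s)"] w rt_uminus
    by (metis act_roots simple_root_roots)
qed

lemma reflection_root:
  assumes "\<rho> \<in> roots" "\<sigma> \<in> roots"
  shows "refl \<rho> \<sigma> \<in> roots"
  using act_roots[OF assms(2) rt_carrier[OF assms(1)]] assms(1) by simp

text \<open>Twice the Weyl vector. Each simple reflection permutes the other positive roots, so with
  roots of norm 1 it pairs to 1 with every simple root.\<close>

definition dom :: "'a \<Rightarrow> real" where
  "dom = (\<Sum>\<rho>\<in>pos_roots. \<rho>)"

lemma finite_pos_roots: "finite pos_roots"
  using finite_roots by (simp add: pos_roots_def)

lemma dom_simple:
  assumes "s \<in> S"
  shows "bf dom (simple_root s) = 1"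
proof -
  let ?P = "pos_roots - {simple_root s}"
  have d: "dom = simple_root s + (\<Sum>\<rho>\<in>?P. \<rho>)"
    unfolding dom_def using assms by (intro sum.remove[OF finite_pos_roots]) simp
  have rr: "rf s (rf s \<rho>) = \<rho>" for \<rho> using assms by (simp add: refl_refl)
  have rs: "rf s (simple_root s) = - simple_root s" using assms by (simp add: refl_def scaleR_2)
  have ne: "rf s \<rho> \<noteq> simple_root s" if "\<rho> \<in> pos_roots" for \<rho>
    using rr[of \<rho>] rs that pos_root_uminus[of "simple_root s"] assms by force
  have "(\<Sum>\<rho>\<in>?P. rf s \<rho>) = (\<Sum>\<rho>\<in>?P. \<rho>)"
    by (rule sum.reindex_bij_witness[of _ "rf s" "rf s"])
       (use rr ne refl_pos_root assms in auto)
  then have "act s dom = - simple_root s + (\<Sum>\<rho>\<in>?P. \<rho>)"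
    unfolding d using assms act_sum[of s "\<lambda>\<rho>. \<rho>" ?P] by (simp add: refl_add)
  then have "act s dom = dom - 2 *\<^sub>R simple_root s" unfolding d by (simp add: scaleR_2)
  then have "(2 * bf dom (simple_root s)) *\<^sub>R simple_root s = 2 *\<^sub>R simple_root s"
    using assms by (simp add: refl_def)
  then show ?thesis using simple_root_ne_0[of s] by (simp add: scaleR_cancel_right)
qed

lemma bf_nonneg_expand:
  assumes "f \<in> V S"
  shows "bf g f = (\<Sum>s\<in>S. f s * bf g (simple_root s))"
proof -
  have fe: "f = (\<Sum>s\<in>S. f s *\<^sub>R simple_root s)" using V_expand assms by blast
  show ?thesis by (subst fe) simp
qed

end

lemma dim_linear_image_le:
  fixes f :: "'v::real_vector \<Rightarrow> 'w::real_vector"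
  assumes "linear f" "fin_dim A"
  shows "dim (f ` A) \<le> dim A"
proof -
  obtain X where X: "A \<subseteq> span X" "finite X" "card X = dim A"
    using fin_dim_basis[OF assms(2)] by metis
  have "f ` A \<subseteq> span (f ` X)"
    using X(1) linear_span_image[OF assms(1), of X] by blast
  then have "dim (f ` A) \<le> card (f ` X)" using X(2) by (intro real_vector.dim_le_card) auto
  also have "\<dots> \<le> dim A" using card_image_le[OF X(2), of f] X(3) by simp
  finally show ?thesis .
qed

context irreducible_coxeter
begin

text \<open>The translate \<open>y\<close> of \<open>x\<close> with the largest pairing with
  \<open>dom\<close> pairs nonnegatively with all simple roots, and strictly by regularity. A
  nontrivial \<open>u\<close> fixing \<open>y\<close> would send some simple root to a negative root
  and yet preserve its positive pairing with \<open>y\<close>.\<close>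

lemma exists_regular_fix:
  assumes "w \<in> carrier G" "x \<in> V S" "act w x = x" "\<And>\<rho>. \<rho> \<in> roots \<Longrightarrow> bf x \<rho> \<noteq> 0"
  shows "w = \<one>"
proof -
  define h where "h g = bf (act g x) dom" for g
  have "\<exists>g\<in>carrier G. \<forall>g'\<in>carrier G. h g' \<le> h g"
  proof -
    have ne: "finite (h ` carrier G)" "h ` carrier G \<noteq> {}" using finite_carrier one_closed by blast+
    obtain g where "g \<in> carrier G" "h g = Max (h ` carrier G)" using Max_in[OF ne] by force
    then show ?thesis using Max_ge[OF ne(1)] by force
  qed
  then obtain g where g: "g \<in> carrier G" "\<And>g'. g' \<in> carrier G \<Longrightarrow> h g' \<le> h g" by blast
  define y where "y = act g x"
  have pos: "0 < bf y (simple_root s)" if s: "s \<in> S" for s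
  proof -
    have "h (s \<otimes> g) = bf (rf s y) dom" using s g(1) by (simp add: h_def y_def)
    also have "\<dots> = h g - 2 * bf y (simple_root s)"
      using dom_simple[OF s] by (simp add: refl_def h_def y_def bf_sym[of "simple_root s" dom])
    finally have "0 \<le> bf y (simple_root s)" using g(2)[of "s \<otimes> g"] s g(1) by simp
    moreover have "bf y (simple_root s) = bf x (act (inv g) (simple_root s))"
      using g(1) by (simp add: y_def bf_act_left)
    then have "bf y (simple_root s) \<noteq> 0" using assms(4) g(1) s by simp
    ultimately show ?thesis by simp
  qed
  define u where "u = g \<otimes> w \<otimes> inv g"
  have u: "u \<in> carrier G" "act u y = y" using g(1) assms(1,3) by (simp_all add: u_def y_def)
  have "u = \<one>"
  proof (rule ccontr)
    assume "u \<noteq> \<one>"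
    then obtain t where t: "t \<in> S" "len (u \<otimes> t) < len u" using descent_exists u(1) by blast
    have nn: "nonneg (- act u (simple_root t))" using len_greater_imp_nonpos[OF u(1) t] .
    have "act u (simple_root t) \<in> V S" using t u(1) by (simp add: act_V simple_root_V)
    then have "- act u (simple_root t) \<in> V S" using V_subspace real_vector.subspace_neg by blast
    then have "bf y (- act u (simple_root t)) = (\<Sum>s\<in>S. (- act u (simple_root t)) s * bf y (simple_root s))"
      by (rule bf_nonneg_expand)
    also have "\<dots> \<ge> 0" using nn pos by (intro sum_nonneg mult_nonneg_nonneg) (auto simp: nonneg_def less_imp_le)
    finally have "bf (act u y) (act u (simple_root t)) \<le> 0" using u(2) by simp
    then show False using u(1) pos[OF t(1)] by simp
  qed
  then have "g \<otimes> w = g" using g(1) assms(1) by (metis u_def inv_solve_right l_one m_closed one_closed inv_closed)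
  then show ?thesis using g(1) assms(1) by simp
qed

section \<open>Moved spaces, fixed spaces and Carter's lemma\<close>

definition Mov :: "'a \<Rightarrow> ('a \<Rightarrow> real) set" where
  "Mov w = (\<lambda>f. act w f - f) ` V S"

definition Fix :: "'a \<Rightarrow> ('a \<Rightarrow> real) set" where
  "Fix w = {f \<in> V S. act w f = f}"

lemma V_diff: "f \<in> V J \<Longrightarrow> g \<in> V J \<Longrightarrow> f - g \<in> V J"
  and V_add: "f \<in> V J \<Longrightarrow> g \<in> V J \<Longrightarrow> f + g \<in> V J"
  and V_scale: "f \<in> V J \<Longrightarrow> r *\<^sub>R f \<in> V J"
  and V_minus: "f \<in> V J \<Longrightarrow> - f \<in> V J"
  and V_zero [simp]: "0 \<in> V J"
  by (auto simp: V_def fun_apply)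

lemma MovI: "f \<in> V S \<Longrightarrow> act w f - f \<in> Mov w"
  by (simp add: Mov_def)

lemma Mov_V: "w \<in> carrier G \<Longrightarrow> Mov w \<subseteq> V S"
  by (auto simp: Mov_def intro!: V_diff act_V)

lemma Mov_subspace: "w \<in> carrier G \<Longrightarrow> subspace (Mov w)"
  unfolding Mov_def
  by (rule linear_subspace_image[OF _ V_subspace])
     (auto simp: linear_iff algebra_simps)

lemma Fix_subspace: "w \<in> carrier G \<Longrightarrow> subspace (Fix w)"
  by (auto simp: Fix_def real_vector.subspace_def intro: V_add V_scale)

lemma fin_dim_VS: "fin_dim (V S)"
  by (simp add: fin_dim_V)

lemma fin_dim_Mov: "w \<in> carrier G \<Longrightarrow> fin_dim (Mov w)"
  using Mov_V fin_dim_VS fin_dim_subset by blast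

lemma Mov_orth_Fix:
  assumes "w \<in> carrier G" "\<eta> \<in> Mov w" "f \<in> Fix w"
  shows "bf f \<eta> = 0"
proof -
  obtain g where "g \<in> V S" "\<eta> = act w g - g" using assms(2) by (auto simp: Mov_def)
  moreover have "bf f (act w g) = bf f g" using bf_act[OF assms(1), of f g] assms(3) by (simp add: Fix_def)
  ultimately show ?thesis by simp
qed

lemma act_pow_diff_Mov:
  assumes "w \<in> carrier G" "f \<in> V S"
  shows "act (w [^] (k::nat)) f - f \<in> Mov w"
proof (induction k)
  case 0
  then show ?case using real_vector.subspace_0[OF Mov_subspace[OF assms(1)]] by simp
next
  case (Suc k)
  have c: "w [^] k \<in> carrier G" using assms(1) by simp
  have "w [^] Suc k = w \<otimes> w [^] k" using assms(1) by (rule nat_pow_Suc2)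
  then have "act (w [^] Suc k) f - f = (act w (act (w [^] k) f) - act (w [^] k) f) + (act (w [^] k) f - f)"
    using assms(1) c by simp
  also have "\<dots> \<in> Mov w"
    using Suc MovI[OF act_V[OF c assms(2)]] real_vector.subspace_add[OF Mov_subspace[OF assms(1)]] by blast
  finally show ?case .
qed

lemma sum_pow_Fix:
  assumes "w \<in> carrier G" "f \<in> V S"
  shows "(\<Sum>k<ord w. act (w [^] k) f) \<in> Fix w"
proof -
  define n where "n = ord w"
  define a where "a = (\<Sum>k<n. act (w [^] k) f)"
  have aV: "a \<in> V S" unfolding a_def
    by (rule real_vector.subspace_sum[OF V_subspace]) (use assms in \<open>simp add: act_V\<close>)
  have "act w a = (\<Sum>k<n. act (w [^] Suc k) f)"
    unfolding a_def nat_pow_Suc2[OF assms(1)] using assms(1) by (simp add: act_sum)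
  also have "\<dots> = a"
  proof -
    have "(\<Sum>k<n. act (w [^] Suc k) f) + act (w [^] (0::nat)) f = (\<Sum>k<Suc n. act (w [^] k) f)"
      by (subst sum.lessThan_Suc_shift) (simp add: add.commute)
    also have "\<dots> = a + act (w [^] n) f" by (simp add: a_def)
    also have "w [^] n = \<one>" using assms(1) by (simp add: n_def)
    finally show ?thesis by simp
  qed
  finally show ?thesis using aV by (simp add: Fix_def a_def n_def)
qed

text \<open>Averaging over the cyclic group of \<open>w\<close> projects \<open>f\<close> to a fixed
  vector, and \<open>f\<close> differs from its average by a combination of vectors
  \<open>act (w [^] k) f - f\<close>, which all lie in \<open>Mov w\<close>.\<close>

lemma Mov_Fix_decomp:
  assumes "w \<in> carrier G" "f \<in> V S"
  shows "\<exists>m\<in>Mov w. f - m \<in> Fix w"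
proof -
  define n where "n = ord w"
  have n: "0 < n" using ord_pos[OF assms(1)] by (simp add: n_def)
  define a where "a = (\<Sum>k<n. act (w [^] k) f)"
  have aF: "a \<in> Fix w" unfolding a_def n_def by (rule sum_pow_Fix[OF assms(1,2)])
  have "a - real n *\<^sub>R f = (\<Sum>k<n. act (w [^] k) f - f)"
    by (simp only: a_def sum_subtractf sum_constant_scaleR card_lessThan)
  also have "\<dots> \<in> Mov w"
    by (rule real_vector.subspace_sum[OF Mov_subspace[OF assms(1)]]) (use assms act_pow_diff_Mov in blast)
  finally have "(- 1 / real n) *\<^sub>R (a - real n *\<^sub>R f) \<in> Mov w"
    using real_vector.subspace_scale[OF Mov_subspace[OF assms(1)]] by blast
  moreover have "f - (- 1 / real n) *\<^sub>R (a - real n *\<^sub>R f) = (1 / real n) *\<^sub>R a"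
    using n by (simp add: algebra_simps)
  then have "f - (- 1 / real n) *\<^sub>R (a - real n *\<^sub>R f) \<in> Fix w"
    using real_vector.subspace_scale[OF Fix_subspace[OF assms(1)] aF] by simp
  ultimately show ?thesis by blast
qed

lemma Mov_of_orth_Fix:
  assumes "w \<in> carrier G" "\<eta> \<in> V S" "\<And>f. f \<in> Fix w \<Longrightarrow> bf f \<eta> = 0"
  shows "\<eta> \<in> Mov w"
proof -
  obtain m where m: "m \<in> Mov w" "\<eta> - m \<in> Fix w" using Mov_Fix_decomp[OF assms(1,2)] by (elim bexE)
  have "bf (\<eta> - m) (\<eta> - m) = 0"
    using assms(3)[OF m(2)] Mov_orth_Fix[OF assms(1) m] by (simp only: bf_diff_right)
  moreover have "\<eta> - m \<in> V S" using m(2) by (simp add: Fix_def)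
  ultimately have "\<eta> - m = 0" using bf_self_eq_0 by blast
  then show ?thesis using m(1) by simp
qed

lemma Mov_mult:
  assumes "u \<in> carrier G" "w \<in> carrier G" "x \<in> Mov (u \<otimes> w)"
  shows "\<exists>a\<in>Mov u. \<exists>b\<in>Mov w. x = a + b"
proof -
  obtain f where f: "f \<in> V S" "x = act u (act w f) - f" using assms by (auto simp: Mov_def)
  then have "x = (act u (act w f) - act w f) + (act w f - f)" by simp
  then show ?thesis using MovI[OF act_V[OF assms(2) f(1)]] MovI[OF f(1)] by blast
qed

lemma Mov_mult_subset:
  assumes "u \<in> carrier G" "w \<in> carrier G" "subspace A" "Mov u \<subseteq> A" "Mov w \<subseteq> A"
  shows "Mov (u \<otimes> w) \<subseteq> A"
proof (rule subsetI)
  fix x assume "x \<in> Mov (u \<otimes> w)"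
  then obtain a b where "a \<in> Mov u" "b \<in> Mov w" "x = a + b" using Mov_mult assms(1,2) by blast
  then show "x \<in> A" using assms(3-5) real_vector.subspace_add by blast
qed

lemma Mov_one [simp]: "Mov \<one> = {0}"
proof -
  have "V S \<noteq> {}" using V_zero by blast
  then show ?thesis by (auto simp: Mov_def)
qed

lemma Mov_inv [simp]:
  assumes "w \<in> carrier G"
  shows "Mov (inv w) = Mov w"
proof -
  have sub: "Mov (inv u) \<subseteq> Mov u" if u: "u \<in> carrier G" for u
  proof (rule subsetI)
    fix x assume "x \<in> Mov (inv u)"
    then obtain f where f: "f \<in> V S" "x = act (inv u) f - f" by (auto simp: Mov_def)
    then have "x = - (act u (act (inv u) f) - act (inv u) f)" using u by simp
    moreover have "act u (act (inv u) f) - act (inv u) f \<in> Mov u"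
      using f(1) u by (intro MovI) (simp add: act_V)
    ultimately show "x \<in> Mov u" using real_vector.subspace_neg[OF Mov_subspace[OF u]] by blast
  qed
  show ?thesis using sub[OF assms] sub[of "inv w"] assms by simp
qed

lemma Mov_conj:
  assumes "w \<in> carrier G" "g \<in> carrier G"
  shows "Mov (g \<otimes> w \<otimes> inv g) = act g ` Mov w"
proof (intro equalityI subsetI)
  fix x assume "x \<in> Mov (g \<otimes> w \<otimes> inv g)"
  then obtain f where f: "f \<in> V S" "x = act (g \<otimes> w \<otimes> inv g) f - f" by (auto simp: Mov_def)
  then have "x = act g (act w (act (inv g) f) - act (inv g) f)" using assms by simp
  moreover have "act (inv g) f \<in> V S" using f assms by (simp add: act_V)
  ultimately show "x \<in> act g ` Mov w" using MovI by blast
next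
  fix x assume "x \<in> act g ` Mov w"
  then obtain f where f: "f \<in> V S" "x = act g (act w f - f)" by (auto simp: Mov_def)
  then have "x = act (g \<otimes> w \<otimes> inv g) (act g f) - act g f" using assms by simp
  then show "x \<in> Mov (g \<otimes> w \<otimes> inv g)" using f(1) assms MovI act_V by metis
qed

definition rk :: "'a \<Rightarrow> nat" where
  "rk w = dim (Mov w)"

lemma rk_one [simp]: "rk \<one> = 0"
  using real_vector.dim_le_card[of "{0}" "{}"] by (simp add: rk_def real_vector.span_empty)

lemma rk_inv [simp]: "w \<in> carrier G \<Longrightarrow> rk (inv w) = rk w"
  by (simp add: rk_def)

lemma rk_mult: "u \<in> carrier G \<Longrightarrow> w \<in> carrier G \<Longrightarrow> rk (u \<otimes> w) \<le> rk u + rk w"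
  unfolding rk_def by (rule dim_sum_le) (auto intro: fin_dim_Mov Mov_mult)

lemma rk_conj:
  assumes "w \<in> carrier G" "g \<in> carrier G"
  shows "rk (g \<otimes> w \<otimes> inv g) = rk w"
proof -
  have le: "rk (g \<otimes> w \<otimes> inv g) \<le> rk w" if "w \<in> carrier G" "g \<in> carrier G" for w g
    unfolding rk_def Mov_conj[OF that] by (rule dim_linear_image_le) (use that in \<open>auto intro: act_linear fin_dim_Mov\<close>)
  have "inv g \<otimes> (g \<otimes> w \<otimes> inv g) \<otimes> inv (inv g) = w" using assms by (simp add: m_assoc[symmetric])
     (simp add: m_assoc)
  then show ?thesis using le[OF assms] le[of "g \<otimes> w \<otimes> inv g" "inv g"] assms by simp
qed

lemma rk_mult_commute:
  assumes "u \<in> carrier G" "w \<in> carrier G"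
  shows "rk (u \<otimes> w) = rk (w \<otimes> u)"
  using rk_conj[of "u \<otimes> w" w] assms by (simp add: m_assoc)

text \<open>If no root lay in \<open>Mov w\<close>, no root hyperplane would contain
  \<open>Fix w\<close>, so a generic fixed vector would be regular, and then \<open>w\<close> is
  trivial.\<close>

lemma root_in_Mov:
  assumes "w \<in> carrier G" "w \<noteq> \<one>"
  shows "\<exists>\<rho>\<in>roots. \<rho> \<in> Mov w"
proof (rule ccontr)
  assume no: "\<not> ?thesis"
  let ?M = "(\<lambda>\<rho>. {f. bf f \<rho> = 0}) ` roots"
  have "\<exists>x\<in>Fix w. \<forall>M\<in>?M. x \<notin> M"
  proof (rule subspace_avoid)
    show "finite ?M" using finite_roots by simp
    fix M assume "M \<in> ?M"
    then obtain \<rho> where \<rho>: "\<rho> \<in> roots" "M = {f. bf f \<rho> = 0}" by blast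
    show "subspace M" using \<rho>(2) by (auto simp: real_vector.subspace_def)
    have "\<rho> \<notin> Mov w" using no \<rho> by blast
    then show "\<exists>x\<in>Fix w. x \<notin> M" using Mov_of_orth_Fix[OF assms(1) roots_V[OF \<rho>(1)]] \<rho>(2) by blast
  next
    show "Fix w \<noteq> {}" using real_vector.subspace_0[OF Fix_subspace[OF assms(1)]] by blast
    show "x + r *\<^sub>R y \<in> Fix w" if "x \<in> Fix w" "y \<in> Fix w" "0 < r" for x y and r :: real
      using that Fix_subspace[OF assms(1)] by (meson real_vector.subspace_add real_vector.subspace_scale)
  qed
  then obtain x where "x \<in> Fix w" "\<forall>\<rho>\<in>roots. bf x \<rho> \<noteq> 0" by auto
  then have "w = \<one>" using exists_regular_fix[OF assms(1), of x] by (auto simp: Fix_def)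
  then show False using assms(2) by simp
qed

text \<open>If \<open>\<rho> = act w v - v\<close>, then \<open>v\<close> and \<open>act w v\<close>
  have the same norm and the reflection in \<open>\<rho>\<close> exchanges them. So
  \<open>rt \<rho> \<otimes> w\<close> fixes \<open>v\<close>, and since \<open>v\<close> is not
  orthogonal to \<open>\<rho>\<close>, the root has left the moved space.\<close>

lemma Mov_rt_mult:
  assumes "w \<in> carrier G" "\<rho> \<in> roots" "\<rho> \<in> Mov w"
  shows "Mov (rt \<rho> \<otimes> w) \<subseteq> Mov w" "rk (rt \<rho> \<otimes> w) < rk w"
proof -
  have sW: "subspace (Mov w)" using Mov_subspace assms(1) by blast
  show sub: "Mov (rt \<rho> \<otimes> w) \<subseteq> Mov w"
  proof (rule subsetI)
    fix x assume "x \<in> Mov (rt \<rho> \<otimes> w)"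
    then obtain f where f: "f \<in> V S" "x = act (rt \<rho> \<otimes> w) f - f" by (auto simp: Mov_def)
    then have "x = (act w f - f) - (2 * bf (act w f) \<rho>) *\<^sub>R \<rho>" using assms by (simp add: refl_def)
    then show "x \<in> Mov w" using MovI[OF f(1)] assms(3) sW
      by (simp add: real_vector.subspace_diff real_vector.subspace_scale)
  qed
  obtain v where v: "v \<in> V S" "\<rho> = act w v - v" using assms(3) by (auto simp: Mov_def)
  have wv: "act w v = v + \<rho>" using v(2) by simp
  have "bf (v + \<rho>) (v + \<rho>) = bf v v" using bf_act[OF assms(1), of v v] wv by simp
  then have b: "bf v \<rho> = - 1 / 2" using assms(2) by (simp add: bf_sym[of \<rho> v])
  then have "act (rt \<rho> \<otimes> w) v = v" using assms wv by (simp add: refl_def)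
  then have fx: "v \<in> Fix (rt \<rho> \<otimes> w)" using v(1) by (simp add: Fix_def)
  have "\<rho> \<notin> Mov (rt \<rho> \<otimes> w)"
    using Mov_orth_Fix[OF _ _ fx, of \<rho>] assms b by auto
  then have "Mov (rt \<rho> \<otimes> w) \<noteq> Mov w" using assms(3) by blast
  then show "rk (rt \<rho> \<otimes> w) < rk w" unfolding rk_def
    using subspace_eq_of_dim[OF Mov_subspace sub fin_dim_Mov[OF assms(1)]] assms by (meson linorder_not_le m_closed rt_carrier)
qed

lemma Mov_rt:
  assumes "\<rho> \<in> roots"
  shows "Mov (rt \<rho>) = span {\<rho>}"
proof (intro equalityI)
  show "Mov (rt \<rho>) \<subseteq> span {\<rho>}"
  proof (rule subsetI)
    fix x assume "x \<in> Mov (rt \<rho>)"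
    then obtain f where "x = refl \<rho> f - f" using assms by (auto simp: Mov_def)
    then have "x = (- 2 * bf f \<rho>) *\<^sub>R \<rho>" by (simp add: refl_def)
    then show "x \<in> span {\<rho>}" by (simp only: real_vector.span_scale real_vector.span_base singletonI)
  qed
  have "refl \<rho> \<rho> - \<rho> = (- 2) *\<^sub>R \<rho>" using assms by (simp add: refl_def algebra_simps)
  then have "(- 2) *\<^sub>R \<rho> \<in> Mov (rt \<rho>)" using MovI[OF roots_V[OF assms], of "rt \<rho>"] assms by simp
  then have "(- 1 / 2) *\<^sub>R (- 2) *\<^sub>R \<rho> \<in> Mov (rt \<rho>)"
    using real_vector.subspace_scale[OF Mov_subspace] assms rt_carrier by blast
  then show "span {\<rho>} \<subseteq> Mov (rt \<rho>)"
    using assms by (intro real_vector.span_minimal Mov_subspace) auto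
qed

lemma rk_rt: "\<rho> \<in> roots \<Longrightarrow> rk (rt \<rho>) = 1"
  unfolding rk_def Mov_rt using roots_ne_0[of \<rho>] real_vector.dim_eq_card_independent[of "{\<rho>}"]
  by (simp add: real_vector.dependent_single)

lemma reflection_word_closed: "set ts \<subseteq> reflections G S \<Longrightarrow> wp ts \<in> carrier G"
  by (induction ts) (auto simp: reflections_carrier)

lemma rk_word_le: "set ts \<subseteq> reflections G S \<Longrightarrow> rk (wp ts) \<le> length ts"
proof (induction ts)
  case (Cons t ts)
  obtain \<rho> where \<rho>: "\<rho> \<in> roots" "t = rt \<rho>"
    using reflection_is_rt[of t] Cons.prems pos_roots_roots by auto
  have "rk (t \<otimes> wp ts) \<le> rk t + rk (wp ts)"
    using Cons.prems \<rho> by (intro rk_mult) (auto simp: reflection_word_closed)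
  then show ?case using Cons \<rho> rk_rt by simp
qed simp

text \<open>Carter's lemma: splitting off a root of the moved space lowers the rank. That all roots
  stay inside \<open>Mov w\<close> is what the later spanning and unfolding arguments use.\<close>

lemma root_factorization:
  assumes "w \<in> carrier G"
  shows "\<exists>rs. set rs \<subseteq> roots \<inter> Mov w \<and> wp (map rt rs) = w \<and> length rs \<le> rk w"
  using assms
proof (induction "rk w" arbitrary: w rule: less_induct)
  case (less w)
  show ?case
  proof (cases "w = \<one>")
    case True
    then show ?thesis by (intro exI[of _ "[]"]) simp
  next
    case False
    obtain \<rho> where \<rho>: "\<rho> \<in> roots" "\<rho> \<in> Mov w" using root_in_Mov less.prems False by blast
    have c: "rt \<rho> \<otimes> w \<in> carrier G" using \<rho> less.prems by simp
    obtain rs where rs: "set rs \<subseteq> roots \<inter> Mov (rt \<rho> \<otimes> w)" "wp (map rt rs) = rt \<rho> \<otimes> w" "length rs \<le> rk (rt \<rho> \<otimes> w)"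
      using less.hyps[OF Mov_rt_mult(2)[OF less.prems \<rho>] c] by blast
    have "wp (map rt (\<rho> # rs)) = w" using rs(2) \<rho>(1) less.prems by (simp add: m_assoc[symmetric])
    moreover have "set (\<rho> # rs) \<subseteq> roots \<inter> Mov w" using rs(1) \<rho> Mov_rt_mult(1)[OF less.prems \<rho>] by auto
    moreover have "length (\<rho> # rs) \<le> rk w" using rs(3) Mov_rt_mult(2)[OF less.prems \<rho>] by simp
    ultimately show ?thesis by blast
  qed
qed

lemma reflection_length_eq_rk:
  assumes "w \<in> carrier G"
  shows "reflection_length G (reflections G S) w = rk w"
proof -
  obtain rs where rs: "set rs \<subseteq> roots \<inter> Mov w" "wp (map rt rs) = w" "length rs \<le> rk w"
    using root_factorization assms by blast
  have m: "set (map rt rs) \<subseteq> reflections G S" using rs(1) by auto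
  have "length rs = rk w" using rk_word_le[OF m] rs by simp
  then show ?thesis unfolding reflection_length_def
  proof (intro Least_equality)
    show "\<exists>ts\<in>lists (reflections G S). length ts = rk w \<and> wp ts = w" if "length rs = rk w"
      using m rs(2) that by (intro bexI[of _ "map rt rs"]) (auto simp: lists_eq_set)
    show "rk w \<le> n" if "\<exists>ts\<in>lists (reflections G S). length ts = n \<and> wp ts = w" for n
      using that rk_word_le by (auto simp: lists_eq_set)
  qed
qed

lemma Mov_subset_span_roots:
  assumes "w \<in> carrier G"
  shows "Mov w \<subseteq> span (roots \<inter> Mov w)"
proof -
  obtain rs where rs: "set rs \<subseteq> roots \<inter> Mov w" "wp (map rt rs) = w"
    using root_factorization assms by blast
  have "Mov (wp (map rt rs)) \<subseteq> span (set rs)" if "set rs \<subseteq> roots" for rs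
    using that
  proof (induction rs)
    case (Cons \<rho> rs)
    have c: "wp (map rt rs) \<in> carrier G" using Cons.prems by (intro reflection_word_closed) auto
    show ?case unfolding list.map wp_Cons
    proof (rule Mov_mult_subset)
      show "Mov (rt \<rho>) \<subseteq> span (set (\<rho> # rs))" using Mov_rt[of \<rho>] Cons.prems
        by (simp add: real_vector.span_mono)
      show "Mov (wp (map rt rs)) \<subseteq> span (set (\<rho> # rs))" using Cons
        by (meson list.set_intros(2) order_trans real_vector.span_mono set_subset_Cons subset_trans)
    qed (use Cons.prems c in auto)
  qed (simp add: real_vector.span_empty)
  then have "Mov w \<subseteq> span (set rs)" using rs by blast
  then show ?thesis using real_vector.span_mono[OF rs(1)] by blast
qed

abbreviation abs_le' :: "'a \<Rightarrow> 'a \<Rightarrow> bool" (infix \<open>\<preceq>\<close> 50) where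
  "u \<preceq> w \<equiv> abs_le G (reflections G S) u w"

lemma abs_le_iff:
  "u \<in> carrier G \<Longrightarrow> w \<in> carrier G \<Longrightarrow> u \<preceq> w \<longleftrightarrow> rk (w \<otimes> inv u) + rk u = rk w"
  by (auto simp: abs_le_def reflection_length_eq_rk)

text \<open>\<open>Mov w\<close> is contained in the sum of the moved spaces of the two factors;
  when the dimensions add up it equals this sum.\<close>

lemma abs_le_Mov:
  assumes "u \<in> carrier G" "w \<in> carrier G" "rk (w \<otimes> inv u) + rk u = rk w"
  shows "Mov u \<subseteq> Mov w" "Mov (w \<otimes> inv u) \<subseteq> Mov w"
proof -
  have "x \<in> Mov w \<Longrightarrow> \<exists>a\<in>Mov (w \<otimes> inv u). \<exists>b\<in>Mov u. x = a + b" for x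
    using Mov_mult[of "w \<otimes> inv u" u x] assms by (simp add: m_assoc)
  then have "Mov (w \<otimes> inv u) \<subseteq> Mov w \<and> Mov u \<subseteq> Mov w"
    using assms by (intro subset_of_dim_sum) (auto simp: rk_def intro: Mov_subspace fin_dim_Mov)
  then show "Mov u \<subseteq> Mov w" "Mov (w \<otimes> inv u) \<subseteq> Mov w" by blast+
qed

lemma rt_abs_le_iff:
  assumes "\<rho> \<in> roots" "w \<in> carrier G"
  shows "rt \<rho> \<preceq> w \<longleftrightarrow> \<rho> \<in> Mov w"
proof
  assume "rt \<rho> \<preceq> w"
  then have "Mov (rt \<rho>) \<subseteq> Mov w" using abs_le_iff abs_le_Mov assms by simp
  then show "\<rho> \<in> Mov w" using Mov_rt[OF assms(1)] real_vector.span_base by blast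
next
  assume r: "\<rho> \<in> Mov w"
  have "rk (w \<otimes> rt \<rho>) < rk w" using Mov_rt_mult(2)[OF assms(2,1) r] rk_mult_commute assms by simp
  moreover have "rk w \<le> rk (w \<otimes> rt \<rho>) + 1"
    using rk_mult[of "w \<otimes> rt \<rho>" "rt \<rho>"] assms rk_rt by (simp add: m_assoc)
  ultimately show "rt \<rho> \<preceq> w" using assms rk_rt by (simp add: abs_le_iff)
qed

subsection \<open>Products of orthogonal simple reflections\<close>

definition orth :: "'a set \<Rightarrow> bool" where
  "orth A \<longleftrightarrow> A \<subseteq> S \<and> (\<forall>s\<in>A. \<forall>t\<in>A. s \<noteq> t \<longrightarrow> bm s t = 0)"

lemma orth_subset: "orth A \<Longrightarrow> B \<subseteq> A \<Longrightarrow> orth B"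
  unfolding orth_def by blast

lemma orth_S: "orth A \<Longrightarrow> A \<subseteq> S"
  by (simp add: orth_def)

lemma orth_finite: "orth A \<Longrightarrow> finite A"
  using finite_S finite_subset orth_S by blast

lemma pairwise_commuting_orth: "A \<subseteq> S \<Longrightarrow> pairwise_commuting G A \<Longrightarrow> orth A"
  by (auto simp: orth_def pairwise_commuting_def intro!: bm_commute)

lemma orth_pairwise_commuting:
  assumes "orth A"
  shows "pairwise_commuting G A"
  unfolding pairwise_commuting_def
proof (intro ballI)
  fix s t assume st: "s \<in> A" "t \<in> A"
  show "s \<otimes> t = t \<otimes> s"
  proof (cases "s = t")
    case False
    have S: "s \<in> S" "t \<in> S" using st assms orth_S by auto
    have "ord (s \<otimes> t) = 2" using bm_eq_0_iff[OF S False] assms st False by (simp add: orth_def)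
    then have "(s \<otimes> t) \<otimes> (s \<otimes> t) = \<one>"
      using pow_ord_eq_1[of "s \<otimes> t"] S by (simp add: numeral_2_eq_2)
    then have "s \<otimes> t = inv (s \<otimes> t)" using S by (metis S_in inv_equality m_closed)
    then show ?thesis using S by (simp add: inv_mult_group)
  qed simp
qed

definition pr :: "'a set \<Rightarrow> 'a" where
  "pr A = commuting_prod G A"

text \<open>Closed form of the action of \<open>pr A\<close> for orthogonal \<open>A\<close>, free
  of any enumeration of \<open>A\<close>. Only coordinates in \<open>A\<close> change
  (\<open>pra_coord\<close>), and most sign arguments rest on this.\<close>

definition pra :: "'a set \<Rightarrow> ('a \<Rightarrow> real) \<Rightarrow> ('a \<Rightarrow> real)" where
  "pra A f = f - (\<Sum>s\<in>A. (2 * bf f (simple_root s)) *\<^sub>R simple_root s)"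

lemma pra_empty [simp]: "pra {} f = f"
  by (simp add: pra_def)

lemma pra_coord: "finite A \<Longrightarrow> pra A f t = (if t \<in> A then f t - 2 * bf f (simple_root t) else f t)"
proof -
  assume "finite A"
  have "(\<Sum>s\<in>A. (2 * bf f (simple_root s)) *\<^sub>R simple_root s) t
      = (\<Sum>s\<in>A. if s = t then 2 * bf f (simple_root t) else 0)"
    unfolding fun_apply by (intro sum.cong) (auto simp: simple_root_apply)
  then show ?thesis using \<open>finite A\<close> by (simp add: pra_def fun_apply)
qed

lemma bf_pra_simple:
  assumes "orth A" "t \<in> S" "\<And>s. s \<in> A \<Longrightarrow> s \<noteq> t \<Longrightarrow> bm s t = 0"
  shows "bf (pra A f) (simple_root t) = (if t \<in> A then - bf f (simple_root t) else bf f (simple_root t))"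
proof -
  have "(\<Sum>s\<in>A. 2 * bf f (simple_root s) * bf (simple_root s) (simple_root t))
    = (\<Sum>s\<in>A. if s = t then 2 * bf f (simple_root t) else 0)"
    using assms orth_S[OF assms(1)] by (intro sum.cong) (auto simp: subset_iff)
  then show ?thesis using orth_finite[OF assms(1)] by (simp add: pra_def)
qed

lemma pra_insert:
  assumes "orth (insert x A)" "x \<notin> A"
  shows "pra (insert x A) f = rf x (pra A f)"
proof -
  have o: "orth A" "x \<in> S" using assms orth_subset orth_S by blast+
  have "bf (pra A f) (simple_root x) = bf f (simple_root x)"
    using bf_pra_simple[OF o(1,2)] assms by (auto simp: orth_def)
  then show ?thesis using assms(2) orth_finite[OF o(1)] by (simp add: refl_def pra_def algebra_simps)
qed

lemma pr_act:
  assumes "orth A"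
  shows "pr A \<in> carrier G \<and> act (pr A) f = pra A f"
proof -
  obtain xs where xs: "set xs = A" "distinct xs" using finite_distinct_list orth_finite assms by blast
  have S: "set xs \<subseteq> S" using xs orth_S assms by blast
  have "pr A = wp xs" unfolding pr_def xs(1)[symmetric]
    by (rule commuting_prod_eq) (use xs S S_carrier orth_pairwise_commuting assms is_group in auto)
  moreover have "wact ys f = pra (set ys) f" if "orth (set ys)" "distinct ys" for ys
    using that
  proof (induction ys)
    case (Cons y ys)
    moreover have "orth (set ys)" using Cons.prems(1) by (rule orth_subset) auto
    ultimately show ?case using pra_insert[of y "set ys" f] by auto
  qed simp
  ultimately show ?thesis using act_wp[OF S] xs S assms by auto
qed

lemma pr_carrier [simp]: "orth A \<Longrightarrow> pr A \<in> carrier G"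
  using pr_act by blast

lemma act_pr [simp]: "orth A \<Longrightarrow> act (pr A) f = pra A f"
  using pr_act by blast

lemma pra_pra:
  assumes "orth A"
  shows "pra A (pra A f) = f"
proof (rule ext)
  fix t
  show "pra A (pra A f) t = f t"
    using assms bf_pra_simple[OF assms, of t f] orth_finite[OF assms] orth_S[OF assms]
    by (auto simp: pra_coord orth_def)
qed

lemma pr_sq [simp]: "orth A \<Longrightarrow> pr A \<otimes> pr A = \<one>"
  by (rule act_inj) (auto simp: pra_pra)

lemma pr_inv [simp]: "orth A \<Longrightarrow> inv (pr A) = pr A"
  by (simp add: inv_equality)

lemma pr_singleton [simp]: "s \<in> S \<Longrightarrow> pr {s} = s"
  by (rule act_inj) (auto simp: orth_def pra_def refl_def)

lemma pra_Un:
  assumes "orth (A \<union> B)" "A \<inter> B = {}"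
  shows "pra (A \<union> B) f = pra A (pra B f)"
proof (rule ext)
  fix t
  have o: "orth A" "orth B" using assms orth_subset by blast+
  have *: "bf (pra B f) (simple_root t) = bf f (simple_root t)" if "t \<in> A"
  proof -
    have "t \<in> S" "t \<notin> B" using that orth_S[OF o(1)] assms(2) by auto
    moreover have "bm s t = 0" if "s \<in> B" "s \<noteq> t" for s using that \<open>t \<in> A\<close> assms(1) by (auto simp: orth_def)
    ultimately show ?thesis using bf_pra_simple[OF o(2), of t f] by auto
  qed
  show "pra (A \<union> B) f t = pra A (pra B f) t"
    using * assms(2) orth_finite[OF o(1)] orth_finite[OF o(2)] by (auto simp: pra_coord)
qed

lemma pr_Un:
  assumes "orth (A \<union> B)" "A \<inter> B = {}"
  shows "pr (A \<union> B) = pr A \<otimes> pr B"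
proof -
  have o: "orth A" "orth B" using assms orth_subset by blast+
  show ?thesis by (rule act_inj) (use assms o pra_Un in auto)
qed

lemma pra_V: "orth A \<Longrightarrow> A \<subseteq> J \<Longrightarrow> f \<in> V J \<Longrightarrow> pra A f \<in> V J"
  using orth_finite by (auto simp: V_def pra_coord)

lemma pra_add: "orth A \<Longrightarrow> pra A (f + g) = pra A f + pra A g"
  and pra_scale: "orth A \<Longrightarrow> pra A (r *\<^sub>R f) = r *\<^sub>R pra A f"
  and pra_minus: "orth A \<Longrightarrow> pra A (- f) = - pra A f"
  and pra_diff: "orth A \<Longrightarrow> pra A (f - g) = pra A f - pra A g"
  and pra_zero: "orth A \<Longrightarrow> pra A 0 = 0"
  by (simp_all add: act_pr[symmetric] del: act_pr)

lemma pra_linear: "orth A \<Longrightarrow> linear (pra A)"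
  by (simp add: linear_iff pra_add pra_scale)

lemma pra_roots: "orth A \<Longrightarrow> \<rho> \<in> roots \<Longrightarrow> pra A \<rho> \<in> roots"
  using act_roots[of \<rho> "pr A"] by simp

lemma pra_simple:
  assumes "orth A" "s \<in> A"
  shows "pra A (simple_root s) = - simple_root s"
proof -
  have "s \<in> S" using assms orth_S by blast
  then have "(\<Sum>t\<in>A. (2 * bf (simple_root s) (simple_root t)) *\<^sub>R simple_root t)
      = (\<Sum>t\<in>A. if t = s then 2 *\<^sub>R simple_root s else 0)"
    using assms by (intro sum.cong) (auto simp: orth_def subset_iff)
  then show ?thesis using assms orth_finite by (simp add: pra_def scaleR_2)
qed

lemma pra_simple_notin:
  assumes "orth (insert s A)" "s \<notin> A"
  shows "pra A (simple_root s) = simple_root s"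
proof -
  have "(\<Sum>t\<in>A. (2 * bf (simple_root s) (simple_root t)) *\<^sub>R simple_root t) = 0"
    using assms by (intro sum.neutral) (auto simp: orth_def subset_iff)
  then show ?thesis by (simp add: pra_def)
qed

lemma pra_pos_root:
  assumes "orth A" "\<rho> \<in> pos_roots" "\<rho> \<notin> simple_root ` A"
  shows "pra A \<rho> \<in> pos_roots"
  using orth_finite[OF assms(1)] assms
proof (induction A rule: finite_induct)
  case (insert x A)
  have o: "orth A" "x \<in> S" using insert.prems orth_subset orth_S by blast+
  have p: "pra A \<rho> \<in> pos_roots" using insert o by auto
  have "pra A \<rho> \<noteq> simple_root x"
  proof
    assume "pra A \<rho> = simple_root x"
    then have "\<rho> = pra A (simple_root x)" using pra_pra[OF o(1)] by metis
    then show False using pra_simple_notin insert.prems insert.hyps by auto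
  qed
  then show ?case using pra_insert[OF insert.prems(1) insert.hyps(2)] refl_pos_root[OF p o(2)] by simp
qed simp

subsection \<open>The form attached to a bipartition\<close>

definition bip :: "'a set \<Rightarrow> bool" where
  "bip P \<longleftrightarrow> P \<subseteq> S \<and> orth P \<and> orth (S - P)"

lemma bipD: "bip P \<Longrightarrow> P \<subseteq> S" "bip P \<Longrightarrow> orth P" "bip P \<Longrightarrow> orth (S - P)"
  by (auto simp: bip_def)

lemma bip_compl: "bip P \<Longrightarrow> bip (S - P)"
  by (auto simp: bip_def double_diff)

lemma bip_orth:
  assumes "bip P" "J \<subseteq> S"
  shows "orth (J \<inter> P)" "orth (J - P)"
  using orth_subset[OF bipD(2)[OF assms(1)], of "J \<inter> P"] orth_subset[OF bipD(3)[OF assms(1)], of "J - P"] assms(2)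
  by auto

text \<open>
  The nonsymmetric form \<open>E\<close> determined by \<open>B f g = E f (g - c\<^sup>-\<^sup>1 g)\<close>, where \<open>c\<close> is the bipartite
  Coxeter element of the pair \<open>(P, S - P)\<close>.
\<close>

definition eul :: "'a set \<Rightarrow> ('a \<Rightarrow> real) \<Rightarrow> ('a \<Rightarrow> real) \<Rightarrow> real" where
  "eul P f g = (\<Sum>s\<in>P. f s * g s) / 2 - (\<Sum>s\<in>S - P. f s * pra (S - P) g s) / 2"

lemma eul_add_left: "eul P (f + g) h = eul P f h + eul P g h"
  by (simp add: eul_def fun_apply algebra_simps sum.distrib add_divide_distrib)

lemma eul_scale_left: "eul P (r *\<^sub>R f) h = r * eul P f h"
  by (simp add: eul_def fun_apply algebra_simps sum_distrib_left)

lemma eul_add_right: "bip P \<Longrightarrow> eul P h (f + g) = eul P h f + eul P h g"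
  by (simp add: eul_def pra_add bipD fun_apply algebra_simps sum.distrib add_divide_distrib)

lemma eul_scale_right: "bip P \<Longrightarrow> eul P h (r *\<^sub>R f) = r * eul P h f"
  by (simp add: eul_def pra_scale bipD fun_apply algebra_simps sum_distrib_left)

lemma eul_linear_left: "linear (\<lambda>f. eul P f g)"
  by (simp add: linear_iff eul_add_left eul_scale_left)

lemma eul_linear_right: "bip P \<Longrightarrow> linear (eul P f)"
  by (simp add: linear_iff eul_add_right eul_scale_right)

lemma eul_minus_left [simp]: "eul P (- f) g = - eul P f g"
  using eul_scale_left[of P "-1" f g] by simp

lemma eul_minus_right [simp]: "bip P \<Longrightarrow> eul P f (- g) = - eul P f g"
  using eul_scale_right[of P f "-1" g] by simp

lemma eul_diff_left: "eul P (f - g) h = eul P f h - eul P g h"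
  by (rule linear_diff[OF eul_linear_left])

lemma eul_diff_right: "bip P \<Longrightarrow> eul P h (f - g) = eul P h f - eul P h g"
  by (rule linear_diff[OF eul_linear_right])

lemma eul_zero [simp]: "eul P 0 f = 0" "bip P \<Longrightarrow> eul P f 0 = 0"
  using linear_0[OF eul_linear_left] linear_0[OF eul_linear_right] by auto

lemma bf_bip_simple:
  assumes "bip P" "s \<in> S - P"
  shows "bf g (simple_root s) = g s + (\<Sum>t\<in>P. g t * bm t s)"
proof -
  have S: "P \<subseteq> S" "finite P" using assms bipD finite_subset finite_S by blast+
  have "bf g (simple_root s) = (\<Sum>t\<in>S. g t * bm t s)" using assms by (simp add: bf_simple_right)
  also have "\<dots> = (\<Sum>t\<in>S - P. g t * bm t s) + (\<Sum>t\<in>P. g t * bm t s)"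
    using S by (simp add: sum.subset_diff)
  also have "(\<Sum>t\<in>S - P. g t * bm t s) = (\<Sum>t\<in>S - P. if t = s then g s else 0)"
    using assms bipD(3)[OF assms(1)] by (intro sum.cong) (auto simp: orth_def)
  also have "\<dots> = g s" using assms by simp
  finally show ?thesis .
qed

text \<open>The matrix of \<open>E\<close>: half the identity plus those entries of the Gram matrix
  whose row lies in \<open>S - P\<close> and column in \<open>P\<close>. Exchanging the halves
  transposes it.\<close>

lemma eul_alt:
  assumes "bip P"
  shows "eul P f g = (\<Sum>s\<in>S. f s * g s) / 2 + (\<Sum>s\<in>S - P. \<Sum>t\<in>P. f s * g t * bm t s)"
proof -
  have S: "P \<subseteq> S" using assms bipD by blast
  have "(\<Sum>s\<in>S - P. f s * pra (S - P) g s) = (\<Sum>s\<in>S - P. - (f s * g s) - 2 * (\<Sum>t\<in>P. f s * g t * bm t s))"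
    using bf_bip_simple[OF assms]
    by (intro sum.cong) (simp_all add: pra_coord algebra_simps sum_distrib_left)
  also have "\<dots> = - (\<Sum>s\<in>S - P. f s * g s) - 2 * (\<Sum>s\<in>S - P. \<Sum>t\<in>P. f s * g t * bm t s)"
    by (simp add: sum_subtractf sum_negf sum_distrib_left)
  finally show ?thesis using sum.subset_diff[OF S finite_S, of "\<lambda>s. f s * g s"]
    by (simp add: eul_def field_simps)
qed

lemma eul_flip:
  assumes "bip P"
  shows "eul P f g = eul (S - P) g f"
proof -
  have S: "P \<subseteq> S" using assms bipD by blast
  have "(\<Sum>s\<in>S - P. \<Sum>t\<in>P. f s * g t * bm t s) = (\<Sum>t\<in>P. \<Sum>s\<in>S - P. g t * f s * bm s t)"
    using S by (subst sum.swap, intro sum.cong HOL.refl) (auto simp: bm_sym[of _ "_"] mult.commute)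
  then show ?thesis using S by (simp add: eul_alt assms bip_compl double_diff mult.commute)
qed

lemma eul_sym_sum:
  assumes "bip P" "f \<in> V S"
  shows "eul P f g + eul P g f = bf f g"
proof -
  have S: "P \<subseteq> S" using assms bipD by blast
  have "bf g f = (\<Sum>s\<in>S. f s * bf g (simple_root s))" by (rule bf_nonneg_expand[OF assms(2)])
  also have "\<dots> = (\<Sum>s\<in>S - P. f s * bf g (simple_root s)) + (\<Sum>s\<in>S - (S - P). f s * bf g (simple_root s))"
    using S sum.subset_diff[OF S finite_S, of "\<lambda>s. f s * bf g (simple_root s)"] by (simp add: double_diff)
  also have "\<dots> = (\<Sum>s\<in>S - P. f s * (g s + (\<Sum>t\<in>P. g t * bm t s)))
     + (\<Sum>s\<in>S - (S - P). f s * (g s + (\<Sum>t\<in>S - P. g t * bm t s)))"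
    using bf_bip_simple[OF assms(1)] bf_bip_simple[OF bip_compl[OF assms(1)]]
    by (intro arg_cong2[of _ _ _ _ "(+)"] sum.cong) simp_all
  also have "\<dots> = (\<Sum>s\<in>S - P. f s * g s) + (\<Sum>s\<in>S - (S - P). f s * g s)
     + (\<Sum>s\<in>S - P. \<Sum>t\<in>P. f s * g t * bm t s) + (\<Sum>s\<in>S - (S - P). \<Sum>t\<in>S - P. f s * g t * bm t s)"
    by (simp add: distrib_left sum.distrib sum_distrib_left mult.assoc)
  also have "\<dots> = eul P f g + eul (S - P) f g"
    using S sum.subset_diff[OF S finite_S, of "\<lambda>s. f s * g s"]
    by (simp add: eul_alt assms(1) bip_compl double_diff)
  finally show ?thesis using eul_flip[OF assms(1), of g f] bf_sym by simp
qed

lemma eul_self: "bip P \<Longrightarrow> f \<in> V S \<Longrightarrow> eul P f f = bf f f / 2"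
  using eul_sym_sum[of P f f] by simp

lemma eul_simple:
  assumes "bip P" "s \<in> P"
  shows "eul P (simple_root s) g = g s / 2"
proof -
  have "finite P" using assms bipD finite_subset finite_S by blast
  have "(\<Sum>t\<in>P. simple_root s t * g t) = (\<Sum>t\<in>P. if t = s then g s else 0)"
    by (intro sum.cong) (auto simp: simple_root_apply)
  moreover have "(\<Sum>t\<in>S - P. simple_root s t * pra (S - P) g t) = 0"
    using assms by (intro sum.neutral) (auto simp: simple_root_apply)
  ultimately show ?thesis using assms \<open>finite P\<close> by (simp add: eul_def)
qed

lemma eul_simple_right:
  assumes "bip P" "s \<in> S - P"
  shows "eul P g (simple_root s) = g s / 2"
  using eul_flip[OF assms(1), of g "simple_root s"] eul_simple[OF bip_compl[OF assms(1)] assms(2)] by simp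

text \<open>Conjugation by the first half exchanges the halves of the Coxeter element, and the form
  follows along. In \<open>V J\<close> it suffices to reflect in \<open>J \<inter> P\<close>,
  because coordinates outside \<open>J\<close> vanish. Every induction by rotation rests on this
  isometry.\<close>

lemma eul_rotate:
  assumes "bip P" "J \<subseteq> S" "f \<in> V J" "g \<in> V J"
  shows "eul (S - P) (pra (J \<inter> P) f) (pra (J \<inter> P) g) = eul P f g"
proof -
  have S: "P \<subseteq> S" "S - (S - P) = P" "finite P" using assms bipD finite_subset finite_S by blast+
  have o: "orth (J \<inter> P)" using bip_orth assms by blast
  have f: "finite (J \<inter> P)" using S by simp
  let ?F = "pra (J \<inter> P) f" and ?G = "pra (J \<inter> P) g"
  have F0: "?F s = 0" if "s \<notin> J" for s using that assms(3) f by (simp add: pra_coord V_def)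
  have PG: "pra P ?G s = g s" if "s \<in> J" "s \<in> P" for s
  proof -
    have "pra P ?G s = pra (J \<inter> P) ?G s" using that f S by (simp add: pra_coord)
    then show ?thesis using pra_pra[OF o] by simp
  qed
  have "eul (S - P) ?F ?G = (\<Sum>s\<in>S - P. f s * g s) / 2 - (\<Sum>s\<in>P. ?F s * g s) / 2"
  proof -
    have "(\<Sum>s\<in>S - P. ?F s * ?G s) = (\<Sum>s\<in>S - P. f s * g s)"
      using f by (intro sum.cong) (auto simp: pra_coord)
    moreover have "(\<Sum>s\<in>P. ?F s * pra P ?G s) = (\<Sum>s\<in>P. ?F s * g s)"
      using F0 PG by (intro sum.cong HOL.refl) (metis mult_zero_left)
    ultimately show ?thesis unfolding eul_def S(2) by simp
  qed
  also have "(\<Sum>s\<in>P. ?F s * g s) = (\<Sum>s\<in>P. g s * pra P f s)"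
    using assms(4) f S by (intro sum.cong HOL.refl) (auto simp: pra_coord V_def)
  also have "(\<Sum>s\<in>S - P. f s * g s) / 2 - (\<Sum>s\<in>P. g s * pra P f s) / 2 = eul (S - P) g f"
    unfolding eul_def S(2) by (simp add: mult.commute)
  finally show ?thesis using eul_flip[OF assms(1)] by simp
qed

definition cox :: "'a set \<Rightarrow> 'a set \<Rightarrow> 'a" where
  "cox P J = pr (J \<inter> P) \<otimes> pr (J - P)"

lemma cox_carrier [simp]: "bip P \<Longrightarrow> J \<subseteq> S \<Longrightarrow> cox P J \<in> carrier G"
  by (simp add: cox_def bip_orth)

lemma act_cox: "bip P \<Longrightarrow> J \<subseteq> S \<Longrightarrow> act (cox P J) f = pra (J \<inter> P) (pra (J - P) f)"
  by (simp add: cox_def bip_orth)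

lemma act_inv_cox: "bip P \<Longrightarrow> J \<subseteq> S \<Longrightarrow> act (inv (cox P J)) f = pra (J - P) (pra (J \<inter> P) f)"
  by (simp add: cox_def bip_orth inv_mult_group)

lemma cox_rotate:
  assumes "bip P" "J \<subseteq> S"
  shows "pr (J \<inter> P) \<otimes> cox (S - P) J \<otimes> pr (J \<inter> P) = cox P J"
proof -
  have "J \<inter> (S - P) = J - P" "J - (S - P) = J \<inter> P" using assms by blast+
  then show ?thesis using assms by (simp add: cox_def bip_orth m_assoc)
qed

lemma eul_inv_cox:
  assumes "bip P"
  shows "eul P f (act (inv (cox P S)) g) = - eul P g f"
proof -
  have S: "S \<inter> P = P" "S - (S - P) = P" using assms bipD by blast+
  have o: "orth P" "orth (S - P)" using assms bipD by blast+
  have "eul P f (act (inv (cox P S)) g) = (\<Sum>s\<in>P. f s * pra (S - P) (pra P g) s) / 2 - (\<Sum>s\<in>S - P. f s * pra P g s) / 2"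
    using act_inv_cox[OF assms, of S] by (simp add: eul_def S pra_pra[OF o(2)])
  also have "\<dots> = (\<Sum>s\<in>P. f s * pra P g s) / 2 - (\<Sum>s\<in>S - P. f s * g s) / 2"
    using orth_finite[OF o(1)] orth_finite[OF o(2)] by (simp add: pra_coord)
  also have "\<dots> = - eul (S - P) f g" by (simp add: eul_def S)
  finally show ?thesis using eul_flip[OF assms, of g f] by simp
qed

lemma eul_cox:
  assumes "bip P"
  shows "eul P (act (cox P S) f) g = - eul P g f"
  using eul_inv_cox[OF assms, of g "act (cox P S) f"] assms by simp

lemma bf_eul_inv_cox:
  assumes "bip P" "f \<in> V S"
  shows "eul P f (g - act (inv (cox P S)) g) = bf f g"
  using eul_sym_sum[OF assms, of g] eul_inv_cox[OF assms(1), of f g] by (simp add: eul_diff_right assms)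

lemma bf_eul_cox:
  assumes "bip P" "f \<in> V S"
  shows "eul P (f - act (cox P S) f) g = bf f g"
  using eul_sym_sum[OF assms, of g] eul_cox[OF assms(1), of f g] by (simp add: eul_diff_left)

lemma simple_root_inject [simp]: "simple_root s = simple_root t \<longleftrightarrow> s = t"
  by (metis simple_root_apply zero_neq_one)

lemma independent_simple_roots: "independent (simple_root ` J)"
proof (subst real_vector.independent_explicit_finite_subsets, intro allI impI ballI)
  fix A u v assume A: "A \<subseteq> simple_root ` J" "finite A" "(\<Sum>v\<in>A. u v *\<^sub>R v) = 0" "v \<in> A"
  obtain s where s: "v = simple_root s" using A by blast
  have "(\<Sum>x\<in>A. u x *\<^sub>R x) s = (\<Sum>x\<in>A. if x = v then u v else 0)"
    unfolding fun_apply
  proof (rule sum.cong[OF HOL.refl])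
    fix x assume "x \<in> A"
    then obtain t where t: "x = simple_root t" using A(1) by blast
    then show "u x *\<^sub>R x s = (if x = v then u v else 0)" unfolding s t by (simp add: simple_root_apply)
  qed
  then show "u v = 0" using A by (simp add: fun_apply)
qed

lemma dim_V:
  assumes "finite J"
  shows "dim (V J) = card J"
proof (rule antisym)
  show "dim (V J) \<le> card J"
    using real_vector.dim_le_card[OF V_subset_span[OF assms]] card_image_le[OF assms, of simple_root] assms by simp
  have "inj_on simple_root J" by (auto simp: inj_on_def)
  then show "card J \<le> dim (V J)"
    using card_independent_le_dim[OF fin_dim_V[OF assms] independent_simple_roots[of J]]
      image_subsetI[of J simple_root "V J"] simple_root_V[of _ J] by (simp add: card_image)
qed

text \<open>For a fixed vector \<open>v\<close> the two halves of the Coxeter element act alike, but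
  they change disjoint sets of coordinates. So neither changes \<open>v\<close>, which is therefore
  orthogonal to the simple roots of \<open>J\<close>.\<close>

lemma Mov_cox:
  assumes "bip P" "J \<subseteq> S"
  shows "Mov (cox P J) = V J"
proof (intro equalityI subsetI)
  have f: "finite (J \<inter> P)" "finite (J - P)" using assms finite_S finite_subset by blast+
  fix x assume "x \<in> Mov (cox P J)"
  then obtain g where "x = pra (J \<inter> P) (pra (J - P) g) - g" using assms by (auto simp: Mov_def act_cox)
  then show "x \<in> V J" using f by (auto simp: V_def pra_coord fun_apply)
next
  fix \<eta> assume \<eta>: "\<eta> \<in> V J"
  have f: "finite (J \<inter> P)" "finite (J - P)" "finite J" using assms finite_S finite_subset by blast+
  have o: "orth (J \<inter> P)" "orth (J - P)" using bip_orth assms by blast+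
  have VS: "\<eta> \<in> V S" using \<eta> V_mono assms by blast
  show "\<eta> \<in> Mov (cox P J)"
  proof (rule Mov_of_orth_Fix)
    fix v assume "v \<in> Fix (cox P J)"
    then have "pra (J \<inter> P) (pra (J - P) v) = v" using assms by (simp add: Fix_def act_cox)
    then have e: "pra (J - P) v = pra (J \<inter> P) v" using pra_pra[OF o(1)] by metis
    have b: "bf v (simple_root s) = 0" if "s \<in> J" for s
      using fun_cong[OF e, of s] that f by (auto simp: pra_coord split: if_splits)
    have "bf v \<eta> = (\<Sum>s\<in>S. \<eta> s * bf v (simple_root s))" by (rule bf_nonneg_expand[OF VS])
    also have "\<dots> = 0" using b \<eta> by (intro sum.neutral) (auto simp: V_def)
    finally show "bf v \<eta> = 0" .
  qed (use assms VS in auto)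
qed

lemma rk_cox: "bip P \<Longrightarrow> J \<subseteq> S \<Longrightarrow> rk (cox P J) = card J"
  using Mov_cox dim_V finite_subset[OF _ finite_S] by (simp add: rk_def)

end

lemma cone_hull_split:
  assumes "x \<in> cone_hull M" "m \<in> M"
  shows "\<exists>a y. 0 \<le> a \<and> y \<in> cone_hull (M - {m}) \<and> x = a *\<^sub>R m + y"
  using assms(1)
proof induction
  case zero
  then show ?case by (intro exI[of _ 0]) (auto intro: cone_hull.zero)
next
  case (add x b r)
  then obtain a y where ay: "0 \<le> a" "y \<in> cone_hull (M - {m})" "x = a *\<^sub>R m + y" by blast
  show ?case
  proof (cases "b = m")
    case True
    then show ?thesis using ay add by (intro exI[of _ "a + r"] exI[of _ y]) (simp add: scaleR_add_left)
  next
    case False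
    then have "y + r *\<^sub>R b \<in> cone_hull (M - {m})" using ay add by (intro cone_hull.add) auto
    then show ?thesis using ay by (intro exI[of _ a] exI[of _ "y + r *\<^sub>R b"]) (simp add: add.assoc)
  qed
qed

context irreducible_coxeter
begin

subsection \<open>Noncrossing elements and their moved spaces\<close>

text \<open>Membership in \<open>NC\<close> expressed by ranks, with \<open>card S\<close> the rank
  of the Coxeter element; see \<open>noncrossing_iff_abs_le\<close>.\<close>

definition noncrossing :: "'a set \<Rightarrow> 'a \<Rightarrow> bool" where
  "noncrossing P y \<longleftrightarrow> y \<in> carrier G \<and> rk (cox P S \<otimes> inv y) + rk y = card S"

text \<open>On a vector \<open>v\<close> fixed by \<open>y\<close>, the elements \<open>c\<close>
  and \<open>c \<otimes> inv y\<close> agree. Hence \<open>act c v - v\<close> lies in the moved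
  space of the latter, and \<open>bf_eul_cox\<close> turns its annihilation of \<open>\<eta>\<close>
  into orthogonality of \<open>v\<close> and \<open>\<eta>\<close>.\<close>

lemma Mov_left_annihilator:
  assumes "bip P" "y \<in> carrier G" "\<eta> \<in> V S"
    and "\<And>\<sigma>. \<sigma> \<in> Mov (cox P S \<otimes> inv y) \<Longrightarrow> eul P \<sigma> \<eta> = 0"
  shows "\<eta> \<in> Mov y"
proof (rule Mov_of_orth_Fix[OF assms(2,3)])
  fix v assume v: "v \<in> Fix y"
  let ?z = "cox P S \<otimes> inv y"
  have z: "?z \<in> carrier G" using assms by simp
  have "v \<in> V S" "act y v = v" using v by (auto simp: Fix_def)
  then have "act (cox P S) v = act ?z v"
    using assms(1,2) act_inv(1)[OF assms(2), of v] by simp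
  then have "act (cox P S) v - v \<in> Mov ?z" using MovI \<open>v \<in> V S\<close> by metis
  then have "eul P (act (cox P S) v - v) \<eta> = 0" by (rule assms(4))
  then show "bf v \<eta> = 0" using bf_eul_cox[OF assms(1) \<open>v \<in> V S\<close>, of \<eta>] by (simp add: eul_diff_left)
qed

lemma rk_mult_ge: "u \<in> carrier G \<Longrightarrow> w \<in> carrier G \<Longrightarrow> rk w \<le> rk u + rk (u \<otimes> w)"
  using rk_mult[of "inv u" "u \<otimes> w"] by (simp add: m_assoc[symmetric])

text \<open>It suffices to treat a root \<open>\<tau>\<close> of the moved space of
  \<open>c \<otimes> inv y\<close>. Splitting its reflection off \<open>c\<close> keeps ranks
  additive, so \<open>y\<close> is still below \<open>rt \<tau> \<otimes> c\<close> and
  \<open>\<eta>\<close> is moved by that element. The value of \<open>E\<close> at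
  \<open>(\<tau>, \<eta>)\<close> then cancels by the rules relating \<open>E\<close>,
  \<open>c\<close> and \<open>bf\<close>.\<close>

lemma Mov_right_annihilator:
  assumes "bip P" "noncrossing P y" "\<sigma> \<in> Mov (cox P S \<otimes> inv y)" "\<eta> \<in> Mov y"
  shows "eul P \<sigma> \<eta> = 0"
proof -
  let ?c = "cox P S" and ?z = "cox P S \<otimes> inv y"
  have y: "y \<in> carrier G" "rk ?z + rk y = card S" using assms(2) by (auto simp: noncrossing_def)
  have c: "?c \<in> carrier G" "?z \<in> carrier G" using assms(1) y by auto
  have root: "eul P \<tau> \<eta> = 0" if \<tau>: "\<tau> \<in> roots \<inter> Mov ?z" for \<tau>
  proof -
    let ?t = "rt \<tau>"
    have r: "\<tau> \<in> roots" "\<tau> \<in> Mov ?z" "?t \<in> carrier G" using \<tau> by auto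
    have lt: "rk (?t \<otimes> ?z) < rk ?z" using Mov_rt_mult(2)[OF c(2) r(1,2)] .
    have e: "(?t \<otimes> ?c) \<otimes> inv y = ?t \<otimes> ?z" using r c y by (simp add: m_assoc)
    have e2: "?t \<otimes> ?c = (?t \<otimes> ?z) \<otimes> y" using r c y by (simp add: m_assoc)
    have "rk (?t \<otimes> ?c) \<le> rk (?t \<otimes> ?z) + rk y" using e2 rk_mult r c y by simp
    moreover have "card S \<le> 1 + rk (?t \<otimes> ?c)"
      using rk_mult_ge[OF r(3) c(1)] rk_cox[OF assms(1), of S] rk_rt[OF r(1)] by simp
    ultimately have "rk ((?t \<otimes> ?c) \<otimes> inv y) + rk y = rk (?t \<otimes> ?c)" using lt y(2) e by simp
    then have "Mov y \<subseteq> Mov (?t \<otimes> ?c)" using abs_le_Mov(1)[OF y(1)] r c by simp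
    then obtain u where u: "u \<in> V S" "\<eta> = act (?t \<otimes> ?c) u - u" using assms(4) by (auto simp: Mov_def)
    define w where "w = act ?c u"
    have wV: "w \<in> V S" using u(1) c(1) by (simp add: w_def act_V)
    have "\<eta> = w - (2 * bf w \<tau>) *\<^sub>R \<tau> - u" using u(2) r c by (simp add: w_def refl_def)
    then have "eul P \<tau> \<eta> = eul P \<tau> w - (2 * bf w \<tau>) * eul P \<tau> \<tau> - eul P \<tau> u"
      by (simp add: eul_diff_right eul_scale_right assms(1))
    moreover have ee: "eul P \<tau> \<tau> = 1 / 2" using eul_self[OF assms(1) roots_V[OF r(1)]] r(1) by simp
    moreover have "eul P w \<tau> = - eul P \<tau> u" using eul_cox[OF assms(1), of u \<tau>] by (simp add: w_def)
    moreover have "eul P w \<tau> + eul P \<tau> w = bf w \<tau>" by (rule eul_sym_sum[OF assms(1) wV])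
    ultimately show ?thesis unfolding ee by simp
  qed
  have "subspace {x. eul P x \<eta> = 0}"
    by (simp add: real_vector.subspace_def eul_add_left eul_scale_left)
  then have "span (roots \<inter> Mov ?z) \<subseteq> {x. eul P x \<eta> = 0}"
    using root by (intro real_vector.span_minimal) auto
  then show ?thesis using Mov_subset_span_roots[OF c(2)] assms(3) by blast
qed

text \<open>On its own moved space a noncrossing \<open>y\<close> satisfies the identity that ties
  \<open>E\<close> to the Coxeter element. The right side does not mention \<open>y\<close>, which
  is why moved spaces can determine noncrossing elements.\<close>

lemma noncrossing_bf:
  assumes "bip P" "noncrossing P y" "\<eta> \<in> Mov y" "v \<in> V S"
  shows "eul P \<eta> (v - act (inv y) v) = bf \<eta> v"
proof -
  let ?c = "cox P S" and ?z = "cox P S \<otimes> inv y"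
  have y: "y \<in> carrier G" using assms(2) by (auto simp: noncrossing_def)
  have c: "?c \<in> carrier G" "?z \<in> carrier G" using assms(1) y by auto
  have \<eta>: "\<eta> \<in> V S" using Mov_V y assms(3) by blast
  have iy: "act (inv y) v = act (inv ?c) (act ?z v)" using c y by simp
  have m: "act ?z v - v \<in> Mov ?z" using MovI[OF assms(4)] .
  have "eul P (act ?z v - v) \<eta> = 0" by (rule Mov_right_annihilator[OF assms(1,2) m assms(3)])
  then have "eul P \<eta> (act ?z v - v) = bf \<eta> (act ?z v - v)"
    using eul_sym_sum[OF assms(1) \<eta>, of "act ?z v - v"] by simp
  moreover have "eul P \<eta> (act ?z v - act (inv ?c) (act ?z v)) = bf \<eta> (act ?z v)"
    by (rule bf_eul_inv_cox[OF assms(1) \<eta>])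
  ultimately show ?thesis unfolding iy
    by (simp only: eul_diff_right[OF assms(1)] bf_diff_right)
qed

lemma rk_eq_0:
  assumes "w \<in> carrier G" "rk w = 0"
  shows "w = \<one>"
proof (rule ccontr)
  assume "w \<noteq> \<one>"
  then obtain \<rho> where "\<rho> \<in> roots" "\<rho> \<in> Mov w" using root_in_Mov assms(1) by blast
  then show False using Mov_rt_mult(2)[OF assms(1)] assms(2) by force
qed

text \<open>A vector \<open>\<eta>\<close> moved by both \<open>inv y \<otimes> x\<close> and
  \<open>x\<close> is a difference of the two expressions in \<open>noncrossing_bf\<close> for
  \<open>x\<close> and \<open>y\<close> at the same \<open>v\<close>. Hence \<open>E\<close>
  vanishes at \<open>(\<eta>, \<eta>)\<close> and \<open>\<eta> = 0\<close>. The two moved spaces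
  are independent inside \<open>Mov y\<close>, so ranks add.\<close>

lemma noncrossing_le:
  assumes "bip P" "noncrossing P x" "noncrossing P y" "Mov x \<subseteq> Mov y"
  shows "rk (y \<otimes> inv x) + rk x = rk y"
proof -
  have xy: "x \<in> carrier G" "y \<in> carrier G" using assms(2,3) by (auto simp: noncrossing_def)
  let ?u = "inv y \<otimes> x"
  have u: "?u \<in> carrier G" using xy by simp
  have "Mov ?u \<inter> Mov x \<subseteq> {0}"
  proof (rule subsetI)
    fix \<eta> assume "\<eta> \<in> Mov ?u \<inter> Mov x"
    then have \<eta>: "\<eta> \<in> Mov ?u" "\<eta> \<in> Mov x" by auto
    then obtain f where f: "f \<in> V S" "\<eta> = act ?u f - f" by (auto simp: Mov_def)
    define v where "v = act x f"
    have v: "v \<in> V S" using f(1) xy by (simp add: v_def act_V)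
    have e: "\<eta> = (v - act (inv x) v) - (v - act (inv y) v)" using f(2) xy by (simp add: v_def)
    have "eul P \<eta> (v - act (inv x) v) = bf \<eta> v" by (rule noncrossing_bf[OF assms(1,2) \<eta>(2) v])
    moreover have "eul P \<eta> (v - act (inv y) v) = bf \<eta> v"
      by (rule noncrossing_bf[OF assms(1,3) _ v]) (use \<eta> assms(4) in blast)
    ultimately have "eul P \<eta> \<eta> = 0" by (subst (2) e) (simp only: eul_diff_right[OF assms(1)])
    moreover have "\<eta> \<in> V S" using \<eta> Mov_V xy by blast
    ultimately have "\<eta> = 0" using eul_self[OF assms(1)] bf_self_eq_0 by simp
    then show "\<eta> \<in> {0}" by simp
  qed
  moreover have "Mov ?u \<subseteq> Mov y"
    by (rule Mov_mult_subset) (use xy assms(4) Mov_subspace in auto)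
  ultimately have "rk ?u + rk x \<le> rk y" unfolding rk_def
    using assms(4) xy u by (intro dim_direct_le Mov_subspace fin_dim_Mov) auto
  moreover have "rk (y \<otimes> inv x) = rk ?u"
  proof -
    have "rk (y \<otimes> inv x) = rk (inv (y \<otimes> inv x))" using xy by simp
    also have "inv (y \<otimes> inv x) = x \<otimes> inv y" using xy by (simp add: inv_mult_group)
    finally show ?thesis using rk_mult_commute xy by simp
  qed
  moreover have "rk y \<le> rk (y \<otimes> inv x) + rk x"
    using rk_mult[of "y \<otimes> inv x" x] xy by (simp add: m_assoc)
  ultimately show ?thesis by simp
qed

lemma noncrossing_Mov_inj:
  assumes "bip P" "noncrossing P x" "noncrossing P y" "Mov x = Mov y"
  shows "x = y"
proof -
  have xy: "x \<in> carrier G" "y \<in> carrier G" using assms(2,3) by (auto simp: noncrossing_def)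
  have "rk (y \<otimes> inv x) = 0" using noncrossing_le[OF assms(1-3)] assms(4) by (simp add: rk_def)
  then have "y \<otimes> inv x = \<one>" using rk_eq_0 xy by simp
  then show ?thesis using xy by (metis inv_closed inv_equality inv_inv)
qed

subsection \<open>Rotation\<close>

text \<open>
  Alternately applying the two halves of the Coxeter element to a nonzero vector of the positive
  cone eventually leaves the cone, since otherwise the sum over an orbit of the Coxeter element
  would be a nonzero fixed vector.
\<close>

lemma rotation_induct [consumes 6, case_names rotate]:
  assumes "bip P" "J \<subseteq> S" "Q \<in> {P, S - P}" "v \<in> V J" "nonneg v" "v \<noteq> 0"
    and step: "\<And>Q v. Q \<in> {P, S - P} \<Longrightarrow> bip Q \<Longrightarrow> v \<in> V J \<Longrightarrow> nonneg v \<Longrightarrow> v \<noteq> 0 \<Longrightarrow>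
      (nonneg (pra (J \<inter> Q) v) \<Longrightarrow> Goal (S - Q) (pra (J \<inter> Q) v)) \<Longrightarrow> Goal Q v"
  shows "Goal Q v"
proof (rule ccontr)
  assume notGoal: "\<not> Goal Q v"
  define Bad where "Bad Q v \<longleftrightarrow> Q \<in> {P, S - P} \<and> v \<in> V J \<and> nonneg v \<and> v \<noteq> 0 \<and> \<not> Goal Q v" for Q v
  have bipQ: "bip Q" if "Q \<in> {P, S - P}" for Q using that assms(1) bip_compl by blast
  have Bad_step: "Bad (S - Q) (pra (J \<inter> Q) v)" if "Bad Q v" for Q v
  proof -
    have Q: "Q \<in> {P, S - P}" "v \<in> V J" "nonneg v" "v \<noteq> 0" "\<not> Goal Q v" using that by (auto simp: Bad_def)
    have o: "orth (J \<inter> Q)" using bip_orth[OF bipQ[OF Q(1)] assms(2)] by blast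
    have "nonneg (pra (J \<inter> Q) v) \<and> \<not> Goal (S - Q) (pra (J \<inter> Q) v)"
      using step[OF Q(1) bipQ[OF Q(1)] Q(2-4)] Q(5) by blast
    moreover have "pra (J \<inter> Q) v \<noteq> 0" using Q(4) pra_pra[OF o, of v] pra_zero[OF o] by force
    moreover have "pra (J \<inter> Q) v \<in> V J" using pra_V[OF o _ Q(2)] by blast
    moreover have "S - Q \<in> {P, S - P}" using Q(1) bipD(1)[OF assms(1)] by (auto simp: double_diff)
    ultimately show ?thesis by (simp add: Bad_def)
  qed
  have bad0: "Bad Q v" using assms notGoal by (simp add: Bad_def)
  have bQ: "bip Q" "Q \<subseteq> S" using bipQ assms(3) bipD by blast+
  let ?g = "inv (cox Q J)"
  have g: "?g \<in> carrier G" using bQ assms(2) by simp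
  have J: "J \<inter> (S - Q) = J - Q" "S - (S - Q) = Q" using assms(2) bQ by blast+
  have bad: "Bad Q (act (?g [^] k) v)" for k :: nat
  proof (induction k)
    case (Suc k)
    have "?g [^] Suc k = ?g \<otimes> ?g [^] k" using g by (rule nat_pow_Suc2)
    then have "act (?g [^] Suc k) v = pra (J - Q) (pra (J \<inter> Q) (act (?g [^] k) v))"
      using g act_inv_cox[OF bQ(1) assms(2)] by simp
    then show ?case using Bad_step[OF Bad_step[OF Suc]] unfolding J by simp
  qed (use bad0 in simp)
  define a where "a = (\<Sum>k<ord ?g. act (?g [^] k) v)"
  have vS: "v \<in> V S" using assms(2,4) V_mono by blast
  have aF: "a \<in> Fix ?g" unfolding a_def by (rule sum_pow_Fix[OF g vS])
  have "a \<in> V J" unfolding a_def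
    by (rule real_vector.subspace_sum[OF V_subspace]) (use bad in \<open>simp add: Bad_def\<close>)
  \<comment> \<open>The orbit sum is fixed and also moved, hence zero; its summands are nonnegative
    and so vanish one by one.\<close>
  then have "a \<in> Mov ?g" using Mov_cox[OF bQ(1) assms(2)] bQ assms(2) by simp
  then have "bf a a = 0" using Mov_orth_Fix[OF g _ aF] by blast
  moreover have "a \<in> V S" using aF by (simp add: Fix_def)
  ultimately have a0: "a = 0" using bf_self_eq_0 by blast
  have "v t = 0" for t
  proof -
    have "(\<Sum>k<ord ?g. act (?g [^] k) v t) = 0" using fun_cong[OF a0, of t] by (simp add: a_def fun_apply)
    moreover have "0 \<le> act (?g [^] k) v t" for k :: nat using bad[of k] by (simp add: Bad_def nonneg_def)
    moreover have "0 < ord ?g" using ord_pos[OF g] by simp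
    ultimately have "\<forall>k\<in>{..<ord ?g}. act (?g [^] k) v t = 0" "0 < ord ?g"
      by (simp_all add: sum_nonneg_eq_0_iff)
    then have "act (?g [^] (0::nat)) v t = 0" by blast
    then show ?thesis by simp
  qed
  then have "v = 0" by (simp add: fun_eq_iff fun_apply)
  then show False using assms by simp
qed

lemma not_nonneg_pra_root:
  assumes "orth A" "\<rho> \<in> pos_roots" "\<not> nonneg (pra A \<rho>)"
  shows "\<exists>s\<in>A. \<rho> = simple_root s"
  using pra_pos_root[OF assms(1,2)] assms(3) by (auto simp: pos_roots_def)

text \<open>Rotation carries roots to roots and the hyperplane of \<open>\<sigma>\<close> to that of
  the rotated root. Once \<open>\<sigma>\<close> is simple and about to turn negative, the
  hyperplane is a coordinate hyperplane and simple roots span it.\<close>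

lemma span_hyperplane_pos:
  assumes "bip P" "J \<subseteq> S" "\<sigma> \<in> pos_roots" "\<sigma> \<in> V J" "\<eta> \<in> V J" "eul P \<eta> \<sigma> = 0"
  shows "\<eta> \<in> span {\<rho> \<in> roots \<inter> V J. eul P \<rho> \<sigma> = 0}"
proof -
  \<comment> \<open>Being a root becomes a premise of the claim because
    \<open>rotation_induct\<close> ranges over all nonnegative vectors; \<open>\<eta>\<close> is
    quantified because it rotates as well.\<close>
  have "\<sigma> \<in> roots \<longrightarrow> (\<forall>\<eta>\<in>V J. eul P \<eta> \<sigma> = 0 \<longrightarrow> \<eta> \<in> span {\<rho> \<in> roots \<inter> V J. eul P \<rho> \<sigma> = 0})"
    using assms(1,2) insertI1 assms(4) pos_roots_nonneg[OF assms(3)] roots_ne_0[OF pos_roots_roots[OF assms(3)]]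
  proof (induction rule: rotation_induct)
    case (rotate Q v)
    show ?case
    proof (intro impI ballI)
      fix \<eta> assume v: "v \<in> roots" and \<eta>: "\<eta> \<in> V J" "eul Q \<eta> v = 0"
      have o: "orth (J \<inter> Q)" using bip_orth rotate(2) assms(2) by blast
      let ?p = "pra (J \<inter> Q)"
      let ?R = "{\<rho> \<in> roots \<inter> V J. eul Q \<rho> v = 0}"
      have pv: "v \<in> pos_roots" using v rotate(4) by (simp add: pos_roots_def)
      have p\<eta>: "?p \<eta> \<in> V J" using pra_V[OF o _ \<eta>(1)] by blast
      have e: "eul (S - Q) (?p f) (?p v) = eul Q f v" if "f \<in> V J" for f
        using eul_rotate[OF rotate(2) assms(2) that rotate(3)] .
      have *: "\<eta> \<in> span ?R" if "?p \<eta> \<in> span X" "\<And>x. x \<in> X \<Longrightarrow> ?p x \<in> ?R" for X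
      proof -
        have "?p (?p \<eta>) \<in> ?p ` span X" using that(1) by blast
        then have "?p (?p \<eta>) \<in> span (?p ` X)" using linear_span_image[OF pra_linear[OF o]] by metis
        moreover have "span (?p ` X) \<subseteq> span ?R" using that(2) by (intro real_vector.span_mono) auto
        ultimately show ?thesis using pra_pra[OF o] by auto
      qed
      show "\<eta> \<in> span ?R"
      proof (cases "nonneg (?p v)")
        case True
        have "?p \<eta> \<in> span {\<rho> \<in> roots \<inter> V J. eul (S - Q) \<rho> (?p v) = 0}"
          using rotate(6)[OF True] pra_roots[OF o v] p\<eta> e[OF \<eta>(1)] \<eta>(2) by simp
        then show ?thesis
        proof (rule *)
          fix x assume x: "x \<in> {\<rho> \<in> roots \<inter> V J. eul (S - Q) \<rho> (?p v) = 0}"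
          then have "?p x \<in> V J" using pra_V[OF o, of J x] by auto
          moreover have "eul Q (?p x) v = 0" using e[OF calculation] x pra_pra[OF o] by simp
          ultimately show "?p x \<in> ?R" using x pra_roots[OF o] by simp
        qed
      next
        case False
        then obtain s where s: "s \<in> J \<inter> Q" "v = simple_root s" using not_nonneg_pra_root[OF o pv] by blast
        \<comment> \<open>One more rotation makes \<open>v\<close> the negative of a simple root of
          the second half for \<open>S - Q\<close>, so \<open>E\<close> reads off the coordinate at
          \<open>s\<close> and the rotated hyperplane is \<open>V (J - {s})\<close>.\<close>
        have e': "eul Q f v = - ?p f s / 2" if "f \<in> V J" for f
        proof -
          have "eul (S - Q) (?p f) (simple_root s) = ?p f s / 2"
            using s bipD(1)[OF rotate(2)] by (intro eul_simple_right bip_compl rotate(2)) auto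
          then show ?thesis using e[OF that] pra_simple[OF o s(1)] s(2) bip_compl[OF rotate(2)] by simp
        qed
        have "?p \<eta> \<in> V (J - {s})" using p\<eta> e'[OF \<eta>(1)] \<eta>(2) by (auto simp: V_def)
        then have "?p \<eta> \<in> span (simple_root ` (J - {s}))"
          using V_subset_span[of "J - {s}"] finite_subset[OF assms(2) finite_S] by auto
        then show ?thesis
        proof (rule *)
          fix x assume "x \<in> simple_root ` (J - {s})"
          then obtain t where t: "t \<in> J" "t \<noteq> s" "x = simple_root t" by blast
          have "simple_root t \<in> V J" using t simple_root_V by blast
          then have V: "?p x \<in> V J" using pra_V[OF o, of J x] t by blast
          have "eul Q (?p x) v = 0" using e'[OF V] t pra_pra[OF o] by (simp add: simple_root_apply)
          then show "?p x \<in> ?R" using V pra_roots[OF o] t assms(2) by auto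
        qed
      qed
    qed
  qed
  then show ?thesis using assms pos_roots_roots by blast
qed

lemma span_hyperplane:
  assumes "bip P" "J \<subseteq> S" "\<sigma> \<in> roots" "\<sigma> \<in> V J" "\<eta> \<in> V J" "eul P \<eta> \<sigma> = 0"
  shows "\<eta> \<in> span {\<rho> \<in> roots \<inter> V J. eul P \<rho> \<sigma> = 0}"
proof (cases "\<sigma> \<in> pos_roots")
  case False
  then have "- \<sigma> \<in> pos_roots" using roots_cases assms by blast
  from span_hyperplane_pos[OF assms(1,2) this V_minus[OF assms(4)] assms(5)] show ?thesis
    using assms(1,6) by simp
qed (use span_hyperplane_pos assms in blast)

subsection \<open>Obtuse bases\<close>

lemma nonneg_scale: "nonneg f \<Longrightarrow> 0 \<le> r \<Longrightarrow> nonneg (r *\<^sub>R f)"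
  by (simp add: nonneg_def fun_apply)

lemma cone_hull_nonneg: "x \<in> cone_hull A \<Longrightarrow> (\<And>a. a \<in> A \<Longrightarrow> nonneg a) \<Longrightarrow> nonneg x"
  by (induction rule: cone_hull.induct) (auto simp: nonneg_def fun_apply)

text \<open>A generating set of the cone with the fewest elements is a simple system. If two members
  had a positive product, reflecting one in the other would, up to sign, give an element of the cone
  and make one of the two redundant.\<close>

lemma obtuse_base:
  assumes "finite \<Psi>" "\<Psi> \<subseteq> pos_roots"
    and closed: "\<And>a b. a \<in> \<Psi> \<Longrightarrow> b \<in> \<Psi> \<Longrightarrow> refl a b \<in> \<Psi> \<or> - refl a b \<in> \<Psi>"
  shows "\<exists>M\<subseteq>\<Psi>. \<Psi> \<subseteq> cone_hull M \<and> (\<forall>m\<in>M. \<forall>m'\<in>M. m \<noteq> m' \<longrightarrow> bf m m' \<le> 0)"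
proof -
  define X where "X = {M. M \<subseteq> \<Psi> \<and> \<Psi> \<subseteq> cone_hull M}"
  have "\<Psi> \<in> X" using cone_hull_base by (auto simp: X_def)
  then obtain M where M: "M \<in> X" "\<And>N. N \<in> X \<Longrightarrow> card M \<le> card N"
    using ex_has_least_nat[of "\<lambda>M. M \<in> X" \<Psi> card] by blast
  have MX: "M \<subseteq> \<Psi>" "\<Psi> \<subseteq> cone_hull M" using M(1) by (auto simp: X_def)
  have fM: "finite M" using MX(1) assms(1) finite_subset by blast
  have pos: "nonneg x" if "x \<in> cone_hull (M - A)" for x A
    by (rule cone_hull_nonneg[OF that]) (use MX assms(2) pos_roots_nonneg in blast)
  have min: "m \<notin> cone_hull (M - {m})" if m: "m \<in> M" for m
  proof
    assume a: "m \<in> cone_hull (M - {m})"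
    have sub: "M \<subseteq> cone_hull (M - {m})"
    proof (rule subsetI)
      fix x assume "x \<in> M"
      then show "x \<in> cone_hull (M - {m})" using a cone_hull_base[of x "M - {m}"] by (cases "x = m") auto
    qed
    have "\<Psi> \<subseteq> cone_hull (M - {m})" using MX(2) cone_hull_minimal[OF _ sub] by (meson subset_iff)
    then have "M - {m} \<in> X" using MX(1) by (auto simp: X_def)
    from M(2)[OF this] card_Diff1_less[OF fM m] show False by linarith
  qed
  \<comment> \<open>Collect the multiple \<open>a\<close> of \<open>m'\<close> hidden in
    \<open>x'\<close>. For \<open>a < 1\<close> the vector \<open>m'\<close> is generated by the
    others, against minimality; otherwise \<open>- m\<close> would be nonnegative.\<close>
  have ext: False if m: "m \<in> M" "m' \<in> M" "m \<noteq> m'" "0 < k" and r: "m' = k *\<^sub>R m + x'" "x' \<in> cone_hull M"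
    for m m' k x'
  proof -
    obtain a z where az: "0 \<le> a" "z \<in> cone_hull (M - {m'})" "x' = a *\<^sub>R m' + z"
      using cone_hull_split[OF r(2) m(2)] by blast
    have e: "(1 - a) *\<^sub>R m' = k *\<^sub>R m + z" using r(1) az(3) by (simp add: scaleR_diff_left algebra_simps)
    have c: "k *\<^sub>R m + z \<in> cone_hull (M - {m'})"
      using m az by (intro cone_hull_add cone_hull_scale) (auto intro: cone_hull_base)
    show False
    proof (cases "a < 1")
      case True
      have "m' = (1 / (1 - a)) *\<^sub>R (1 - a) *\<^sub>R m'" using True by simp
      also have "\<dots> \<in> cone_hull (M - {m'})" unfolding e using c True by (intro cone_hull_scale) auto
      finally show False using min m(2) by blast
    next
      case False
      have e': "- m = (1 / k) *\<^sub>R ((a - 1) *\<^sub>R m' + 1 *\<^sub>R z)"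
      proof -
        have "(a - 1) *\<^sub>R m' + z = - (k *\<^sub>R m)" using e by (simp add: scaleR_diff_left algebra_simps)
        then show ?thesis using m(4) by simp
      qed
      have "nonneg m'" "nonneg z" using pos[OF az(2)] MX m assms(2) pos_roots_nonneg by auto
      then have "nonneg (- m)" unfolding e' using False m(4)
        by (intro nonneg_scale nonneg_combination) auto
      then show False using root_not_both[of m] MX m(1) assms(2) by (auto simp: pos_roots_def)
    qed
  qed
  show ?thesis
  proof (intro exI[of _ M] conjI MX ballI impI)
    fix m m' assume mm: "m \<in> M" "m' \<in> M" "m \<noteq> m'"
    show "bf m m' \<le> 0"
    proof (rule ccontr)
      assume "\<not> bf m m' \<le> 0"
      then have k: "0 < 2 * bf m m'" by simp
      have r: "refl m m' = m' - (2 * bf m m') *\<^sub>R m" by (simp add: refl_def bf_sym)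
      consider "refl m m' \<in> cone_hull M" | "- refl m m' \<in> cone_hull M"
        using closed[of m m'] MX mm by blast
      then show False
      proof cases
        case 1
        have "m' = (2 * bf m m') *\<^sub>R m + refl m m'" by (simp add: r)
        then show False using ext[OF mm k] 1 by blast
      next
        case 2
        have "m = (1 / (2 * bf m m')) *\<^sub>R m' + (1 / (2 * bf m m')) *\<^sub>R (- refl m m')"
          using k by (simp add: r scaleR_diff_right)
        moreover have "(1 / (2 * bf m m')) *\<^sub>R (- refl m m') \<in> cone_hull M" using 2 k by (intro cone_hull_scale) auto
        moreover have "0 < 1 / (2 * bf m m')" using k by simp
        ultimately show False using ext[OF mm(2,1) mm(3)[symmetric]] by blast
      qed
    qed
  qed
qed

text \<open>Separate a representation into its positive part \<open>xp\<close> and the negated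
  negative part \<open>xn\<close>. Then \<open>bf x xn\<close> is nonnegative while
  \<open>bf xp xn\<close> is nonpositive, so the norm of \<open>xn\<close> is zero.\<close>

lemma obtuse_dual_cone:
  assumes "finite M" "M \<subseteq> V S" "x \<in> span M" "\<And>m. m \<in> M \<Longrightarrow> 0 \<le> bf x m"
    and obtuse: "\<And>m m'. m \<in> M \<Longrightarrow> m' \<in> M \<Longrightarrow> m \<noteq> m' \<Longrightarrow> bf m m' \<le> 0"
  shows "x \<in> cone_hull M"
proof -
  obtain u where u: "x = (\<Sum>m\<in>M. u m *\<^sub>R m)" using assms(1,3) real_vector.span_finite[OF assms(1)] by auto
  define xp where "xp = (\<Sum>m\<in>{m\<in>M. 0 \<le> u m}. u m *\<^sub>R m)"
  define xn where "xn = (\<Sum>m\<in>{m\<in>M. u m < 0}. (- u m) *\<^sub>R m)"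
  have "M = {m\<in>M. 0 \<le> u m} \<union> {m\<in>M. u m < 0}" by auto
  then have "x = (\<Sum>m\<in>{m\<in>M. 0 \<le> u m} \<union> {m\<in>M. u m < 0}. u m *\<^sub>R m)" using u by simp
  also have "\<dots> = xp - xn" unfolding xp_def xn_def
    by (subst sum.union_disjoint) (use assms(1) in \<open>auto simp: sum_negf\<close>)
  finally have x: "x = xp - xn" .
  have "0 \<le> bf x xn" unfolding xn_def bf_sum_right
    by (rule sum_nonneg) (use assms(4) in \<open>auto simp: mult_nonpos_nonneg\<close>)
  moreover have "bf xp xn \<le> 0" unfolding xp_def xn_def bf_sum_right bf_sum_left
  proof (intro sum_nonpos)
    fix i j assume ij: "i \<in> {m\<in>M. u m < 0}" "j \<in> {m\<in>M. 0 \<le> u m}"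
    then have "j \<noteq> i" by auto
    then have "bf j i \<le> 0" using obtuse[of j i] ij by auto
    then show "bf (u j *\<^sub>R j) (- u i *\<^sub>R i) \<le> 0" using ij
      by (simp add: mult_nonneg_nonpos mult_nonpos_nonpos zero_le_mult_iff)
  qed
  ultimately have "bf xn xn \<le> 0" unfolding x by simp
  moreover have "xn \<in> V S" unfolding xn_def
    by (rule real_vector.subspace_sum[OF V_subspace]) (use assms(2) V_scale in blast)
  ultimately have "xn = 0" using bf_pos by fastforce
  then have "x = xp" using x by simp
  also have "xp \<in> cone_hull M" unfolding xp_def
    by (intro cone_hull_sum cone_hull_scale cone_hull_base) auto
  finally show ?thesis .
qed

text \<open>
  In a noncrossing root subsystem that contains simple roots from the first half of the
  bipartition, the remaining simple roots of the subsystem avoid these in their support.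
\<close>

lemma hyperplane_cone_split:
  assumes "bip P" "J \<subseteq> S" "K \<subseteq> J \<inter> P" "\<sigma> \<in> roots" "\<sigma> \<in> V (J - K)"
    and "\<eta> \<in> pos_roots" "\<eta> \<in> V J" "eul P \<eta> \<sigma> = 0"
  shows "\<eta> \<in> cone_hull (simple_root ` K \<union> {\<rho> \<in> pos_roots \<inter> V (J - K). eul P \<rho> \<sigma> = 0})"
proof -
  let ?\<Psi> = "{\<rho> \<in> pos_roots \<inter> V (J - K). eul P \<rho> \<sigma> = 0}"
  have fin: "finite ?\<Psi>" using finite_pos_roots by simp
  have KS: "K \<subseteq> S" "K \<subseteq> P" "orth K"
    using assms(1-3) orth_subset[OF bipD(2)[OF assms(1)], of K] by auto
  have fK: "finite K" using KS(1) finite_S finite_subset by blast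
  have JK: "J - K \<subseteq> S" using assms(2) by blast
  have closed: "refl a b \<in> ?\<Psi> \<or> - refl a b \<in> ?\<Psi>" if ab: "a \<in> ?\<Psi>" "b \<in> ?\<Psi>" for a b
  proof -
    have r: "refl a b \<in> roots" using reflection_root ab pos_roots_roots by blast
    have v: "refl a b \<in> V (J - K)" using refl_V ab by blast
    have e: "eul P (refl a b) \<sigma> = 0" using ab by (simp add: refl_def eul_diff_left eul_scale_left)
    show ?thesis using roots_cases[OF r] v V_minus[OF v] e by auto
  qed
  obtain M1 where M1: "M1 \<subseteq> ?\<Psi>" "?\<Psi> \<subseteq> cone_hull M1" "\<And>m m'. m \<in> M1 \<Longrightarrow> m' \<in> M1 \<Longrightarrow> m \<noteq> m' \<Longrightarrow> bf m m' \<le> 0"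
    using obtuse_base[OF fin _ closed] by blast
  \<comment> \<open>The candidate for the simple roots of the subsystem in \<open>V J\<close>
    annihilated by \<open>\<sigma>\<close>. The simple roots of \<open>K\<close> belong to it since
    \<open>\<sigma>\<close> vanishes on \<open>K\<close> and \<open>K\<close> lies in the first
    half.\<close>
  define M where "M = simple_root ` K \<union> M1"
  have fM: "finite M" using fK finite_subset[OF M1(1) fin] by (simp add: M_def)
  have Mpos: "m \<in> pos_roots" if "m \<in> M" for m using that M1(1) KS(1) by (auto simp: M_def)
  have MVJ: "m \<in> V J" if "m \<in> M" for m
    using that M1(1) assms(3) V_mono[of "J - K" J] simple_root_V[of _ J] by (auto simp: M_def)
  have MVS: "M \<subseteq> V S" using MVJ V_mono[OF assms(2)] by blast
  have s0: "\<sigma> s = 0" if "s \<in> K" for s using that assms(5) by (auto simp: V_def)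
  have Meul: "eul P m \<sigma> = 0" if "m \<in> M" for m
  proof (cases "m \<in> M1")
    case False
    then obtain s where "s \<in> K" "m = simple_root s" using \<open>m \<in> M\<close> by (auto simp: M_def)
    then show ?thesis using eul_simple[OF assms(1), of s \<sigma>] KS(2) s0 by auto
  qed (use M1(1) in auto)
  have mixed: "bf m (simple_root s) \<le> 0" if "s \<in> K" "m \<in> M1" for s m
  proof -
    have "s \<in> S" using that KS(1) by blast
    have m: "m \<in> pos_roots" "m s = 0" using that M1(1) by (auto simp: V_def)
    have "bf m (simple_root s) = (\<Sum>t\<in>S. m t * bm t s)" using bf_simple_right \<open>s \<in> S\<close> by blast
    also have "\<dots> \<le> 0"
    proof (rule sum_nonpos)
      fix t assume "t \<in> S"
      show "m t * bm t s \<le> 0"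
        using bm_nonpos[OF \<open>t \<in> S\<close> \<open>s \<in> S\<close>] m pos_roots_nonneg[OF m(1)]
        by (cases "t = s") (auto simp: nonneg_def mult_nonneg_nonpos)
    qed
    finally show ?thesis .
  qed
  have obtuse: "bf m m' \<le> 0" if mm: "m \<in> M" "m' \<in> M" "m \<noteq> m'" for m m'
  proof -
    consider "m \<in> M1" "m' \<in> M1" | s where "s \<in> K" "m = simple_root s" "m' \<in> M1"
      | s where "s \<in> K" "m' = simple_root s" "m \<in> M1"
      | s t where "s \<in> K" "t \<in> K" "m = simple_root s" "m' = simple_root t"
      using mm(1,2) unfolding M_def by auto
    then show ?thesis
    proof cases
      case (2 s)
      then show ?thesis using mixed[of s m'] bf_sym[of m m'] by simp
    next
      case (4 s t)
      then show ?thesis using KS mm(3) by (auto simp: orth_def subset_iff)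
    qed (use M1(3) mm(3) mixed in auto)
  qed
  have spanM: "\<eta> \<in> span M" if \<eta>: "\<eta> \<in> V J" "eul P \<eta> \<sigma> = 0" for \<eta>
  proof -
    define \<kappa> where "\<kappa> = \<eta> - (\<Sum>s\<in>K. \<eta> s *\<^sub>R simple_root s)"
    have sK: "(\<Sum>s\<in>K. \<eta> s *\<^sub>R simple_root s) t = (if t \<in> K then \<eta> t else 0)" for t
    proof -
      have "(\<Sum>s\<in>K. \<eta> s *\<^sub>R simple_root s) t = (\<Sum>s\<in>K. if s = t then \<eta> t else 0)"
        unfolding fun_apply by (intro sum.cong) (auto simp: simple_root_apply)
      then show ?thesis using fK by simp
    qed
    have "\<kappa> t = (if t \<in> K then 0 else \<eta> t)" for t
      unfolding \<kappa>_def minus_apply sK by simp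
    then have kV: "\<kappa> \<in> V (J - K)" using \<eta>(1) by (auto simp: V_def)
    have "eul P (\<Sum>s\<in>K. \<eta> s *\<^sub>R simple_root s) \<sigma> = (\<Sum>s\<in>K. \<eta> s * eul P (simple_root s) \<sigma>)"
      by (simp add: linear_sum[OF eul_linear_left] eul_scale_left)
    also have "\<dots> = 0" using Meul by (intro sum.neutral) (auto simp: M_def)
    finally have ke: "eul P \<kappa> \<sigma> = 0" using \<eta>(2) by (simp add: \<kappa>_def eul_diff_left)
    have "\<kappa> \<in> span {\<rho> \<in> roots \<inter> V (J - K). eul P \<rho> \<sigma> = 0}"
      by (rule span_hyperplane[OF assms(1) JK assms(4,5) kV ke])
    also have "\<dots> \<subseteq> span M"
    proof (rule real_vector.span_minimal[OF subsetI real_vector.subspace_span])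
      fix \<rho> assume \<rho>: "\<rho> \<in> {\<rho> \<in> roots \<inter> V (J - K). eul P \<rho> \<sigma> = 0}"
      have "\<rho> \<in> ?\<Psi> \<or> - \<rho> \<in> ?\<Psi>" using roots_cases[of \<rho>] \<rho> V_minus by auto
      then have "\<rho> \<in> cone_hull M1 \<or> - \<rho> \<in> cone_hull M1" using M1(2) by blast
      then have "\<rho> \<in> span M1 \<or> - \<rho> \<in> span M1" using cone_hull_subset_span by blast
      then have "\<rho> \<in> span M1" using real_vector.span_neg[of "- \<rho>" M1] by auto
      then show "\<rho> \<in> span M" using real_vector.span_mono[of M1 M] by (auto simp: M_def)
    qed
    finally have "\<kappa> \<in> span M" .
    moreover have "(\<Sum>s\<in>K. \<eta> s *\<^sub>R simple_root s) \<in> span M"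
      by (intro real_vector.span_sum real_vector.span_scale real_vector.span_base) (auto simp: M_def)
    ultimately have "\<kappa> + (\<Sum>s\<in>K. \<eta> s *\<^sub>R simple_root s) \<in> span M" by (rule real_vector.span_add)
    then show ?thesis by (simp add: \<kappa>_def)
  qed
  define h where "h f = (\<Sum>s\<in>S. f s)" for f :: "'a \<Rightarrow> real"
  have hpos: "0 < h m" if "m \<in> pos_roots" for m
  proof -
    have m: "m \<in> V S" "m \<noteq> 0" "nonneg m" using that roots_V roots_ne_0 by (auto simp: pos_roots_def)
    then obtain t where "m t \<noteq> 0" by (auto simp: fun_eq_iff fun_apply)
    then show ?thesis unfolding h_def using m
      by (intro sum_pos2[of S t]) (auto simp: nonneg_def V_def less_le)
  qed
  \<comment> \<open>Descent on the height \<open>h\<close>, measured by the number of lower positive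
    roots: reflecting in an \<open>m\<close> of \<open>M\<close> with positive product subtracts a
    positive multiple of \<open>m\<close>.\<close>
  have "\<eta> \<in> cone_hull M" if "\<eta> \<in> pos_roots" "\<eta> \<in> V J" "eul P \<eta> \<sigma> = 0" for \<eta>
    using that
  proof (induction "card {\<rho> \<in> pos_roots. h \<rho> < h \<eta>}" arbitrary: \<eta> rule: less_induct)
    case (less \<eta>)
    have nn: "nonneg \<eta>" using less.prems pos_roots_nonneg by blast
    show ?case
    proof (cases "\<exists>s\<in>K. \<eta> s \<noteq> 0")
      case False
      then have "\<eta> \<in> ?\<Psi>" using less.prems by (auto simp: V_def)
      then show ?thesis using M1(2) cone_hull_mono[of M1 M] by (auto simp: M_def)
    next
      case True
      then obtain s where s: "s \<in> K" "0 < \<eta> s" using nn by (auto simp: nonneg_def less_le)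
      show ?thesis
      proof (cases "\<exists>m\<in>M. 0 < bf \<eta> m")
        case False
        \<comment> \<open>Without such an \<open>m\<close>, the obtuse set \<open>M\<close> would
          generate \<open>- \<eta>\<close> with nonnegative coefficients.\<close>
        have "bf (- \<eta>) m \<ge> 0" if "m \<in> M" for m using False that by (auto simp: not_less)
        moreover have "- \<eta> \<in> span M" using spanM less.prems real_vector.span_neg by blast
        ultimately have "- \<eta> \<in> cone_hull M" using obtuse_dual_cone[OF fM MVS] obtuse by blast
        then have "nonneg (- \<eta>)" using cone_hull_nonneg Mpos pos_roots_nonneg by blast
        then show ?thesis using root_not_both less.prems nn pos_roots_roots by blast
      next
        case True
        then obtain m where m: "m \<in> M" "0 < bf \<eta> m" by blast
        show ?thesis
        proof (cases "\<eta> \<in> M")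
          case True
          then show ?thesis by (rule cone_hull_base)
        next
          case False
          define \<eta>' where "\<eta>' = refl m \<eta>"
          have e: "\<eta> = \<eta>' + (2 * bf \<eta> m) *\<^sub>R m" by (simp add: \<eta>'_def refl_def)
          have r': "\<eta>' \<in> roots" unfolding \<eta>'_def using reflection_root m(1) Mpos less.prems pos_roots_roots by blast
          \<comment> \<open>Members of \<open>M1\<close> vanish at \<open>s\<close>, so reflecting
            in them preserves the positive coordinate there; a simple reflection makes only its own
            root negative.\<close>
          have pos': "\<eta>' \<in> pos_roots"
          proof (cases "m \<in> M1")
            case True
            then have "m s = 0" using M1(1) s(1) by (auto simp: V_def)
            then have "0 < \<eta>' s" using s(2) by (simp add: \<eta>'_def refl_def fun_apply)
            then show ?thesis using root_positive_of_coord r' by blast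
          next
            case False
            then obtain t where "t \<in> K" "m = simple_root t" using m(1) by (auto simp: M_def)
            then show ?thesis unfolding \<eta>'_def using refl_pos_root less.prems KS(1) \<open>\<eta> \<notin> M\<close> m(1) by blast
          qed
          have V': "\<eta>' \<in> V J" unfolding \<eta>'_def using refl_V MVJ m(1) less.prems by blast
          have e': "eul P \<eta>' \<sigma> = 0" using Meul[OF m(1)] less.prems by (simp add: \<eta>'_def refl_def eul_diff_left eul_scale_left)
          have "h \<eta> = h \<eta>' + 2 * bf \<eta> m * h m"
            by (subst e) (simp add: h_def plus_fun_apply scaleR_fun_apply sum.distrib sum_distrib_left)
          then have lt: "h \<eta>' < h \<eta>" using m hpos[OF Mpos[OF m(1)]] by simp
          have "{\<rho> \<in> pos_roots. h \<rho> < h \<eta>'} \<subset> {\<rho> \<in> pos_roots. h \<rho> < h \<eta>}"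
            using lt pos' by (auto intro!: psubsetI)
          then have "card {\<rho> \<in> pos_roots. h \<rho> < h \<eta>'} < card {\<rho> \<in> pos_roots. h \<rho> < h \<eta>}"
            using finite_pos_roots by (intro psubset_card_mono) auto
          then have "\<eta>' \<in> cone_hull M" using less.hyps pos' V' e' by blast
          then have "\<eta>' + (2 * bf \<eta> m) *\<^sub>R m \<in> cone_hull M" using m by (intro cone_hull.add) auto
          then show ?thesis using e by simp
        qed
      qed
    qed
  qed
  then have "\<eta> \<in> cone_hull M" using assms(6-8) by blast
  then show ?thesis using cone_hull_mono[of M "simple_root ` K \<union> ?\<Psi>"] M1(1) unfolding M_def by blast
qed

subsection \<open>Inversions\<close>

text \<open>Weights allow inversions of the small system, each accounting for several roots of the
  big one, to be compared with inversions there.\<close>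

definition inv_wt :: "(('a \<Rightarrow> real) \<Rightarrow> nat) \<Rightarrow> 'a \<Rightarrow> nat" where
  "inv_wt f w = (\<Sum>\<rho> | \<rho> \<in> pos_roots \<and> act w \<rho> \<notin> pos_roots. f \<rho>)"

text \<open>\<open>pr A\<close> permutes the positive roots other than the simple roots of
  \<open>A\<close> and negates the latter, so only these contribute to the change. Terms stand on
  both sides to avoid subtraction of natural numbers.\<close>

lemma inv_wt_mult_pr:
  assumes "w \<in> carrier G" "orth A" and f: "\<And>\<rho> g. \<rho> \<in> roots \<Longrightarrow> g \<in> carrier G \<Longrightarrow> f (act g \<rho>) = f \<rho>"
  shows "inv_wt f (w \<otimes> pr A) + (\<Sum>s | s \<in> A \<and> act w (simple_root s) \<notin> pos_roots. f (simple_root s))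
       = inv_wt f w + (\<Sum>s | s \<in> A \<and> act w (simple_root s) \<in> pos_roots. f (simple_root s))"
proof -
  have AS: "A \<subseteq> S" "finite A" using assms(2) orth_S orth_finite by auto
  let ?R = "{\<rho> \<in> pos_roots. \<rho> \<notin> simple_root ` A}"
  have split: "inv_wt f u = (\<Sum>\<rho> | \<rho> \<in> ?R \<and> act u \<rho> \<notin> pos_roots. f \<rho>)
      + (\<Sum>s | s \<in> A \<and> act u (simple_root s) \<notin> pos_roots. f (simple_root s))" for u
  proof -
    have e: "{\<rho>. \<rho> \<in> pos_roots \<and> act u \<rho> \<notin> pos_roots} =
      {\<rho>. \<rho> \<in> ?R \<and> act u \<rho> \<notin> pos_roots} \<union> simple_root ` {s. s \<in> A \<and> act u (simple_root s) \<notin> pos_roots}"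
      using AS by auto
    have "inv_wt f u = (\<Sum>\<rho> | \<rho> \<in> ?R \<and> act u \<rho> \<notin> pos_roots. f \<rho>)
       + sum f (simple_root ` {s. s \<in> A \<and> act u (simple_root s) \<notin> pos_roots})"
      unfolding inv_wt_def e by (rule sum.union_disjoint) (use finite_pos_roots AS in auto)
    also have "sum f (simple_root ` {s. s \<in> A \<and> act u (simple_root s) \<notin> pos_roots})
      = (\<Sum>s | s \<in> A \<and> act u (simple_root s) \<notin> pos_roots. f (simple_root s))"
      by (subst sum.reindex) (auto simp: inj_on_def)
    finally show ?thesis .
  qed
  have c: "pr A \<in> carrier G" using assms(2) by simp
  have pR: "pra A \<rho> \<in> ?R" if "\<rho> \<in> ?R" for \<rho>
  proof -
    have "pra A \<rho> \<noteq> simple_root s" if "s \<in> A" for s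
    proof
      assume "pra A \<rho> = simple_root s"
      then have "\<rho> = - simple_root s" using pra_pra[OF assms(2), of \<rho>] pra_simple[OF assms(2) that] by simp
      then have "- simple_root s \<in> pos_roots" using \<open>\<rho> \<in> ?R\<close> by simp
      then show False using pos_root_uminus[of "simple_root s"] that AS by auto
    qed
    then show ?thesis using pra_pos_root[OF assms(2), of \<rho>] that by auto
  qed
  have fp: "f (pra A \<rho>) = f \<rho>" if "\<rho> \<in> ?R" for \<rho>
    using f[of \<rho> "pr A"] that assms(2) pos_roots_roots by auto
  have rest: "(\<Sum>\<rho> | \<rho> \<in> ?R \<and> act (w \<otimes> pr A) \<rho> \<notin> pos_roots. f \<rho>) = (\<Sum>\<rho> | \<rho> \<in> ?R \<and> act w \<rho> \<notin> pos_roots. f \<rho>)"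
    by (rule sum.reindex_bij_witness[of _ "pra A" "pra A"])
       (use pR fp pra_pra[OF assms(2)] assms(1,2) in auto)
  have simp: "act (w \<otimes> pr A) (simple_root s) \<notin> pos_roots \<longleftrightarrow> act w (simple_root s) \<in> pos_roots" if s: "s \<in> A" for s
  proof -
    have r: "act w (simple_root s) \<in> roots" using s AS assms(1) by auto
    have "act (w \<otimes> pr A) (simple_root s) = - act w (simple_root s)"
      using assms(1,2) pra_simple[OF assms(2) s] by simp
    then show ?thesis using roots_cases[OF r] pos_root_uminus[of "act w (simple_root s)"] by auto
  qed
  have "(\<Sum>s | s \<in> A \<and> act (w \<otimes> pr A) (simple_root s) \<notin> pos_roots. f (simple_root s))
      = (\<Sum>s | s \<in> A \<and> act w (simple_root s) \<in> pos_roots. f (simple_root s))"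
    by (rule sum.cong) (use simp in auto)
  then show ?thesis using split[of "w \<otimes> pr A"] split[of w] rest by simp
qed

lemma inv_wt_one [simp]: "inv_wt f \<one> = 0"
  by (simp add: inv_wt_def)

lemma nonneg_sum: "(\<And>i. i \<in> I \<Longrightarrow> nonneg (f i)) \<Longrightarrow> nonneg (\<Sum>i\<in>I. f i)"
  by (simp add: nonneg_def fun_apply sum_nonneg)

lemma act_nonpos_extend:
  assumes "w \<in> carrier G" "\<And>s. s \<in> S \<Longrightarrow> act w (simple_root s) \<notin> pos_roots" "\<rho> \<in> pos_roots"
  shows "act w \<rho> \<notin> pos_roots"
proof
  assume p: "act w \<rho> \<in> pos_roots"
  have r: "\<rho> \<in> V S" "nonneg \<rho>" using assms(3) roots_V by (auto simp: pos_roots_def)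
  have "\<rho> = (\<Sum>s\<in>S. \<rho> s *\<^sub>R simple_root s)" using V_expand r(1) by blast
  then have "act w \<rho> = (\<Sum>s\<in>S. \<rho> s *\<^sub>R act w (simple_root s))"
    using assms(1) act_sum[OF assms(1), of "\<lambda>s. \<rho> s *\<^sub>R simple_root s" S] by simp
  then have e: "- act w \<rho> = (\<Sum>s\<in>S. \<rho> s *\<^sub>R (- act w (simple_root s)))"
    by (simp add: sum_negf)
  have "nonneg (- act w (simple_root s))" if "s \<in> S" for s
    using assms(1,2) that roots_cases[of "act w (simple_root s)"] pos_roots_nonneg by auto
  then have "nonneg (- act w \<rho>)" unfolding e using r(2)
    by (intro nonneg_sum nonneg_scale) (auto simp: nonneg_def)
  then show False using p root_not_both by (auto simp: pos_roots_def)
qed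

text \<open>A descent of \<open>inv w \<otimes> u\<close> would give a positive root that
  \<open>w\<close> sends to a positive root, although \<open>w\<close> makes all positive roots
  negative.\<close>

lemma longest_unique:
  assumes "u \<in> carrier G" "w \<in> carrier G"
    and "\<And>s. s \<in> S \<Longrightarrow> act u (simple_root s) \<notin> pos_roots" "\<And>s. s \<in> S \<Longrightarrow> act w (simple_root s) \<notin> pos_roots"
  shows "u = w"
proof -
  have "inv w \<otimes> u = \<one>"
  proof (rule ccontr)
    assume "inv w \<otimes> u \<noteq> \<one>"
    then obtain t where t: "t \<in> S" "len (inv w \<otimes> u \<otimes> t) < len (inv w \<otimes> u)"
      using descent_exists[of "inv w \<otimes> u"] assms by auto
    define \<tau> where "\<tau> = - act (inv w \<otimes> u) (simple_root t)"
    have "nonneg \<tau>" unfolding \<tau>_def by (rule len_greater_imp_nonpos) (use t assms in auto)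
    then have "\<tau> \<in> pos_roots" using t assms by (simp add: \<tau>_def pos_roots_def)
    then have "act w \<tau> \<notin> pos_roots" using act_nonpos_extend assms by blast
    moreover have "act w \<tau> = - act u (simple_root t)" using assms by (simp add: \<tau>_def)
    moreover have "- act u (simple_root t) \<in> pos_roots"
      using roots_cases[of "act u (simple_root t)"] assms t by auto
    ultimately show False by simp
  qed
  then show ?thesis using assms by (metis inv_closed inv_equality inv_inv)
qed

lemma inv_wt_le: "inv_wt f w \<le> (\<Sum>\<rho>\<in>pos_roots. f \<rho>)"
  unfolding inv_wt_def by (rule sum_mono2) (use finite_pos_roots in auto)

subsection \<open>The Perron vector\<close>

text \<open>\<open>bf p (simple_root s)\<close> is the coordinate at \<open>s\<close> of the Gram
  matrix applied to \<open>p\<close>, so the last clause says that \<open>p\<close> is an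
  eigenvector with eigenvalue \<open>\<kappa>\<close>.\<close>

definition perron :: "('a \<Rightarrow> real) \<Rightarrow> real \<Rightarrow> bool" where
  "perron p \<kappa> \<longleftrightarrow> p \<in> V S \<and> 0 < \<kappa> \<and> (\<forall>s\<in>S. 0 < p s) \<and> (\<forall>s\<in>S. bf p (simple_root s) = \<kappa> * p s)"

text \<open>First-order condition at a minimum; for \<open>a \<noteq> 0\<close> the test point
  \<open>- a / c\<close>, with \<open>c\<close> larger than \<open>b\<close>, makes the quadratic
  negative.\<close>

lemma linear_coeff_zero:
  assumes "\<And>t::real. 0 \<le> a * t + b * t\<^sup>2"
  shows "a = 0"
proof (rule ccontr)
  assume a: "a \<noteq> 0"
  define c where "c = \<bar>b\<bar> + 1"
  have c: "0 < c" "b < c" by (auto simp: c_def)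
  have "0 \<le> a * (- a / c) + b * (- a / c)\<^sup>2" by (rule assms)
  also have "\<dots> = (a\<^sup>2 / c) * (b / c - 1)" using c by (simp add: power2_eq_square field_simps)
  also have "\<dots> < 0" using a c by (intro mult_pos_neg) (auto simp: divide_less_eq)
  finally show False by simp
qed

lemma exists_minimizer:
  obtains p where "p \<in> V S" "(\<Sum>s\<in>S. (p s)\<^sup>2) = 1"
    "\<And>f. f \<in> V S \<Longrightarrow> (\<Sum>s\<in>S. (f s)\<^sup>2) = 1 \<Longrightarrow> bf p p \<le> bf f f"
proof -
  define K where "K = {f \<in> V S. (\<Sum>s\<in>S. (f s)\<^sup>2) = 1}"
  define Q where "Q f = bf f f" for f
  have Q0: "0 \<le> Q f" if "f \<in> K" for f using bf_pos[of f] that by (cases "f = 0") (auto simp: K_def Q_def)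
  obtain s0 where s0: "s0 \<in> S" using S_nonempty by blast
  have "(\<Sum>s\<in>S. (simple_root s0 s)\<^sup>2) = (\<Sum>s\<in>S. if s = s0 then 1 else 0)"
    by (intro sum.cong) (auto simp: simple_root_apply)
  then have ne: "simple_root s0 \<in> K" using s0 by (simp add: K_def simple_root_V)
  define m where "m = Inf (Q ` K)"
  have bdd: "bdd_below (Q ` K)" using Q0 by (intro bdd_belowI2[of _ 0]) auto
  have m: "m \<le> Q f" if "f \<in> K" for f unfolding m_def using bdd that by (auto intro: cInf_lower)
  have "\<exists>f\<in>K. Q f < m + 1 / real (Suc n)" for n
  proof -
    have "Inf (Q ` K) < m + 1 / real (Suc n)" by (simp add: m_def)
    then show ?thesis using cInf_less_iff[of "Q ` K"] bdd ne by auto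
  qed
  then obtain X where X: "\<And>n. X n \<in> K" "\<And>n. Q (X n) < m + 1 / real (Suc n)" by metis
  have b: "\<bar>X n s\<bar> \<le> 1" if "s \<in> S" for n s
  proof -
    have "(X n s)\<^sup>2 \<le> (\<Sum>s\<in>S. (X n s)\<^sup>2)" by (rule member_le_sum) (use that in auto)
    then have "(X n s)\<^sup>2 \<le> 1" using X(1)[of n] by (simp add: K_def)
    then show ?thesis by (simp add: abs_square_le_1)
  qed
  obtain r where r: "strict_mono r" "\<forall>s\<in>S. convergent (\<lambda>n. X (r n) s)"
    using convergent_subsequence_finite[OF finite_S, of X 1] b by blast
  define p where "p = (\<lambda>s. if s \<in> S then lim (\<lambda>n. X (r n) s) else 0)"
  have lim: "(\<lambda>n. X (r n) s) \<longlonglongrightarrow> p s" if "s \<in> S" for s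
    using r(2) that by (simp add: p_def convergent_LIMSEQ_iff)
  have pV: "p \<in> V S" by (simp add: V_def p_def)
  have "(\<lambda>n. \<Sum>s\<in>S. (X (r n) s)\<^sup>2) \<longlonglongrightarrow> (\<Sum>s\<in>S. (p s)\<^sup>2)"
    by (intro tendsto_sum tendsto_power lim)
  moreover have "(\<lambda>n. \<Sum>s\<in>S. (X (r n) s)\<^sup>2) = (\<lambda>n. 1)" using X(1) by (simp add: K_def)
  ultimately have p1: "(\<Sum>s\<in>S. (p s)\<^sup>2) = 1" using LIMSEQ_unique by (metis tendsto_const)
  have "(\<lambda>n. Q (X (r n))) \<longlonglongrightarrow> Q p" unfolding Q_def bf_def
    by (intro tendsto_sum tendsto_mult lim tendsto_const)
  moreover have "(\<lambda>n. m + 1 / real (Suc (r n))) \<longlonglongrightarrow> m + 0"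
    using LIMSEQ_subseq_LIMSEQ[OF LIMSEQ_Suc[OF lim_inverse_n'] r(1)]
    by (intro tendsto_add tendsto_const) (simp add: comp_def)
  ultimately have "Q p \<le> m + 0"
    by (rule LIMSEQ_le) (use X(2) less_imp_le in blast)
  then have "\<And>f. f \<in> K \<Longrightarrow> Q p \<le> Q f" using m by force
  then show ?thesis using that[OF pV p1] by (auto simp: K_def Q_def)
qed

text \<open>Off-diagonal entries of the form are nonpositive, so replacing the coordinates of a
  minimiser on the unit sphere by their absolute values gives another one. Being minimal, it is an
  eigenvector; a zero coordinate would spread over the connected Coxeter graph.\<close>

lemma exists_perron: "\<exists>p \<kappa>. perron p \<kappa>"
proof -
  obtain q where q: "q \<in> V S" "(\<Sum>s\<in>S. (q s)\<^sup>2) = 1"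
    "\<And>f. f \<in> V S \<Longrightarrow> (\<Sum>s\<in>S. (f s)\<^sup>2) = 1 \<Longrightarrow> bf q q \<le> bf f f"
    using exists_minimizer by blast
  define p where "p = (\<lambda>s. \<bar>q s\<bar>)"
  have pV: "p \<in> V S" using q(1) by (simp add: p_def V_def)
  have p1: "(\<Sum>s\<in>S. (p s)\<^sup>2) = 1" using q(2) by (simp add: p_def)
  have "bf p p \<le> bf q q" unfolding bf_def
  proof (intro sum_mono)
    fix s t assume st: "s \<in> S" "t \<in> S"
    show "p s * p t * bm s t \<le> q s * q t * bm s t"
    proof (cases "s = t")
      case False
      have "q s * q t \<le> p s * p t" unfolding p_def abs_mult[symmetric] by simp
      then show ?thesis using bm_nonpos[OF st False] by (rule mult_right_mono_neg)
    qed (use st in \<open>simp add: p_def\<close>)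
  qed
  define m where "m = bf p p"
  have min: "m * (\<Sum>s\<in>S. (f s)\<^sup>2) \<le> bf f f" if f: "f \<in> V S" for f
  proof (cases "f = 0")
    case False
    define n where "n = (\<Sum>s\<in>S. (f s)\<^sup>2)"
    obtain t where t: "f t \<noteq> 0" "t \<in> S" using False f by (auto simp: fun_eq_iff fun_apply V_def)
    have n: "0 < n" unfolding n_def by (rule sum_pos2[of S t]) (use t in auto)
    let ?g = "(1 / sqrt n) *\<^sub>R f"
    have "(\<Sum>s\<in>S. (?g s)\<^sup>2) = (\<Sum>s\<in>S. (f s)\<^sup>2) / n"
      using n by (simp add: fun_apply power_mult_distrib power_divide sum_divide_distrib)
    also have "\<dots> = 1" using n by (simp add: n_def[symmetric])
    finally have "bf q q \<le> bf ?g ?g" using q(3) V_scale[OF f] by blast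
    then have "m \<le> bf ?g ?g" using \<open>bf p p \<le> bf q q\<close> by (simp add: m_def)
    also have "\<dots> = bf f f / n" using n by (simp add: field_simps power2_eq_square[symmetric])
    finally show ?thesis using n by (simp add: n_def[symmetric] field_simps)
  qed (simp add: fun_apply)
  have eig: "bf p (simple_root s) = m * p s" if s: "s \<in> S" for s
  proof -
    have "0 \<le> (2 * (bf p (simple_root s) - m * p s)) * t + (1 - m) * t\<^sup>2" for t
    proof -
      have "p + t *\<^sub>R simple_root s \<in> V S" using pV s by (intro V_add V_scale simple_root_V)
      from min[OF this] have "m * (\<Sum>r\<in>S. ((p + t *\<^sub>R simple_root s) r)\<^sup>2) \<le> bf p p + 2 * t * bf p (simple_root s) + t\<^sup>2"
        using s by (simp add: bf_sym[of "simple_root s" p] power2_eq_square algebra_simps)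
      moreover have "(\<Sum>r\<in>S. ((p + t *\<^sub>R simple_root s) r)\<^sup>2) = 1 + 2 * t * p s + t\<^sup>2"
      proof -
        have "(\<Sum>r\<in>S. ((p + t *\<^sub>R simple_root s) r)\<^sup>2) = (\<Sum>r\<in>S. (p r)\<^sup>2 + (if r = s then 2 * t * p s + t\<^sup>2 else 0))"
          by (intro sum.cong) (auto simp: fun_apply simple_root_apply power2_eq_square algebra_simps)
        then show ?thesis using p1 s by (simp add: sum.distrib)
      qed
      ultimately show ?thesis by (simp add: m_def algebra_simps)
    qed
    then have "2 * (bf p (simple_root s) - m * p s) = 0" by (rule linear_coeff_zero)
    then show ?thesis by simp
  qed
  have m0: "0 < m" unfolding m_def
  proof (rule bf_pos[OF pV])
    show "p \<noteq> 0" using p1 by (auto simp: fun_apply)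
  qed
  have p0: "0 \<le> p s" for s by (simp add: p_def)
  \<comment> \<open>At a zero coordinate all terms of the eigenvalue equation have the same sign, so
    each of them vanishes.\<close>
  have nb: "p t = 0" if "p s = 0" "s \<in> S" "t \<in> S" "bm t s \<noteq> 0" for s t
  proof -
    have "(\<Sum>t\<in>S. - (p t * bm t s)) = 0"
      using eig[OF that(2)] that(1,2) by (simp add: bf_simple_right sum_negf)
    moreover have "0 \<le> - (p t * bm t s)" if "t \<in> S" for t
      using bm_nonpos[OF that \<open>s \<in> S\<close>] p0[of t] \<open>p s = 0\<close> by (cases "t = s") (auto simp: mult_nonneg_nonpos)
    ultimately have "- (p t * bm t s) = 0" using that(3) by (subst (asm) sum_nonneg_eq_0_iff) auto
    then show ?thesis using that(4) by simp
  qed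
  have "p s \<noteq> 0" if s: "s \<in> S" for s
  proof
    assume ps: "p s = 0"
    have "p t = 0" if "t \<in> S" for t
      using graph_connected[OF s that]
    proof induction
      case (step y z)
      then have "y \<in> S" "z \<in> S" "y \<noteq> z" "ord (y \<otimes> z) \<noteq> 2" by (auto simp: coxeter_graph_def)
      then show ?case using nb[OF step.IH, of z] bm_eq_0_iff bm_sym by simp
    qed (rule ps)
    then show False using p1 by simp
  qed
  then have "\<forall>s\<in>S. 0 < p s" using p0 by (simp add: less_le)
  then show ?thesis using pV m0 eig unfolding perron_def by blast
qed

lemma perron_root_sign:
  assumes "perron p \<kappa>" "\<rho> \<in> roots"
  shows "\<rho> \<in> pos_roots \<longleftrightarrow> 0 < bf p \<rho>"
proof -
  have p: "0 < \<kappa>" "\<And>s. s \<in> S \<Longrightarrow> 0 < p s" "\<And>s. s \<in> S \<Longrightarrow> bf p (simple_root s) = \<kappa> * p s"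
    using assms(1) by (auto simp: perron_def)
  have pos: "0 < bf p \<sigma>" if \<sigma>: "\<sigma> \<in> pos_roots" for \<sigma>
  proof -
    have s: "\<sigma> \<in> V S" "\<sigma> \<noteq> 0" "nonneg \<sigma>" using \<sigma> roots_V roots_ne_0 by (auto simp: pos_roots_def)
    then obtain t where t: "\<sigma> t \<noteq> 0" "t \<in> S" by (auto simp: fun_eq_iff fun_apply V_def)
    have "0 < (\<Sum>s\<in>S. \<sigma> s * bf p (simple_root s))"
      by (rule sum_pos2[of S t]) (use t s(3) p in \<open>auto simp: nonneg_def less_le\<close>)
    then show ?thesis using bf_nonneg_expand[OF s(1)] by simp
  qed
  show ?thesis
  proof
    assume "0 < bf p \<rho>"
    then have "- \<rho> \<notin> pos_roots" using pos[of "- \<rho>"] by auto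
    then show "\<rho> \<in> pos_roots" using roots_cases assms(2) by blast
  qed (rule pos)
qed

text \<open>Alternating products of the two halves; \<open>A\<close> is the half that acts first,
  the rightmost factor.\<close>

fun alt :: "'a set \<Rightarrow> nat \<Rightarrow> 'a" where
  "alt A 0 = \<one>"
| "alt A (Suc k) = alt (S - A) k \<otimes> pr A"

lemma alt_carrier: "bip A \<Longrightarrow> alt A k \<in> carrier G"
  by (induction k arbitrary: A) (auto simp: bip_compl bipD)

text \<open>
  The plane spanned by the two halves of the Perron vector is stable under the two halves of the
  Coxeter element. The coordinates in this plane do not depend on which of the halves comes
  first, and they determine the signs of the roots.
\<close>

lemma alt_sign:
  assumes "bip P"
  shows "\<exists>K. K 0 \<and> (\<forall>A\<in>{P, S - P}. \<forall>k. \<forall>s\<in>S - A. act (alt A k) (simple_root s) \<in> pos_roots \<longleftrightarrow> K k)"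
proof -
  obtain p \<kappa> where p: "perron p \<kappa>" using exists_perron by blast
  then have p': "p \<in> V S" "0 < \<kappa>" "\<And>s. s \<in> S \<Longrightarrow> 0 < p s" "\<And>s. s \<in> S \<Longrightarrow> bf p (simple_root s) = \<kappa> * p s"
    by (auto simp: perron_def)
  define l where "l = 2 * (1 - \<kappa>)"
  define h where "h A = (\<lambda>s. if s \<in> A then p s else 0)" for A
  have h_apply: "h A s = (if s \<in> A then p s else 0)" for A s
    by (simp add: h_def)
  have h_sum: "h A + h (S - A) = p" if "A \<subseteq> S" for A
    using p'(1) that by (auto simp: h_def fun_eq_iff fun_apply V_def)
  have h_in: "bf (h A) (simple_root s) = p s" if A: "bip A" "s \<in> A" for A s
  proof -
    have AS: "A \<subseteq> S" "orth A" using A bipD by auto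
    have "bf (h A) (simple_root s) = (\<Sum>t\<in>S. if t = s then p s else 0)"
      unfolding bf_simple_right[OF subsetD[OF AS(1) A(2)]]
      using A AS by (intro sum.cong) (auto simp: h_def orth_def)
    then show ?thesis using A AS by auto
  qed
  have h_out: "bf (h A) (simple_root s) = (\<kappa> - 1) * p s" if A: "bip A" "s \<in> S - A" for A s
  proof -
    have "bf (h A) (simple_root s) + bf (h (S - A)) (simple_root s) = \<kappa> * p s"
      using h_sum[of A] p'(4)[of s] A bipD(1)[OF A(1)] by (metis Diff_iff bf_add_left)
    then show ?thesis using h_in[OF bip_compl[OF A(1)] A(2)] by (simp add: algebra_simps)
  qed
  have pra_h: "pra A (x *\<^sub>R h (S - A) + y *\<^sub>R h A) = (l * x - y) *\<^sub>R h A + x *\<^sub>R h (S - A)" if A: "bip A" for A x y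
  proof (rule ext)
    fix s
    have AS: "A \<subseteq> S" "finite A" "S - (S - A) = A" using bipD(1)[OF A] finite_S finite_subset by blast+
    have "bf (h (S - A)) (simple_root s) = (\<kappa> - 1) * p s" if "s \<in> A"
      using h_out[OF bip_compl[OF A], of s] AS that by auto
    then show "pra A (x *\<^sub>R h (S - A) + y *\<^sub>R h A) s = ((l * x - y) *\<^sub>R h A + x *\<^sub>R h (S - A)) s"
      using h_in[OF A, of s] AS(1,2)
      by (cases "s \<in> A"; simp add: pra_coord plus_fun_apply scaleR_fun_apply h_apply l_def subset_iff)
         (simp_all add: algebra_simps)
  qed
  \<comment> \<open>Coordinates of the translated Perron vector with respect to \<open>h A\<close>
    and \<open>h (S - A)\<close>; the recursion is \<open>pra_h\<close>, and it is the same for both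
    choices of \<open>A\<close>.\<close>
  define xy where "xy = rec_nat (1::real, 1::real) (\<lambda>_ (x, y). (l * x - y, x))"
  have xy0: "xy 0 = (1, 1)" and xyS: "xy (Suc k) = (l * fst (xy k) - snd (xy k), fst (xy k))" for k
    by (simp_all add: xy_def case_prod_beta)
  have coord: "act (inv (alt A k)) p = fst (xy k) *\<^sub>R h A + snd (xy k) *\<^sub>R h (S - A)" if "bip A" for A k
    using that
  proof (induction k arbitrary: A)
    case 0
    then show ?case using h_sum[of A] bipD(1)[of A] by (simp add: xy0)
  next
    case (Suc k)
    have b: "bip (S - A)" "orth A" "S - (S - A) = A" using Suc.prems bip_compl bipD by auto
    have c: "alt (S - A) k \<in> carrier G" using alt_carrier b by blast
    have "act (inv (alt A (Suc k))) p = pra A (act (inv (alt (S - A) k)) p)"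
      using c b by (simp add: inv_mult_group)
    also have "\<dots> = pra A (fst (xy k) *\<^sub>R h (S - A) + snd (xy k) *\<^sub>R h A)"
      using Suc.IH[OF b(1)] b(3) by simp
    finally show ?case using pra_h[OF Suc.prems] by (simp add: xyS)
  qed
  \<comment> \<open>This number times \<open>p s\<close> is the product of the translated Perron
    vector with the simple root of \<open>s\<close> outside \<open>A\<close>, so its sign is
    independent of \<open>s\<close> and of the chosen half.\<close>
  define K where "K k \<longleftrightarrow> 0 < snd (xy k) + (\<kappa> - 1) * fst (xy k)" for k
  have "act (alt A k) (simple_root s) \<in> pos_roots \<longleftrightarrow> K k" if A: "A \<in> {P, S - P}" and s: "s \<in> S - A" for A k s
  proof -
    have b: "bip A" using A assms bip_compl by blast
    have c: "alt A k \<in> carrier G" using alt_carrier b by blast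
    have "bf p (act (alt A k) (simple_root s)) = bf (act (inv (alt A k)) p) (simple_root s)"
      using c by (simp add: bf_act_left)
    also have "\<dots> = p s * (snd (xy k) + (\<kappa> - 1) * fst (xy k))"
      unfolding coord[OF b] bf_add_left bf_scale_left h_out[OF b s] h_in[OF bip_compl[OF b] s]
      by (simp add: algebra_simps)
    finally have "bf p (act (alt A k) (simple_root s)) = p s * (snd (xy k) + (\<kappa> - 1) * fst (xy k))" .
    then show ?thesis using perron_root_sign[OF p, of "act (alt A k) (simple_root s)"] s c p'(3)[of s]
      by (simp add: K_def zero_less_mult_iff)
  qed
  moreover have "K 0" using p'(2) by (simp add: K_def xy0)
  ultimately show ?thesis by blast
qed

end

subsection \<open>Foldings\<close>

locale folding =
  U: irreducible_coxeter W S + D: irreducible_coxeter W' S'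
  for W :: "('a, 'm) monoid_scheme" and S and W' :: "('b, 'n) monoid_scheme" and S' +
  fixes fld :: "'a \<Rightarrow> 'b" and unfld :: "'b \<Rightarrow> 'a" and P' :: "'b set"
  assumes folds: "folds_to W S W' S' fld unfld" and bip': "D.bip P'"
begin

definition fibre :: "'b set \<Rightarrow> 'a set" where
  "fibre A = {s \<in> S. fld s \<in> A}"

lemma fibre_S: "fibre A \<subseteq> S"
  by (auto simp: fibre_def)

lemma finite_fibre [simp]: "finite (fibre A)"
  using fibre_S U.finite_S finite_subset by blast

lemma fld_S: "s \<in> S \<Longrightarrow> fld s \<in> S'"
  using folds by (auto simp: folds_to_def)

lemma fibre_S' [simp]: "fibre S' = S"
  using fld_S by (auto simp: fibre_def)

lemma fibre_diff: "fibre (A - B) = fibre A - fibre B"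
  and fibre_Int: "fibre (A \<inter> B) = fibre A \<inter> fibre B"
  by (auto simp: fibre_def)

lemma fibre_mono: "A \<subseteq> B \<Longrightarrow> fibre A \<subseteq> fibre B"
  by (auto simp: fibre_def)

lemma fibre_nonempty: "s' \<in> S' \<Longrightarrow> fibre {s'} \<noteq> {}"
  using folds by (auto simp: folds_to_def fibre_def)

lemma unfld_carrier [simp]: "w \<in> carrier W' \<Longrightarrow> unfld w \<in> carrier W"
  using folds by (auto simp: folds_to_def hom_def)

lemma unfld_mult [simp]: "u \<in> carrier W' \<Longrightarrow> w \<in> carrier W' \<Longrightarrow> unfld (u \<otimes>\<^bsub>W'\<^esub> w) = unfld u \<otimes>\<^bsub>W\<^esub> unfld w"
  using folds by (auto simp: folds_to_def hom_def)

lemma unfld_inj: "u \<in> carrier W' \<Longrightarrow> w \<in> carrier W' \<Longrightarrow> unfld u = unfld w \<Longrightarrow> u = w"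
  using folds by (auto simp: folds_to_def inj_on_def)

lemma unfld_group_hom: "group_hom W' W unfld"
  using folds D.is_group U.is_group by (auto simp: group_hom_def group_hom_axioms_def folds_to_def)

lemma unfld_one [simp]: "unfld \<one>\<^bsub>W'\<^esub> = \<one>\<^bsub>W\<^esub>"
  by (rule group_hom.hom_one[OF unfld_group_hom])

lemma unfld_inv [simp]: "w \<in> carrier W' \<Longrightarrow> unfld (inv\<^bsub>W'\<^esub> w) = inv\<^bsub>W\<^esub> (unfld w)"
  by (rule group_hom.hom_inv[OF unfld_group_hom])

lemma fibre_single: "fibre {s'} = {s \<in> S. fld s = s'}"
  by (auto simp: fibre_def)

lemma orth_fibre_single: "s' \<in> S' \<Longrightarrow> U.orth (fibre {s'})"
  using folds fibre_S[of "{s'}"] unfolding folds_to_def fibre_single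
  by (intro U.pairwise_commuting_orth) auto

lemma unfld_S: "s' \<in> S' \<Longrightarrow> unfld s' = U.pr (fibre {s'})"
  using folds unfolding folds_to_def fibre_single U.pr_def by blast

text \<open>The unfolded reflections commute. Applied to the simple root of \<open>s\<close>,
  commutation says that reflecting in the fibre of \<open>s'\<close> negates the image under the
  other factor. That reflection leaves the coordinate at \<open>t\<close> alone, so the coordinate,
  which is \<open>- 2 * bm s t\<close>, vanishes.\<close>

lemma commuting_fibres_orth:
  assumes "s' \<in> S'" "t' \<in> S'" "s' \<noteq> t'" "s' \<otimes>\<^bsub>W'\<^esub> t' = t' \<otimes>\<^bsub>W'\<^esub> s'" "s \<in> fibre {s'}" "t \<in> fibre {t'}"
  shows "U.bm s t = 0"
proof -
  let ?A = "fibre {s'}" and ?B = "fibre {t'}"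
  have o: "U.orth ?A" "U.orth ?B" using orth_fibre_single assms by blast+
  have S: "s \<in> S" "t \<in> S" and ne: "s \<notin> ?B" "t \<notin> ?A" using assms by (auto simp: fibre_def)
  have "unfld (s' \<otimes>\<^bsub>W'\<^esub> t') = unfld (t' \<otimes>\<^bsub>W'\<^esub> s')" using assms(4) by simp
  then have "U.act (U.pr ?A \<otimes>\<^bsub>W\<^esub> U.pr ?B) (simple_root s) = U.act (U.pr ?B \<otimes>\<^bsub>W\<^esub> U.pr ?A) (simple_root s)"
    using assms(1,2) by (simp add: unfld_S)
  then have e: "U.pra ?A (U.pra ?B (simple_root s)) = - U.pra ?B (simple_root s)"
    using o U.pra_simple[OF o(1) assms(5)] U.pra_minus[OF o(2)] by simp
  have "U.pra ?B (simple_root s) t = - 2 * U.bm s t"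
    using assms(6) S ne by (auto simp: U.pra_coord simple_root_apply)
  moreover have "U.pra ?A (U.pra ?B (simple_root s)) t = U.pra ?B (simple_root s) t"
    using ne by (simp add: U.pra_coord)
  ultimately show ?thesis using fun_cong[OF e, of t] by (simp add: uminus_apply)
qed

lemma orth_fibre:
  assumes "D.orth A"
  shows "U.orth (fibre A)"
  unfolding U.orth_def
proof (intro conjI ballI impI fibre_S)
  fix s t assume st: "s \<in> fibre A" "t \<in> fibre A" "s \<noteq> t"
  have S': "fld s \<in> S'" "fld t \<in> S'" "fld s \<in> A" "fld t \<in> A" using st D.orth_S[OF assms] by (auto simp: fibre_def)
  show "U.bm s t = 0"
  proof (cases "fld s = fld t")
    case True
    then have "s \<in> fibre {fld s}" "t \<in> fibre {fld s}" using st by (auto simp: fibre_def)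
    then show ?thesis using orth_fibre_single[OF S'(1)] st(3) by (auto simp: U.orth_def)
  next
    case False
    show ?thesis
      by (rule commuting_fibres_orth[OF S'(1,2) False])
         (use D.orth_pairwise_commuting[OF assms] S' st in \<open>auto simp: pairwise_commuting_def fibre_def\<close>)
  qed
qed

lemma unfld_pr:
  assumes "D.orth A"
  shows "unfld (D.pr A) = U.pr (fibre A)"
  using D.orth_finite[OF assms] assms
proof (induction A rule: finite_induct)
  case empty
  have "fibre {} = {}" by (simp add: fibre_def)
  moreover have "D.pr {} = \<one>\<^bsub>W'\<^esub>" by (rule D.act_inj) (use D.orth_subset[OF empty] in auto)
  moreover have "U.pr {} = \<one>\<^bsub>W\<^esub>" by (rule U.act_inj) (use orth_fibre[OF empty] \<open>fibre {} = {}\<close> in auto)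
  ultimately show ?case by simp
next
  case (insert x A)
  have o: "D.orth A" "x \<in> S'" using insert.prems D.orth_subset D.orth_S by blast+
  have d: "D.pr (insert x A) = x \<otimes>\<^bsub>W'\<^esub> D.pr A"
    using D.pr_Un[of "{x}" A] insert o by simp
  have f: "fibre (insert x A) = fibre {x} \<union> fibre A" "fibre {x} \<inter> fibre A = {}"
    using insert.hyps by (auto simp: fibre_def)
  have "U.pr (fibre (insert x A)) = U.pr (fibre {x}) \<otimes>\<^bsub>W\<^esub> U.pr (fibre A)"
    using U.pr_Un[of "fibre {x}" "fibre A"] f orth_fibre[OF insert.prems] by simp
  then show ?case using d insert.IH[OF o(1)] o unfld_S[OF o(2)] by simp
qed

lemma bip_fibre: "D.bip A \<Longrightarrow> U.bip (fibre A)"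
  using orth_fibre[of A] orth_fibre[of "S' - A"] fibre_S[of A]
  by (auto simp: U.bip_def D.bip_def fibre_diff)

lemma unfld_cox:
  assumes "D.bip A" "J \<subseteq> S'"
  shows "unfld (D.cox A J) = U.cox (fibre A) (fibre J)"
  using unfld_pr[OF D.bip_orth(1)[OF assms]] unfld_pr[OF D.bip_orth(2)[OF assms]] D.bip_orth[OF assms]
  by (simp add: D.cox_def U.cox_def fibre_Int fibre_diff)

lemma unfld_alt:
  assumes "D.bip A"
  shows "unfld (D.alt A k) = U.alt (fibre A) k"
  using assms
proof (induction k arbitrary: A)
  case (Suc k)
  have b: "D.bip (S' - A)" "D.orth A" using Suc.prems D.bip_compl D.bipD by auto
  then show ?case using Suc.IH[OF b(1)] D.alt_carrier[OF b(1)] unfld_pr[OF b(2)] by (simp add: fibre_diff)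
qed simp

section \<open>Roots reversed by an unfolded reflection, and positivity of unfolding\<close>

definition fibroots :: "('b \<Rightarrow> real) \<Rightarrow> ('a \<Rightarrow> real) set" where
  "fibroots \<rho> = {\<sigma> \<in> U.roots. U.act (unfld (D.rt \<rho>)) \<sigma> = - \<sigma>}"

lemma fibroots_act:
  assumes "\<rho> \<in> D.roots" "w \<in> carrier W'"
  shows "fibroots (D.act w \<rho>) = U.act (unfld w) ` fibroots \<rho>"
proof -
  have e: "unfld (D.rt (D.act w \<rho>)) = unfld w \<otimes>\<^bsub>W\<^esub> unfld (D.rt \<rho>) \<otimes>\<^bsub>W\<^esub> inv\<^bsub>W\<^esub> (unfld w)"
    using assms by (simp add: D.rt_act)
  have c: "unfld w \<in> carrier W" "unfld (D.rt \<rho>) \<in> carrier W" using assms by auto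
  show ?thesis
  proof (intro equalityI subsetI)
    fix \<sigma> assume "\<sigma> \<in> fibroots (D.act w \<rho>)"
    then have s: "\<sigma> \<in> U.roots" "U.act (unfld w) (U.act (unfld (D.rt \<rho>)) (U.act (inv\<^bsub>W\<^esub> unfld w) \<sigma>)) = - \<sigma>"
      using c by (auto simp: fibroots_def e)
    define \<tau> where "\<tau> = U.act (inv\<^bsub>W\<^esub> unfld w) \<sigma>"
    have "U.act (inv\<^bsub>W\<^esub> unfld w) (U.act (unfld w) (U.act (unfld (D.rt \<rho>)) \<tau>)) = U.act (inv\<^bsub>W\<^esub> unfld w) (- \<sigma>)"
      using s(2) by (simp add: \<tau>_def)
    then have "\<tau> \<in> fibroots \<rho>" using s(1) c by (simp add: \<tau>_def fibroots_def)
    moreover have "\<sigma> = U.act (unfld w) \<tau>" using c by (simp add: \<tau>_def)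
    ultimately show "\<sigma> \<in> U.act (unfld w) ` fibroots \<rho>" by blast
  next
    fix \<sigma> assume "\<sigma> \<in> U.act (unfld w) ` fibroots \<rho>"
    then show "\<sigma> \<in> fibroots (D.act w \<rho>)" using c by (auto simp: fibroots_def e)
  qed
qed

lemma fibroots_simple:
  assumes "s' \<in> S'"
  shows "fibroots (simple_root s') = simple_root ` fibre {s'} \<union> uminus ` simple_root ` fibre {s'}"
proof -
  have o: "U.orth (fibre {s'})" using orth_fibre_single assms by blast
  have a: "U.act (unfld (D.rt (simple_root s'))) \<sigma> = U.pra (fibre {s'}) \<sigma>" for \<sigma>
    using assms o by (simp add: unfld_S)
  show ?thesis
  proof (intro equalityI subsetI)
    fix \<sigma> assume "\<sigma> \<in> fibroots (simple_root s')"
    then have s: "\<sigma> \<in> U.roots" "U.pra (fibre {s'}) \<sigma> = - \<sigma>" using a by (auto simp: fibroots_def)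
    have *: "\<tau> \<in> simple_root ` fibre {s'}" if "\<tau> \<in> U.pos_roots" "U.pra (fibre {s'}) \<tau> = - \<tau>" for \<tau>
      using U.pra_pos_root[OF o that(1)] that U.pos_root_uminus[OF that(1)] by auto
    show "\<sigma> \<in> simple_root ` fibre {s'} \<union> uminus ` simple_root ` fibre {s'}"
    proof (cases "\<sigma> \<in> U.pos_roots")
      case False
      then have "- \<sigma> \<in> U.pos_roots" using U.roots_cases s(1) by blast
      then have "- \<sigma> \<in> simple_root ` fibre {s'}" using * s(2) U.pra_minus[OF o] by simp
      then have "- (- \<sigma>) \<in> uminus ` simple_root ` fibre {s'}" by (rule imageI)
      then show ?thesis by simp
    qed (use * s(2) in blast)
  next
    fix \<sigma> assume "\<sigma> \<in> simple_root ` fibre {s'} \<union> uminus ` simple_root ` fibre {s'}"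
    then show "\<sigma> \<in> fibroots (simple_root s')"
      using a U.pra_simple[OF o] U.pra_minus[OF o] fibre_S[of "{s'}"] by (auto simp: fibroots_def)
  qed
qed

text \<open>
  The number of roots of the big system reversed by a reflection of the small one; summed over the
  inversions of an element, it bounds twice the number of inversions of the unfolded element.
\<close>

definition fw :: "('b \<Rightarrow> real) \<Rightarrow> nat" where
  "fw \<rho> = card (fibroots \<rho>)"

lemma fw_act:
  assumes "\<rho> \<in> D.roots" "w \<in> carrier W'"
  shows "fw (D.act w \<rho>) = fw \<rho>"
proof -
  have "inj_on (U.act (unfld w)) (fibroots \<rho>)"
    using assms(2) by (intro inj_on_inverseI[of _ "U.act (inv\<^bsub>W\<^esub> (unfld w))"]) simp
  then show ?thesis unfolding fw_def fibroots_act[OF assms] by (rule card_image)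
qed

lemma fw_simple:
  assumes "s' \<in> S'"
  shows "fw (simple_root s') = 2 * card (fibre {s'})"
proof -
  have i: "inj_on simple_root (fibre {s'})" by (auto simp: inj_on_def)
  have "simple_root ` fibre {s'} \<inter> uminus ` simple_root ` fibre {s'} = {}"
  proof -
    have "- simple_root s \<noteq> simple_root t" if "s \<in> S" "t \<in> S" for s t
      using U.pos_root_uminus[of "simple_root s"] U.simple_root_pos_roots[OF that(2)] that(1) by force
    then show ?thesis using fibre_S[of "{s'}"] by (auto simp: subset_iff) metis
  qed
  then have "fw (simple_root s') = card (simple_root ` fibre {s'}) + card (uminus ` simple_root ` fibre {s'})"
    unfolding fw_def fibroots_simple[OF assms] by (intro card_Un_disjoint) auto
  also have "card (uminus ` simple_root ` fibre {s'}) = card (simple_root ` fibre {s'})"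
    by (rule card_image) (auto simp: inj_on_def)
  finally show ?thesis using card_image[OF i] by simp
qed

lemma sum_fw:
  assumes "A \<subseteq> S'"
  shows "(\<Sum>s'\<in>A. fw (simple_root s')) = 2 * card (fibre A)"
proof -
  have "finite A" using assms D.finite_S finite_subset by blast
  have "(\<Sum>s'\<in>A. fw (simple_root s')) = 2 * (\<Sum>s'\<in>A. card (fibre {s'}))"
    using assms fw_simple by (simp add: sum_distrib_left subset_iff)
  also have "(\<Sum>s'\<in>A. card (fibre {s'})) = card (\<Union>s'\<in>A. fibre {s'})"
    using \<open>finite A\<close> by (intro card_UN_disjoint[symmetric]) (auto simp: fibre_def)
  also have "(\<Union>s'\<in>A. fibre {s'}) = fibre A" by (auto simp: fibre_def)
  finally show ?thesis .
qed

text \<open>The weight is 2 because \<open>fw\<close> counts reversed roots with both signs.\<close>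

definition invU :: "'b \<Rightarrow> nat" where
  "invU w = U.inv_wt (\<lambda>_. 2) (unfld w)"

definition invD :: "'b \<Rightarrow> nat" where
  "invD w = D.inv_wt fw w"

lemma invU_mult:
  assumes "w \<in> carrier W'" "D.orth A"
  shows "invU (w \<otimes>\<^bsub>W'\<^esub> D.pr A) + 4 * card {s \<in> fibre A. U.act (unfld w) (simple_root s) \<notin> U.pos_roots}
    = invU w + 2 * card (fibre A)"
proof -
  let ?N = "{s \<in> fibre A. U.act (unfld w) (simple_root s) \<notin> U.pos_roots}"
  let ?Q = "{s \<in> fibre A. U.act (unfld w) (simple_root s) \<in> U.pos_roots}"
  have "invU (w \<otimes>\<^bsub>W'\<^esub> D.pr A) + 2 * card ?N = invU w + 2 * card ?Q"
    using U.inv_wt_mult_pr[of "unfld w" "fibre A" "\<lambda>_. 2"] orth_fibre[OF assms(2)] assms unfld_pr[OF assms(2)]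
    by (simp add: invU_def mult.commute)
  moreover have "card (fibre A) = card (?N \<union> ?Q)" by (rule arg_cong[of _ _ card]) auto
  moreover have "card (?N \<union> ?Q) = card ?N + card ?Q" by (rule card_Un_disjoint) auto
  ultimately show ?thesis by simp
qed

lemma invD_mult:
  assumes "w \<in> carrier W'" "D.orth A"
  shows "invD (w \<otimes>\<^bsub>W'\<^esub> D.pr A) + 2 * (\<Sum>s' | s' \<in> A \<and> D.act w (simple_root s') \<notin> D.pos_roots. fw (simple_root s'))
    = invD w + 2 * card (fibre A)"
proof -
  let ?N = "{s' \<in> A. D.act w (simple_root s') \<notin> D.pos_roots}"
  let ?Q = "{s' \<in> A. D.act w (simple_root s') \<in> D.pos_roots}"
  have f: "finite A" "A \<subseteq> S'" using assms(2) D.orth_finite D.orth_S by auto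
  have "invD (w \<otimes>\<^bsub>W'\<^esub> D.pr A) + (\<Sum>s'\<in>?N. fw (simple_root s')) = invD w + (\<Sum>s'\<in>?Q. fw (simple_root s'))"
    unfolding invD_def by (rule D.inv_wt_mult_pr[OF assms fw_act])
  moreover have "(\<Sum>s'\<in>A. fw (simple_root s')) = (\<Sum>s'\<in>?N \<union> ?Q. fw (simple_root s'))" by (rule sum.cong) auto
  moreover have "(\<Sum>s'\<in>?N \<union> ?Q. fw (simple_root s')) = (\<Sum>s'\<in>?N. fw (simple_root s')) + (\<Sum>s'\<in>?Q. fw (simple_root s'))"
    by (rule sum.union_disjoint) (use f in auto)
  ultimately show ?thesis using sum_fw[OF f(2)] by simp
qed

text \<open>A length-increasing step by \<open>t\<close> raises \<open>invD\<close> by exactly twice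
  the size of the fibre of \<open>t\<close>, and this is the most by which \<open>invU\<close> can
  grow.\<close>

lemma invU_le_invD:
  assumes "w \<in> carrier W'"
  shows "invU w \<le> invD w"
  using assms
proof (induction "D.len w" arbitrary: w rule: less_induct)
  case (less w)
  show ?case
  proof (cases "w = \<one>\<^bsub>W'\<^esub>")
    case True
    then show ?thesis by (simp add: invU_def invD_def)
  next
    case False
    obtain t where t: "t \<in> S'" "D.len (w \<otimes>\<^bsub>W'\<^esub> t) < D.len w" using D.descent_exists less.prems False by blast
    define v where "v = w \<otimes>\<^bsub>W'\<^esub> t"
    have v: "v \<in> carrier W'" "v \<otimes>\<^bsub>W'\<^esub> t = w" using t less.prems by (auto simp: v_def)
    have o: "D.orth {t}" using t by (simp add: D.orth_def)
    have "nonneg (D.act v (simple_root t))" by (rule D.len_less_imp_nonneg) (use v t v_def in auto)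
    then have "D.act v (simple_root t) \<in> D.pos_roots" using v t by (simp add: D.pos_roots_def)
    then have e: "{s'. s' \<in> {t} \<and> D.act v (simple_root s') \<notin> D.pos_roots} = {}" by auto
    have "invD w = invD v + 2 * card (fibre {t})"
      using invD_mult[OF v(1) o] v(2) t(1) unfolding e by simp
    moreover have "invU w \<le> invU v + 2 * card (fibre {t})" using invU_mult[OF v(1) o] v(2) t(1) by simp
    moreover have "invU v \<le> invD v" using less.hyps v(1) t(2) v_def by blast
    ultimately show ?thesis by simp
  qed
qed

text \<open>By \<open>alt_sign\<close> every alternating product gains the maximal number of big
  inversions until the sign flips. Squeezed between \<open>invU\<close> and this maximum,
  \<open>invD\<close> must gain equally, so its simple roots also turn negative at the same
  time.\<close>

lemma longest_element:
  "\<exists>w\<in>carrier W'. (\<forall>s'\<in>S'. D.act w (simple_root s') \<notin> D.pos_roots) \<and> invU w = invD w"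
proof -
  have bP: "U.bip (fibre P')" using bip_fibre bip' by blast
  obtain K where K: "K 0" "\<And>A k s. A \<in> {fibre P', S - fibre P'} \<Longrightarrow> s \<in> S - A \<Longrightarrow>
      U.act (U.alt A k) (simple_root s) \<in> U.pos_roots \<longleftrightarrow> K k"
    using U.alt_sign[OF bP] by blast
  let ?C = "{P', S' - P'}"
  have P'S: "P' \<subseteq> S'" using D.bipD bip' by blast
  have bC: "D.bip A" if "A \<in> ?C" for A using that bip' D.bip_compl by blast
  have cC: "S' - A \<in> ?C" if "A \<in> ?C" for A using that P'S by (auto simp: double_diff)
  have alt_c: "D.alt A k \<in> carrier W'" if "A \<in> ?C" for A k using D.alt_carrier bC that by blast
  have sgn: "U.act (unfld (D.alt (S' - A) k)) (simple_root s) \<in> U.pos_roots \<longleftrightarrow> K k"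
    if A: "A \<in> ?C" and s: "s \<in> fibre A" for A k s
  proof -
    have "fibre (S' - A) \<in> {fibre P', S - fibre P'}" using cC[OF A] fibre_diff[of S' P'] by (elim insertE) simp_all
    moreover have "s \<in> S - fibre (S' - A)" using s by (auto simp: fibre_def)
    ultimately show ?thesis using K(2) unfld_alt[OF bC[OF cC[OF A]]] by simp
  qed
  have step: "invU (D.alt A (Suc k)) = invU (D.alt (S' - A) k) + 2 * card (fibre A)" if A: "A \<in> ?C" and "K k" for A k
  proof -
    have e: "{s \<in> fibre A. U.act (unfld (D.alt (S' - A) k)) (simple_root s) \<notin> U.pos_roots} = {}"
      using sgn[OF A] \<open>K k\<close> by auto
    show ?thesis using invU_mult[OF alt_c[OF cC[OF A]] D.bipD(2)[OF bC[OF A]], of k] unfolding e by simp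
  qed
  \<comment> \<open>Without a flip of the sign the inversion count would grow beyond the number of
    positive roots.\<close>
  have "\<exists>k. \<not> K k"
  proof (rule ccontr)
    assume "\<not> ?thesis"
    then have all: "K k" for k by blast
    have "k \<le> invU (D.alt P' (2 * k))" for k
    proof (induction k)
      case (Suc k)
      have "invU (D.alt P' (2 * Suc k)) = invU (D.alt P' (2 * k)) + 2 * card (fibre (S' - P')) + 2 * card (fibre P')"
        using step[of P' "Suc (2 * k)"] step[of "S' - P'" "2 * k"] all P'S by (simp add: double_diff)
      moreover have "0 < card (fibre (S' - P')) + card (fibre P')"
      proof -
        have "S \<subseteq> fibre (S' - P') \<union> fibre P'" using fld_S by (auto simp: fibre_def)
        then have "fibre (S' - P') \<noteq> {} \<or> fibre P' \<noteq> {}" using U.S_nonempty by blast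
        then show ?thesis by (auto simp: card_gt_0_iff)
      qed
      ultimately show ?case using Suc by linarith
    qed simp
    then have "Suc (\<Sum>\<rho>\<in>U.pos_roots. 2) \<le> invU (D.alt P' (2 * Suc (\<Sum>\<rho>\<in>U.pos_roots. 2)))" by blast
    also have "\<dots> \<le> (\<Sum>\<rho>\<in>U.pos_roots. 2)" unfolding invU_def by (rule U.inv_wt_le)
    finally show False by simp
  qed
  then obtain k0 where k0: "\<not> K k0" "\<And>k. k < k0 \<Longrightarrow> K k" using exists_least_iff[of "\<lambda>k. \<not> K k"] by auto
  then obtain j where j: "k0 = Suc j" using K(1) by (cases k0) auto
  have eqk: "invU (D.alt A k) = invD (D.alt A k)" if "k \<le> k0" "A \<in> ?C" for A k
    using that
  proof (induction k arbitrary: A)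
    case 0
    then show ?case by (simp add: invU_def invD_def)
  next
    case (Suc k)
    have "invU (D.alt A (Suc k)) = invU (D.alt (S' - A) k) + 2 * card (fibre A)"
      using step k0(2) Suc.prems by simp
    moreover have "invD (D.alt A (Suc k)) \<le> invD (D.alt (S' - A) k) + 2 * card (fibre A)"
      using invD_mult[OF alt_c[OF cC[OF Suc.prems(2)]] D.bipD(2)[OF bC[OF Suc.prems(2)]], of k] by simp
    moreover have "invU (D.alt (S' - A) k) = invD (D.alt (S' - A) k)"
      using Suc.IH[OF _ cC[OF Suc.prems(2)]] Suc.prems(1) by simp
    moreover have "invU (D.alt A (Suc k)) \<le> invD (D.alt A (Suc k))"
      by (rule invU_le_invD) (use alt_c[OF Suc.prems(2)] in blast)
    ultimately show ?case by linarith
  qed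
  \<comment> \<open>Equality of the counts before and after the last factor leaves no simple root of
    \<open>A\<close> that was negative already, so the last factor turns them all negative.\<close>
  have negD: "D.act (D.alt A k0) (simple_root s') \<notin> D.pos_roots" if A: "A \<in> ?C" and s': "s' \<in> A" for A s'
  proof -
    let ?v = "D.alt (S' - A) j"
    have v: "?v \<in> carrier W'" using alt_c cC A by blast
    have o: "D.orth A" using D.bipD bC A by blast
    have sS: "s' \<in> S'" using s' D.orth_S[OF o] by blast
    have "invU (D.alt A k0) = invU ?v + 2 * card (fibre A)" unfolding j by (rule step) (use A k0 j in auto)
    then have "invD (D.alt A k0) = invD ?v + 2 * card (fibre A)"
      using eqk[of k0 A] eqk[of j "S' - A"] A cC j by simp
    then have "(\<Sum>s' | s' \<in> A \<and> D.act ?v (simple_root s') \<notin> D.pos_roots. fw (simple_root s')) = 0"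
      using invD_mult[OF v o] by (simp add: j)
    moreover have "finite {s'. s' \<in> A \<and> D.act ?v (simple_root s') \<notin> D.pos_roots}" using D.orth_finite[OF o] by simp
    moreover have "fw (simple_root s') \<noteq> 0" using fw_simple[OF sS] fibre_nonempty[OF sS] by simp
    ultimately have p: "D.act ?v (simple_root s') \<in> D.pos_roots" using s' by auto
    have "D.act (D.alt A k0) (simple_root s') = - D.act ?v (simple_root s')"
      using v o D.pra_simple[OF o s'] by (simp add: j)
    then show ?thesis using D.pos_root_uminus[OF p] by simp
  qed
  have negU: "U.act (unfld (D.alt A k0)) (simple_root s) \<notin> U.pos_roots" if A: "A \<in> ?C" and s: "s \<in> S" for A s
  proof (cases "s \<in> fibre A")
    case True
    let ?v = "D.alt (S' - A) j"
    have v: "?v \<in> carrier W'" using alt_c cC A by blast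
    have o: "D.orth A" using D.bipD bC A by blast
    have p: "U.act (unfld ?v) (simple_root s) \<in> U.pos_roots" using sgn[OF A True, of j] k0(2) j by simp
    have "U.act (unfld (D.alt A k0)) (simple_root s) = - U.act (unfld ?v) (simple_root s)"
      using v o orth_fibre[OF o] U.pra_simple[OF orth_fibre[OF o] True] by (simp add: j unfld_pr)
    then show ?thesis using U.pos_root_uminus[OF p] by simp
  next
    case False
    then have "s \<in> fibre (S' - A)" using s fld_S by (auto simp: fibre_def)
    moreover have "S' - (S' - A) = A" using A P'S by (auto simp: double_diff)
    ultimately show ?thesis using sgn[OF cC[OF A], of s k0] k0(1) by simp
  qed
  \<comment> \<open>So far negativity in the small system is known only on the half applied first.
    The two products coincide in the big group, hence in the small one by injectivity, and together
    they cover \<open>S'\<close>.\<close>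
  have "unfld (D.alt P' k0) = unfld (D.alt (S' - P') k0)"
    by (rule U.longest_unique) (use negU alt_c in auto)
  then have same: "D.alt P' k0 = D.alt (S' - P') k0" using unfld_inj alt_c by blast
  have "\<forall>s'\<in>S'. D.act (D.alt P' k0) (simple_root s') \<notin> D.pos_roots"
    using negD[of P'] negD[of "S' - P'"] same by auto
  then show ?thesis using alt_c[of P' k0] eqk[of k0 P'] by blast
qed

text \<open>Induction downwards from the longest element: a step up by \<open>t\<close> adds exactly
  twice the fibre size to \<open>invD\<close> and at most this to \<open>invU\<close>, so equality
  above forces equality below.\<close>

lemma invU_eq_invD:
  assumes "w \<in> carrier W'"
  shows "invU w = invD w"
  using assms
proof (induction "(\<Sum>\<rho>\<in>D.pos_roots. fw \<rho>) - invD w" arbitrary: w rule: less_induct)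
  case (less w)
  obtain w0 where w0: "w0 \<in> carrier W'" "\<And>s'. s' \<in> S' \<Longrightarrow> D.act w0 (simple_root s') \<notin> D.pos_roots" "invU w0 = invD w0"
    using longest_element by blast
  show ?case
  proof (cases "\<exists>s'\<in>S'. D.act w (simple_root s') \<in> D.pos_roots")
    case False
    then have "w = w0" using D.longest_unique[OF less.prems w0(1)] w0(2) by blast
    then show ?thesis using w0(3) by simp
  next
    case True
    then obtain t where t: "t \<in> S'" "D.act w (simple_root t) \<in> D.pos_roots" by blast
    have o: "D.orth {t}" using t by (simp add: D.orth_def)
    have e: "{s'. s' \<in> {t} \<and> D.act w (simple_root s') \<notin> D.pos_roots} = {}" using t by auto
    have d: "invD (w \<otimes>\<^bsub>W'\<^esub> t) = invD w + 2 * card (fibre {t})"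
      using invD_mult[OF less.prems o] t(1) unfolding e by simp
    have u: "invU (w \<otimes>\<^bsub>W'\<^esub> t) \<le> invU w + 2 * card (fibre {t})" using invU_mult[OF less.prems o] t(1) by simp
    have "invD (w \<otimes>\<^bsub>W'\<^esub> t) \<le> (\<Sum>\<rho>\<in>D.pos_roots. fw \<rho>)" unfolding invD_def by (rule D.inv_wt_le)
    moreover have "0 < card (fibre {t})" using fibre_nonempty[OF t(1)] by (simp add: card_gt_0_iff)
    ultimately have "(\<Sum>\<rho>\<in>D.pos_roots. fw \<rho>) - invD (w \<otimes>\<^bsub>W'\<^esub> t) < (\<Sum>\<rho>\<in>D.pos_roots. fw \<rho>) - invD w"
      using d by linarith
    then have "invU (w \<otimes>\<^bsub>W'\<^esub> t) = invD (w \<otimes>\<^bsub>W'\<^esub> t)" using less.hyps less.prems t(1) by simp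
    then show ?thesis using d u invU_le_invD[OF less.prems] by linarith
  qed
qed

text \<open>The counts agree for \<open>w\<close> and for \<open>w\<close> times \<open>s'\<close>;
  an already negative simple root in the fibre would make the increase of \<open>invU\<close> too
  small.\<close>

lemma unfold_positive:
  assumes "w \<in> carrier W'" "s' \<in> S'" "D.act w (simple_root s') \<in> D.pos_roots" "s \<in> fibre {s'}"
  shows "U.act (unfld w) (simple_root s) \<in> U.pos_roots"
proof -
  have o: "D.orth {s'}" using assms by (simp add: D.orth_def)
  have e: "{t. t \<in> {s'} \<and> D.act w (simple_root t) \<notin> D.pos_roots} = {}" using assms by auto
  have d: "invD (w \<otimes>\<^bsub>W'\<^esub> s') = invD w + 2 * card (fibre {s'})"
    using invD_mult[OF assms(1) o] assms(2) unfolding e by simp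
  have "card {s \<in> fibre {s'}. U.act (unfld w) (simple_root s) \<notin> U.pos_roots} = 0"
    using invU_mult[OF assms(1) o] d assms(1,2) invU_eq_invD[of w] invU_eq_invD[of "w \<otimes>\<^bsub>W'\<^esub> s'"] by simp
  then show ?thesis using assms(4) by auto
qed

end

section \<open>Stripping and rotating cones of annihilated positive roots\<close>

context irreducible_coxeter
begin

definition restr :: "'a set \<Rightarrow> ('a \<Rightarrow> real) \<Rightarrow> ('a \<Rightarrow> real)" where
  "restr A f = (\<lambda>s. if s \<in> A then f s else 0)"

lemma restr_apply: "restr A f s = (if s \<in> A then f s else 0)"
  by (simp add: restr_def)

lemma restr_linear: "linear (restr A)"
  by (auto simp: linear_iff restr_apply fun_eq_iff plus_fun_apply scaleR_fun_apply)

lemma restr_V: "restr A f \<in> V A"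
  by (simp add: V_def restr_apply)

lemma restr_id: "f \<in> V A \<Longrightarrow> restr A f = f"
  by (auto simp: V_def restr_apply fun_eq_iff)

lemma hyperplane_cone_split_hull:
  assumes "bip P" "J \<subseteq> S" "K \<subseteq> J \<inter> P" "\<sigma> \<in> roots" "\<sigma> \<in> V (J - K)"
    and "v \<in> cone_hull {\<rho> \<in> pos_roots \<inter> V J. eul P \<rho> \<sigma> = 0}"
  shows "v \<in> cone_hull (simple_root ` K \<union> {\<rho> \<in> pos_roots \<inter> V (J - K). eul P \<rho> \<sigma> = 0})"
  by (rule cone_hull_minimal[OF assms(6)]) (use hyperplane_cone_split[OF assms(1-5)] in auto)

text \<open>If \<open>\<sigma>\<close> did not vanish at \<open>s\<close> in \<open>K\<close>, the
  simple root of \<open>s\<close> would not be among the generators. All other generators have a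
  nonnegative coordinate at \<open>s\<close> after reflection, and then so would \<open>v\<close>.
  Once \<open>\<sigma>\<close> vanishes on \<open>K\<close>, the splitting of the cone survives the
  projection away from \<open>K\<close>.\<close>

lemma cone_strip:
  assumes "bip P" "J \<subseteq> S" "K \<subseteq> J \<inter> P" "\<sigma> \<in> roots" "\<sigma> \<in> V J"
    and v: "v \<in> cone_hull {\<rho> \<in> pos_roots \<inter> V J. eul P \<rho> \<sigma> = 0}"
    and neg: "\<And>s. s \<in> K \<Longrightarrow> pra (J \<inter> P) v s < 0"
  shows "\<sigma> \<in> V (J - K)"
    and "restr (J - K) v \<in> cone_hull {\<rho> \<in> pos_roots \<inter> V (J - K). eul P \<rho> \<sigma> = 0}"
proof -
  let ?C = "{\<rho> \<in> pos_roots \<inter> V J. eul P \<rho> \<sigma> = 0}"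
  have o: "orth (J \<inter> P)" using bip_orth assms by blast
  have s0: "\<sigma> s = 0" if s: "s \<in> K" for s
  proof (rule ccontr)
    assume ne: "\<sigma> s \<noteq> 0"
    have base: "0 \<le> pra (J \<inter> P) a s" if a: "a \<in> ?C" for a
    proof (cases "nonneg (pra (J \<inter> P) a)")
      case False
      then obtain r where r: "r \<in> J \<inter> P" "a = simple_root r" using not_nonneg_pra_root[OF o, of a] a by blast
      have "r \<noteq> s" using a ne eul_simple[OF assms(1), of r \<sigma>] r by auto
      then show ?thesis using pra_simple[OF o r(1)] r(2) by (simp add: uminus_apply simple_root_apply)
    qed (simp add: nonneg_def)
    have "0 \<le> pra (J \<inter> P) v s"
    proof (rule cone_hull.induct[OF v])
      show "0 \<le> pra (J \<inter> P) 0 s" by (simp add: pra_zero[OF o] zero_fun_apply)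
      show "0 \<le> pra (J \<inter> P) (x + r *\<^sub>R a) s" if "0 \<le> pra (J \<inter> P) x s" "a \<in> ?C" "0 \<le> r" for x a and r :: real
        using that base by (simp add: pra_add[OF o] pra_scale[OF o] plus_fun_apply scaleR_fun_apply)
    qed
    then show False using neg[OF s] by simp
  qed
  then show \<sigma>: "\<sigma> \<in> V (J - K)" using assms(5) by (auto simp: V_def)
  let ?C' = "{\<rho> \<in> pos_roots \<inter> V (J - K). eul P \<rho> \<sigma> = 0}"
  have "v \<in> cone_hull (simple_root ` K \<union> ?C')"
    by (rule hyperplane_cone_split_hull[OF assms(1-4) \<sigma> v])
  then show "restr (J - K) v \<in> cone_hull ?C'"
  proof (rule cone_hull_image[OF _ restr_linear], intro image_subsetI)
    fix x assume "x \<in> simple_root ` K \<union> ?C'"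
    then consider s where "s \<in> K" "x = simple_root s" | "x \<in> ?C'" by blast
    then show "restr (J - K) x \<in> cone_hull ?C'"
    proof cases
      case 1
      then have "restr (J - K) x = 0" by (intro ext) (auto simp: restr_apply simple_root_apply zero_fun_apply)
      then show ?thesis by (simp add: cone_hull.zero)
    next
      case 2
      then show ?thesis by (simp add: restr_id cone_hull_base)
    qed
  qed
qed

text \<open>Only simple roots in \<open>J \<inter> P\<close> are turned negative, and those among
  the generators have letters in \<open>K\<close>. Reflecting the remaining generators in
  \<open>J \<inter> P - K\<close> keeps them positive and gives the right result outside
  \<open>K\<close>; the missing multiples of simple roots of \<open>K\<close> are nonnegative by
  \<open>nn\<close>.\<close>

lemma cone_rotate:
  assumes "bip P" "J \<subseteq> S" "\<sigma> \<in> roots" "\<sigma> \<in> V J"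
    and v: "v \<in> cone_hull {\<rho> \<in> pos_roots \<inter> V J. eul P \<rho> \<sigma> = 0}"
    and nn: "nonneg (pra (J \<inter> P) v)"
  shows "pra (J \<inter> P) v \<in> cone_hull {\<rho> \<in> pos_roots \<inter> V J. eul (S - P) \<rho> (pra (J \<inter> P) \<sigma>) = 0}"
proof -
  let ?p = "pra (J \<inter> P)"
  define K where "K = {s \<in> J \<inter> P. \<sigma> s = 0}"
  have K: "K \<subseteq> J \<inter> P" "K \<subseteq> S" using assms(2) by (auto simp: K_def)
  have o: "orth (J \<inter> P)" using bip_orth[OF assms(1,2)] by simp
  then have o: "orth (J \<inter> P)" "orth K" "orth (J \<inter> P - K)"
    using orth_subset[OF o K(1)] orth_subset[OF o Diff_subset] by auto
  have f: "finite (J \<inter> P)" "finite K" using orth_finite o by auto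
  have \<sigma>: "\<sigma> \<in> V (J - K)" using assms(4) by (auto simp: V_def K_def)
  let ?C' = "{\<rho> \<in> pos_roots \<inter> V (J - K). eul P \<rho> \<sigma> = 0}"
  let ?C'' = "{\<rho> \<in> pos_roots \<inter> V (J - K). eul (S - P) \<rho> (?p \<sigma>) = 0}"
  have vh: "v \<in> cone_hull (simple_root ` K \<union> ?C')"
    by (rule hyperplane_cone_split_hull[OF assms(1,2) K(1) assms(3) \<sigma> v])
  \<comment> \<open>Coordinates in \<open>K\<close> are left open because their sign is controlled
    only for the whole of \<open>v\<close>, not for partial sums.\<close>
  define good where "good x \<longleftrightarrow> (\<exists>y\<in>cone_hull ?C''. \<forall>t. t \<notin> K \<longrightarrow> ?p x t = y t)" for x
  have "good v"
  proof (rule cone_hull.induct[OF vh])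
    show "good 0" unfolding good_def pra_zero[OF o(1)] by (intro bexI[of _ 0] cone_hull.zero) simp
  next
    fix x a and r :: real
    assume gx: "good x" and a: "a \<in> simple_root ` K \<union> ?C'" and r: "0 \<le> r"
    obtain y where y: "y \<in> cone_hull ?C''" "\<And>t. t \<notin> K \<Longrightarrow> ?p x t = y t" using gx unfolding good_def by auto
    have lin: "?p (x + r *\<^sub>R a) t = ?p x t + r * ?p a t" for t
      by (simp add: pra_add[OF o(1)] pra_scale[OF o(1)] plus_fun_apply scaleR_fun_apply)
    consider s where "s \<in> K" "a = simple_root s" | "a \<in> ?C'" using a by blast
    then show "good (x + r *\<^sub>R a)"
    proof cases
      case (1 s)
      then have "s \<in> J \<inter> P" using K(1) by blast
      then have "?p a t = 0" if "t \<notin> K" for t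
        using pra_simple[OF o(1), of s] 1 that by (auto simp: uminus_apply simple_root_apply)
      then show ?thesis unfolding good_def using y lin by (intro bexI[of _ y]) auto
    next
      case 2
      define a' where "a' = pra (J \<inter> P - K) a"
      have "a \<notin> simple_root ` (J \<inter> P - K)"
      proof
        assume "a \<in> simple_root ` (J \<inter> P - K)"
        then obtain s where "s \<in> J \<inter> P - K" "a = simple_root s" by blast
        then show False using 2 eul_simple[OF assms(1), of s \<sigma>] by (auto simp: K_def)
      qed
      then have pos: "a' \<in> pos_roots" unfolding a'_def using 2 by (intro pra_pos_root[OF o(3)]) auto
      have V': "a' \<in> V (J - K)" unfolding a'_def using 2 by (intro pra_V[OF o(3)]) auto
      have aJ: "a \<in> V J" using 2 V_mono[of "J - K" J] by blast
      have kJ: "pra K a \<in> V J" using pra_V[OF o(2) _ aJ] K(1) by blast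
      \<comment> \<open>In this form \<open>eul_rotate\<close> applies, and \<open>pra K a\<close>
        differs from \<open>a\<close> by simple roots of \<open>K\<close>, which
        \<open>\<sigma>\<close> annihilates.\<close>
      have "a' = ?p (pra K a)"
      proof -
        have "J \<inter> P = (J \<inter> P - K) \<union> K" using K(1) by blast
        then have "?p (pra K a) = pra (J \<inter> P - K) (pra K (pra K a))"
          using pra_Un[of "J \<inter> P - K" K "pra K a"] o(1) by auto
        then show ?thesis by (simp add: a'_def pra_pra[OF o(2)])
      qed
      then have "eul (S - P) a' (?p \<sigma>) = eul P (pra K a) \<sigma>"
        using eul_rotate[OF assms(1,2) kJ assms(4)] by simp
      also have "\<dots> = eul P a \<sigma> - (\<Sum>s\<in>K. 2 * bf a (simple_root s) * eul P (simple_root s) \<sigma>)"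
        by (simp add: pra_def eul_diff_left linear_sum[OF eul_linear_left] eul_scale_left)
      also have "(\<Sum>s\<in>K. 2 * bf a (simple_root s) * eul P (simple_root s) \<sigma>) = 0"
        by (rule sum.neutral) (auto simp: K_def eul_simple[OF assms(1)])
      finally have "a' \<in> ?C''" using 2 pos V' by simp
      then have "y + r *\<^sub>R a' \<in> cone_hull ?C''" using y(1) r by (intro cone_hull.add) auto
      moreover have "?p a t = a' t" if "t \<notin> K" for t using f(1) that by (simp add: a'_def pra_coord)
      ultimately show ?thesis unfolding good_def using y(2) lin
        by (intro bexI[of _ "y + r *\<^sub>R a'"]) (auto simp: plus_fun_apply scaleR_fun_apply)
    qed
  qed
  then obtain y where y: "y \<in> cone_hull ?C''" "\<And>t. t \<notin> K \<Longrightarrow> ?p v t = y t" unfolding good_def by auto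
  have "subspace (V (J - K))" by (rule V_subspace)
  then have "span ?C'' \<subseteq> V (J - K)" by (intro real_vector.span_minimal) auto
  then have yV: "y \<in> V (J - K)" using y(1) cone_hull_subset_span by blast
  have e: "?p v = y + (\<Sum>s\<in>K. ?p v s *\<^sub>R simple_root s)"
  proof (rule ext)
    fix t
    have "(\<Sum>s\<in>K. ?p v s *\<^sub>R simple_root s) t = (\<Sum>s\<in>K. if s = t then ?p v t else 0)"
      unfolding sum_fun_apply by (intro sum.cong) (auto simp: simple_root_apply scaleR_fun_apply)
    also have "\<dots> = (if t \<in> K then ?p v t else 0)" using f(2) by simp
    finally show "?p v t = (y + (\<Sum>s\<in>K. ?p v s *\<^sub>R simple_root s)) t"
      using y(2)[of t] yV by (auto simp: plus_fun_apply V_def)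
  qed
  let ?T = "{\<rho> \<in> pos_roots \<inter> V J. eul (S - P) \<rho> (?p \<sigma>) = 0}"
  have "?C'' \<subseteq> ?T" using V_mono[of "J - K" J] by auto
  then have "y \<in> cone_hull ?T" using y(1) cone_hull_mono by blast
  moreover have "(\<Sum>s\<in>K. ?p v s *\<^sub>R simple_root s) \<in> cone_hull ?T"
  proof (intro cone_hull_sum cone_hull_scale cone_hull_base)
    fix s assume s: "s \<in> K"
    have sJ: "simple_root s \<in> V J" using s K(1) by (intro simple_root_V) blast
    have "eul (S - P) (?p (simple_root s)) (?p \<sigma>) = eul P (simple_root s) \<sigma>"
      by (rule eul_rotate[OF assms(1,2) sJ assms(4)])
    also have "\<dots> = 0" using s eul_simple[OF assms(1), of s \<sigma>] by (simp add: K_def)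
    finally have "eul (S - P) (simple_root s) (?p \<sigma>) = 0"
      using pra_simple[OF o(1) subsetD[OF K(1) s]] by simp
    then show "simple_root s \<in> ?T" using s K(2) sJ by auto
    show "0 \<le> ?p v s" using nn by (simp add: nonneg_def)
  qed
  ultimately show ?thesis by (subst e) (rule cone_hull_add)
qed

lemma rk_add_Mov:
  assumes "u \<in> carrier G" "w \<in> carrier G" "rk (u \<otimes> w) = rk u + rk w"
  shows "Mov u \<subseteq> Mov (u \<otimes> w)" "Mov w \<subseteq> Mov (u \<otimes> w)"
  using abs_le_Mov[of w "u \<otimes> w"] assms by (auto simp: m_assoc)

lemma Mov_pr:
  assumes "orth A"
  shows "Mov (pr A) \<subseteq> span (simple_root ` A)" "simple_root ` A \<subseteq> Mov (pr A)"
proof -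
  show "Mov (pr A) \<subseteq> span (simple_root ` A)"
  proof (rule subsetI)
    fix x assume "x \<in> Mov (pr A)"
    then obtain f where "x = pra A f - f" using assms by (auto simp: Mov_def)
    then have "x = - (\<Sum>s\<in>A. (2 * bf f (simple_root s)) *\<^sub>R simple_root s)" by (simp add: pra_def)
    also have "\<dots> \<in> span (simple_root ` A)"
      by (intro real_vector.span_neg real_vector.span_sum real_vector.span_scale real_vector.span_base) auto
    finally show "x \<in> span (simple_root ` A)" .
  qed
  show "simple_root ` A \<subseteq> Mov (pr A)"
  proof (rule image_subsetI)
    fix s assume s: "s \<in> A"
    let ?f = "(- 1 / 2) *\<^sub>R simple_root s"
    have "?f \<in> V S" using s orth_S[OF assms] by (intro V_scale simple_root_V) blast
    moreover have "act (pr A) ?f - ?f = simple_root s"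
      using pra_simple[OF assms s] assms by (simp add: pra_scale[OF assms] scaleR_add_left[symmetric])
    ultimately show "simple_root s \<in> Mov (pr A)" using MovI by metis
  qed
qed

end

context folding
begin

subsection \<open>The intertwiner\<close>

text \<open>
  Averaging over the small group produces an equivariant map of the geometric representations. By
  positivity of unfolding, all terms contributing to the coefficients below are positive.
\<close>

lemma exists_intertwiner:
  "\<exists>x. (\<forall>s\<in>S. 0 < x s) \<and> (\<forall>w\<in>carrier W'. \<forall>f\<in>D.V S'.
     U.act (unfld w) (\<lambda>s. if s \<in> S then x s * f (fld s) else 0)
     = (\<lambda>s. if s \<in> S then x s * D.act w f (fld s) else 0))"
proof -
  obtain p \<kappa> where p: "U.perron p \<kappa>" using U.exists_perron by blast
  obtain q \<kappa>' where q: "D.perron q \<kappa>'" using D.exists_perron by blast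
  \<comment> \<open>The average of the rank-one map \<open>f\<close> to \<open>D.bf q f\<close>
    times \<open>p\<close>. Perron vectors are used because their product with a root has the sign
    of the root.\<close>
  define \<Phi> where "\<Phi> f = (\<Sum>u\<in>carrier W'. D.bf (D.act u q) f *\<^sub>R U.act (unfld u) p)" for f
  have lin: "linear \<Phi>"
    by (auto simp: linear_iff \<Phi>_def scaleR_add_left sum.distrib scaleR_sum_right)
  have eqv: "U.act (unfld w) (\<Phi> f) = \<Phi> (D.act w f)" if w: "w \<in> carrier W'" for w f
  proof -
    have "\<Phi> (D.act w f) = (\<Sum>u\<in>carrier W'. D.bf (D.act (w \<otimes>\<^bsub>W'\<^esub> u) q) (D.act w f) *\<^sub>R U.act (unfld (w \<otimes>\<^bsub>W'\<^esub> u)) p)"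
      unfolding \<Phi>_def
      by (rule sum.reindex_bij_witness[of _ "\<lambda>u. w \<otimes>\<^bsub>W'\<^esub> u" "\<lambda>u. inv\<^bsub>W'\<^esub> w \<otimes>\<^bsub>W'\<^esub> u"])
         (use w in \<open>auto simp: D.m_assoc[symmetric]\<close>)
    also have "\<dots> = (\<Sum>u\<in>carrier W'. D.bf (D.act u q) f *\<^sub>R U.act (unfld w) (U.act (unfld u) p))"
      by (rule sum.cong) (use w in auto)
    also have "\<dots> = U.act (unfld w) (\<Phi> f)"
      unfolding \<Phi>_def using w by (simp add: U.act_sum)
    finally show ?thesis by simp
  qed
  define x where "x s = U.bf (\<Phi> (simple_root (fld s))) (simple_root s)" for s
  have pos: "0 < x s" if s: "s \<in> S" for s
  proof -
    define s' where "s' = fld s"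
    have s': "s' \<in> S'" "s \<in> fibre {s'}" using s fld_S by (auto simp: s'_def fibre_def)
    \<comment> \<open>The factors have the signs of a small root and of its unfolded counterpart. If
      the small root is negative, multiplying by \<open>s'\<close> reduces to the positive
      case.\<close>
    have t: "0 < D.bf (D.act u q) (simple_root s') * U.bf (U.act (unfld u) p) (simple_root s)"
      if u: "u \<in> carrier W'" for u
    proof -
      let ?a = "D.act (inv\<^bsub>W'\<^esub> u) (simple_root s')" and ?b = "U.act (unfld (inv\<^bsub>W'\<^esub> u)) (simple_root s)"
      have r: "?a \<in> D.roots" "?b \<in> U.roots" using u s' s by auto
      have e: "D.bf (D.act u q) (simple_root s') = D.bf q ?a" "U.bf (U.act (unfld u) p) (simple_root s) = U.bf p ?b"
        using u by (simp_all add: D.bf_act_left U.bf_act_left)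
      show ?thesis
      proof (cases "?a \<in> D.pos_roots")
        case True
        then have "?b \<in> U.pos_roots" using unfold_positive[OF _ s'(1) True s'(2)] u by simp
        then show ?thesis using True D.perron_root_sign[OF q r(1)] U.perron_root_sign[OF p r(2)] unfolding e
          by (simp del: D.act_inv U.act_inv)
      next
        case False
        have o: "D.orth {s'}" using s' by (simp add: D.orth_def)
        define v where "v = inv\<^bsub>W'\<^esub> u \<otimes>\<^bsub>W'\<^esub> s'"
        have v: "v \<in> carrier W'" using u s' by (simp add: v_def)
        have "D.act v (simple_root s') = - ?a" using u s' by (simp add: v_def)
        then have n1: "D.act v (simple_root s') \<in> D.pos_roots" "- ?a \<in> D.pos_roots"
          using D.roots_cases[OF r(1)] False by auto
        have "U.act (unfld v) (simple_root s) = - ?b"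
          using u s' orth_fibre_single[OF s'(1)] U.pra_simple[OF orth_fibre_single[OF s'(1)] s'(2)]
          by (simp add: v_def unfld_S)
        then have n2: "- ?b \<in> U.pos_roots" using unfold_positive[OF v s'(1) n1(1) s'(2)] by simp
        have "D.bf q ?a < 0" "U.bf p ?b < 0"
          using D.perron_root_sign[OF q, of "- ?a"] U.perron_root_sign[OF p, of "- ?b"] n1(2) n2 r by auto
        then show ?thesis unfolding e by (rule mult_neg_neg)
      qed
    qed
    have "x s = (\<Sum>u\<in>carrier W'. D.bf (D.act u q) (simple_root s') * U.bf (U.act (unfld u) p) (simple_root s))"
      by (simp add: x_def \<Phi>_def s'_def)
    also have "\<dots> > 0" using t D.finite_carrier D.one_closed by (intro sum_pos) auto
    finally show ?thesis .
  qed
  \<comment> \<open>By equivariance the image is negated by \<open>unfld s'\<close>, and the vectors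
    so negated are spanned by the simple roots of the fibre.\<close>
  have simp: "\<Phi> (simple_root s') = (\<Sum>s\<in>fibre {s'}. x s *\<^sub>R simple_root s)" if s': "s' \<in> S'" for s'
  proof -
    let ?F = "\<Phi> (simple_root s')"
    have o: "U.orth (fibre {s'})" using orth_fibre_single s' by blast
    have "U.act (unfld s') ?F = \<Phi> (- simple_root s')" using eqv[of s' "simple_root s'"] s' by simp
    then have "U.pra (fibre {s'}) ?F = - ?F" using s' o linear_neg[OF lin] by (simp add: unfld_S)
    then have "?F + ?F = (\<Sum>s\<in>fibre {s'}. (2 * U.bf ?F (simple_root s)) *\<^sub>R simple_root s)"
      by (simp add: U.pra_def algebra_simps)
    also have "\<dots> = (\<Sum>s\<in>fibre {s'}. 2 *\<^sub>R x s *\<^sub>R simple_root s)"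
      by (rule sum.cong) (auto simp: x_def fibre_def)
    finally have "2 *\<^sub>R ?F = 2 *\<^sub>R (\<Sum>s\<in>fibre {s'}. x s *\<^sub>R simple_root s)"
      by (simp add: scaleR_2[symmetric] scaleR_sum_right)
    then show ?thesis by simp
  qed
  have form: "\<Phi> f = (\<lambda>s. if s \<in> S then x s * f (fld s) else 0)" if f: "f \<in> D.V S'" for f
  proof (rule ext)
    fix t
    have "f = (\<Sum>s'\<in>S'. f s' *\<^sub>R simple_root s')" using D.V_expand f by blast
    then have "\<Phi> f = (\<Sum>s'\<in>S'. f s' *\<^sub>R \<Phi> (simple_root s'))"
      by (metis (no_types, lifting) linear_sum[OF lin] linear_scale[OF lin] sum.cong)
    also have "\<dots> = (\<Sum>s'\<in>S'. f s' *\<^sub>R (\<Sum>s\<in>fibre {s'}. x s *\<^sub>R simple_root s))"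
      by (rule sum.cong) (use simp in auto)
    finally have "\<Phi> f t = (\<Sum>s'\<in>S'. f s' * (\<Sum>s\<in>fibre {s'}. x s * simple_root s t))"
      by (simp add: sum_fun_apply scaleR_fun_apply)
    also have "\<dots> = (\<Sum>s'\<in>S'. if s' = fld t then (if t \<in> S then x t * f (fld t) else 0) else 0)"
    proof (rule sum.cong[OF HOL.refl])
      fix s' assume "s' \<in> S'"
      have "(\<Sum>s\<in>fibre {s'}. x s * simple_root s t) = (\<Sum>s\<in>fibre {s'}. if s = t then x t else 0)"
        by (rule sum.cong) (auto simp: simple_root_apply)
      also have "\<dots> = (if t \<in> fibre {s'} then x t else 0)" by simp
      finally show "f s' * (\<Sum>s\<in>fibre {s'}. x s * simple_root s t) = (if s' = fld t then (if t \<in> S then x t * f (fld t) else 0) else 0)"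
        by (auto simp: fibre_def)
    qed
    also have "\<dots> = (if t \<in> S then x t * f (fld t) else 0)" using fld_S by simp
    finally show "\<Phi> f t = (if t \<in> S then x t * f (fld t) else 0)" .
  qed
  have "U.act (unfld w) (\<lambda>s. if s \<in> S then x s * f (fld s) else 0) = (\<lambda>s. if s \<in> S then x s * D.act w f (fld s) else 0)"
    if "w \<in> carrier W'" "f \<in> D.V S'" for w f
    using eqv[OF that(1), of f] form[OF that(2)] form[OF D.act_V[OF that]] by simp
  then show ?thesis using pos by blast
qed

definition xw :: "'a \<Rightarrow> real" where
  "xw = (SOME x. (\<forall>s\<in>S. 0 < x s) \<and> (\<forall>w\<in>carrier W'. \<forall>f\<in>D.V S'.
     U.act (unfld w) (\<lambda>s. if s \<in> S then x s * f (fld s) else 0)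
     = (\<lambda>s. if s \<in> S then x s * D.act w f (fld s) else 0)))"

definition phi :: "('b \<Rightarrow> real) \<Rightarrow> ('a \<Rightarrow> real)" where
  "phi f = (\<lambda>s. if s \<in> S then xw s * f (fld s) else 0)"

lemma phi_apply: "phi f s = (if s \<in> S then xw s * f (fld s) else 0)"
  by (simp add: phi_def)

lemma xw_pos: "s \<in> S \<Longrightarrow> 0 < xw s"
  using someI_ex[OF exists_intertwiner] unfolding xw_def by auto

lemma phi_act: "w \<in> carrier W' \<Longrightarrow> f \<in> D.V S' \<Longrightarrow> phi (D.act w f) = U.act (unfld w) (phi f)"
  using someI_ex[OF exists_intertwiner] unfolding xw_def[symmetric] phi_def by auto

lemma phi_linear: "linear phi"
  by (auto simp: linear_iff phi_apply fun_eq_iff plus_fun_apply scaleR_fun_apply algebra_simps)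

lemma phi_VS: "phi f \<in> U.V S"
  by (simp add: U.V_def phi_apply)

lemma phi_pra: "D.orth A \<Longrightarrow> f \<in> D.V S' \<Longrightarrow> phi (D.pra A f) = U.pra (fibre A) (phi f)"
  using phi_act[of "D.pr A" f] by (simp add: unfld_pr orth_fibre)

lemma phi_simple:
  assumes "s' \<in> S'"
  shows "phi (simple_root s') = (\<Sum>s\<in>fibre {s'}. xw s *\<^sub>R simple_root s)"
proof (rule ext)
  fix t
  have "(\<Sum>s\<in>fibre {s'}. xw s *\<^sub>R simple_root s) t = (\<Sum>s\<in>fibre {s'}. if s = t then xw t else 0)"
    unfolding sum_fun_apply by (intro sum.cong) (auto simp: simple_root_apply scaleR_fun_apply)
  then show "phi (simple_root s') t = (\<Sum>s\<in>fibre {s'}. xw s *\<^sub>R simple_root s) t"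
    by (auto simp: phi_apply simple_root_apply fibre_def)
qed

lemma phi_eq_0:
  assumes "f \<in> D.V S'" "phi f = 0"
  shows "f = 0"
proof (rule ext)
  fix s'
  show "f s' = 0 s'"
  proof (cases "s' \<in> S'")
    case True
    then obtain s where s: "s \<in> S" "fld s = s'" using fibre_nonempty by (auto simp: fibre_def)
    then show ?thesis using fun_cong[OF assms(2), of s] xw_pos[OF s(1)] by (simp add: phi_apply zero_fun_apply)
  qed (use assms(1) in \<open>simp add: D.V_def zero_fun_apply\<close>)
qed

text \<open>The image of a simple root is a positive combination over its fibre; translating by
  \<open>unfld w\<close> keeps these roots positive by \<open>unfold_positive\<close>.\<close>

lemma phi_pos_root:
  assumes "\<rho> \<in> D.pos_roots"
  shows "phi \<rho> \<in> cone_hull (U.pos_roots \<inter> fibroots \<rho>)"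
proof -
  obtain w s' where w: "w \<in> carrier W'" "s' \<in> S'" "\<rho> = D.act w (simple_root s')"
    using D.rootsE D.pos_roots_roots assms by blast
  have "phi \<rho> = (\<Sum>s\<in>fibre {s'}. xw s *\<^sub>R U.act (unfld w) (simple_root s))"
    using w by (simp add: phi_act D.simple_root_V phi_simple U.act_sum)
  also have "\<dots> \<in> cone_hull (U.pos_roots \<inter> fibroots \<rho>)"
  proof (intro cone_hull_sum cone_hull_scale cone_hull_base IntI)
    fix s assume s: "s \<in> fibre {s'}"
    show "U.act (unfld w) (simple_root s) \<in> U.pos_roots"
      using unfold_positive[OF w(1,2) _ s] assms w(3) by simp
    show "U.act (unfld w) (simple_root s) \<in> fibroots \<rho>"
      using s fibroots_act[of "simple_root s'" w] fibroots_simple[OF w(2)] w by auto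
    show "0 \<le> xw s" using xw_pos[of s] s by (auto simp: fibre_def)
  qed
  finally show ?thesis .
qed

lemma fibroots_roots: "\<tau> \<in> fibroots \<rho> \<Longrightarrow> \<tau> \<in> U.roots"
  by (simp add: fibroots_def)

lemma fibroots_uminus: "\<rho> \<in> D.roots \<Longrightarrow> fibroots (- \<rho>) = fibroots \<rho>"
  by (simp add: fibroots_def)

lemma fibroots_pra:
  assumes "D.orth A" "\<rho> \<in> D.roots" "\<tau> \<in> fibroots \<rho>"
  shows "U.pra (fibre A) \<tau> \<in> fibroots (D.pra A \<rho>)"
proof -
  have "U.act (unfld (D.pr A)) \<tau> \<in> fibroots (D.act (D.pr A) \<rho>)"
    using fibroots_act[OF assms(2), of "D.pr A"] assms by auto
  then show ?thesis using assms(1) by (simp add: unfld_pr orth_fibre)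
qed

text \<open>Rotate until \<open>\<rho>\<close> is simple. Then the hypothesis is a vanishing sum of
  coordinates of \<open>\<sigma>\<close> over a fibre with positive weights. Coordinates of a root
  have one sign, so each of them vanishes.\<close>

lemma eul_phi_fibroots_pos:
  assumes "D.bip A" "\<rho> \<in> D.pos_roots" "\<sigma> \<in> U.roots" "U.eul (fibre A) (phi \<rho>) \<sigma> = 0" "\<tau> \<in> fibroots \<rho>"
  shows "U.eul (fibre A) \<tau> \<sigma> = 0"
proof -
  have "\<rho> \<in> D.roots \<longrightarrow> (\<forall>\<sigma>\<in>U.roots. U.eul (fibre A) (phi \<rho>) \<sigma> = 0 \<longrightarrow> (\<forall>\<tau>\<in>fibroots \<rho>. U.eul (fibre A) \<tau> \<sigma> = 0))"
    using assms(1) order_refl[of S'] insertI1 D.roots_V[OF D.pos_roots_roots[OF assms(2)]]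
      D.pos_roots_nonneg[OF assms(2)] D.roots_ne_0[OF D.pos_roots_roots[OF assms(2)]]
  proof (induction rule: D.rotation_induct)
    case (rotate Q v)
    show ?case
    proof (intro impI ballI)
      fix \<sigma> \<tau> assume v: "v \<in> D.roots" and \<sigma>: "\<sigma> \<in> U.roots" "U.eul (fibre Q) (phi v) \<sigma> = 0" and \<tau>: "\<tau> \<in> fibroots v"
      have QS: "S' \<inter> Q = Q" using D.bipD rotate(2) by blast
      have o: "D.orth Q" using D.bipD rotate(2) by blast
      have b: "U.bip (fibre Q)" using bip_fibre rotate(2) by blast
      have pv: "v \<in> D.pos_roots" using v rotate(4) by (simp add: D.pos_roots_def)
      have SF: "S \<inter> fibre Q = fibre Q" using fibre_S by blast
      have rot: "U.eul (fibre (S' - Q)) (U.pra (fibre Q) f) (U.pra (fibre Q) \<sigma>) = U.eul (fibre Q) f \<sigma>" if "f \<in> U.V S" for f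
        using U.eul_rotate[OF b order_refl that U.roots_V[OF \<sigma>(1)]] by (simp add: SF fibre_diff)
      show "U.eul (fibre Q) \<tau> \<sigma> = 0"
      proof (cases "nonneg (D.pra (S' \<inter> Q) v)")
        case True
        have "U.eul (fibre (S' - Q)) (phi (D.pra Q v)) (U.pra (fibre Q) \<sigma>) = 0"
          using rot[OF phi_VS] \<sigma>(2) phi_pra[OF o rotate(3)] by simp
        then have "U.eul (fibre (S' - Q)) (U.pra (fibre Q) \<tau>) (U.pra (fibre Q) \<sigma>) = 0"
          using rotate(6)[OF True] D.pra_roots[OF o v] U.pra_roots[OF orth_fibre[OF o] \<sigma>(1)] fibroots_pra[OF o v \<tau>]
          unfolding QS by blast
        then show ?thesis using rot[of \<tau>] U.roots_V[OF fibroots_roots[OF \<tau>]] by simp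
      next
        case False
        then obtain s' where s': "s' \<in> Q" "v = simple_root s'"
          using D.not_nonneg_pra_root[OF _ pv] o unfolding QS by blast
        have sS: "s' \<in> S'" using s' D.bipD(1)[OF rotate(2)] by blast
        have fQ: "s \<in> fibre Q" if "s \<in> fibre {s'}" for s using that s' by (auto simp: fibre_def)
        have "U.eul (fibre Q) (phi v) \<sigma> = (\<Sum>s\<in>fibre {s'}. xw s * (\<sigma> s / 2))"
          unfolding s'(2) phi_simple[OF sS]
          by (simp add: linear_sum[OF U.eul_linear_left] U.eul_scale_left)
             (rule sum.cong, use fQ U.eul_simple[OF b] in auto)
        then have z: "(\<Sum>s\<in>fibre {s'}. xw s * \<sigma> s) = 0" using \<sigma>(2) by (simp add: sum_divide_distrib[symmetric])
        have \<sigma>0: "\<sigma> s = 0" if s: "s \<in> fibre {s'}" for s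
        proof -
          have x: "0 < xw t" if "t \<in> fibre {s'}" for t using xw_pos that by (auto simp: fibre_def)
          consider "nonneg \<sigma>" | "nonneg (- \<sigma>)" using U.root_pos_or_neg \<sigma>(1) by blast
          then have "xw s * \<sigma> s = 0"
          proof cases
            case 1
            then have "\<forall>t\<in>fibre {s'}. xw t * \<sigma> t = 0" using z x
              by (subst sum_nonneg_eq_0_iff[symmetric]) (auto simp: nonneg_def less_imp_le)
            then show ?thesis using s by blast
          next
            case 2
            then have "\<forall>t\<in>fibre {s'}. - (xw t * \<sigma> t) = 0" using z x
              by (subst sum_nonneg_eq_0_iff[symmetric])
                 (auto simp: nonneg_def uminus_apply less_imp_le sum_negf mult_nonneg_nonpos)
            then show ?thesis using s by simp
          qed
          then show ?thesis using x[OF s] by simp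
        qed
        have "U.eul (fibre Q) (simple_root s) \<sigma> = 0" if "s \<in> fibre {s'}" for s
          using U.eul_simple[OF b fQ[OF that], of \<sigma>] \<sigma>0[OF that] by simp
        then show ?thesis using \<tau> fibroots_simple[OF sS] s'(2) by auto
      qed
    qed
  qed
  then show ?thesis using assms D.pos_roots_roots by blast
qed

lemma eul_phi_fibroots:
  assumes "D.bip A" "\<rho> \<in> D.roots" "\<sigma> \<in> U.roots" "U.eul (fibre A) (phi \<rho>) \<sigma> = 0" "\<tau> \<in> fibroots \<rho>"
  shows "U.eul (fibre A) \<tau> \<sigma> = 0"
proof (cases "\<rho> \<in> D.pos_roots")
  case False
  then have "- \<rho> \<in> D.pos_roots" using D.roots_cases assms(2) by blast
  moreover have "U.eul (fibre A) (phi (- \<rho>)) \<sigma> = 0" using assms(4) linear_neg[OF phi_linear] by simp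
  moreover have "\<tau> \<in> fibroots (- \<rho>)" using assms(2,5) fibroots_uminus by blast
  ultimately show ?thesis using eul_phi_fibroots_pos assms(1,3) by blast
qed (use assms eul_phi_fibroots_pos in blast)

text \<open>Again by rotation: for simple \<open>\<rho>\<close> the hypothesis is a vanishing
  coordinate of \<open>f\<close>, so \<open>phi f\<close> vanishes on the whole fibre.\<close>

lemma eul_fibroots_phi_pos:
  assumes "D.bip A" "\<rho> \<in> D.pos_roots" "f \<in> D.V S'" "D.eul A \<rho> f = 0" "\<tau> \<in> fibroots \<rho>"
  shows "U.eul (fibre A) \<tau> (phi f) = 0"
proof -
  have "\<rho> \<in> D.roots \<longrightarrow> (\<forall>f\<in>D.V S'. D.eul A \<rho> f = 0 \<longrightarrow> (\<forall>\<tau>\<in>fibroots \<rho>. U.eul (fibre A) \<tau> (phi f) = 0))"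
    using assms(1) order_refl[of S'] insertI1 D.roots_V[OF D.pos_roots_roots[OF assms(2)]]
      D.pos_roots_nonneg[OF assms(2)] D.roots_ne_0[OF D.pos_roots_roots[OF assms(2)]]
  proof (induction rule: D.rotation_induct)
    case (rotate Q v)
    show ?case
    proof (intro impI ballI)
      fix f \<tau> assume v: "v \<in> D.roots" and f: "f \<in> D.V S'" "D.eul Q v f = 0" and \<tau>: "\<tau> \<in> fibroots v"
      have QS: "S' \<inter> Q = Q" using D.bipD rotate(2) by blast
      have o: "D.orth Q" using D.bipD rotate(2) by blast
      have b: "U.bip (fibre Q)" using bip_fibre rotate(2) by blast
      have pv: "v \<in> D.pos_roots" using v rotate(4) by (simp add: D.pos_roots_def)
      have SF: "S \<inter> fibre Q = fibre Q" using fibre_S by blast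
      show "U.eul (fibre Q) \<tau> (phi f) = 0"
      proof (cases "nonneg (D.pra (S' \<inter> Q) v)")
        case True
        have "D.eul (S' - Q) (D.pra Q v) (D.pra Q f) = 0"
          using D.eul_rotate[OF rotate(2) order_refl rotate(3) f(1)] f(2) by (simp add: QS)
        moreover have "D.pra Q f \<in> D.V S'" using D.pra_V[OF o _ f(1)] D.bipD(1)[OF rotate(2)] by blast
        ultimately have "U.eul (fibre (S' - Q)) (U.pra (fibre Q) \<tau>) (phi (D.pra Q f)) = 0"
          using rotate(6)[OF True] D.pra_roots[OF o v] fibroots_pra[OF o v \<tau>] unfolding QS by blast
        then show ?thesis
          using U.eul_rotate[OF b order_refl U.roots_V[OF fibroots_roots[OF \<tau>]] phi_VS[of f]] phi_pra[OF o f(1)]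
          by (simp add: SF fibre_diff)
      next
        case False
        then obtain s' where s': "s' \<in> Q" "v = simple_root s'"
          using D.not_nonneg_pra_root[OF _ pv] o unfolding QS by blast
        have sS: "s' \<in> S'" using s' D.bipD(1)[OF rotate(2)] by blast
        have "f s' = 0" using D.eul_simple[OF rotate(2) s'(1), of f] f(2) s'(2) by simp
        then have "U.eul (fibre Q) (simple_root s) (phi f) = 0" if "s \<in> fibre {s'}" for s
          using U.eul_simple[OF b, of s "phi f"] that s'(1) by (auto simp: fibre_def phi_apply)
        then show ?thesis using \<tau> fibroots_simple[OF sS] s'(2) by auto
      qed
    qed
  qed
  then show ?thesis using assms D.pos_roots_roots by blast
qed

lemma eul_fibroots_phi:
  assumes "D.bip A" "\<rho> \<in> D.roots" "f \<in> D.V S'" "D.eul A \<rho> f = 0" "\<tau> \<in> fibroots \<rho>"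
  shows "U.eul (fibre A) \<tau> (phi f) = 0"
proof (cases "\<rho> \<in> D.pos_roots")
  case False
  then have "- \<rho> \<in> D.pos_roots" using D.roots_cases assms(2) by blast
  moreover have "\<tau> \<in> fibroots (- \<rho>)" using assms(2,5) fibroots_uminus by blast
  ultimately show ?thesis using eul_fibroots_phi_pos[OF assms(1) _ assms(3)] assms(4) by simp
qed (use assms eul_fibroots_phi_pos in blast)

lemma eul_fibroots_fibroots:
  assumes "D.bip A" "\<rho> \<in> D.roots" "\<sigma> \<in> D.roots" "D.eul A \<rho> \<sigma> = 0" "a \<in> fibroots \<rho>" "b \<in> fibroots \<sigma>"
  shows "U.eul (fibre A) a b = 0"
proof -
  have bA: "U.bip (fibre A)" using bip_fibre assms(1) by blast
  have "U.eul (fibre A) a (phi \<sigma>) = 0"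
    by (rule eul_fibroots_phi[OF assms(1,2) D.roots_V[OF assms(3)] assms(4,5)])
  then have "U.eul (fibre (S' - A)) (phi \<sigma>) a = 0" using U.eul_flip[OF bA, of a] by (simp add: fibre_diff)
  then have "U.eul (fibre (S' - A)) b a = 0"
    by (rule eul_phi_fibroots[OF D.bip_compl[OF assms(1)] assms(3) fibroots_roots[OF assms(5)] _ assms(6)])
  then show ?thesis using U.eul_flip[OF bA, of a] by (simp add: fibre_diff)
qed

subsection \<open>Unfolding noncrossing elements\<close>

lemma Mov_unfold_rt:
  assumes "\<rho> \<in> D.roots"
  shows "U.Mov (unfld (D.rt \<rho>)) \<subseteq> span (fibroots \<rho>)"
proof -
  obtain w s' where w: "w \<in> carrier W'" "s' \<in> S'" "\<rho> = D.act w (simple_root s')"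
    using D.rootsE assms by blast
  have o: "U.orth (fibre {s'})" using orth_fibre_single w by blast
  have "unfld (D.rt \<rho>) = unfld w \<otimes>\<^bsub>W\<^esub> U.pr (fibre {s'}) \<otimes>\<^bsub>W\<^esub> inv\<^bsub>W\<^esub> (unfld w)"
    using w by (simp add: D.rt_act unfld_S o)
  then have "U.Mov (unfld (D.rt \<rho>)) = U.act (unfld w) ` U.Mov (U.pr (fibre {s'}))"
    using U.Mov_conj w o by simp
  also have "\<dots> \<subseteq> U.act (unfld w) ` span (simple_root ` fibre {s'})"
    using U.Mov_pr(1)[OF o] by (rule image_mono)
  also have "\<dots> = span (U.act (unfld w) ` simple_root ` fibre {s'})"
    using linear_span_image[OF U.act_linear] w by simp
  also have "\<dots> \<subseteq> span (fibroots \<rho>)"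
    using fibroots_act[of "simple_root s'" w] fibroots_simple[OF w(2)] w
    by (intro real_vector.span_mono) auto
  finally show ?thesis .
qed

text \<open>Factor \<open>w\<close> into reflections with roots in \<open>Mov w\<close>; each
  unfolded reflection moves only the span of its \<open>fibroots\<close>.\<close>

lemma Mov_unfold_subset:
  assumes "w \<in> carrier W'" "subspace A" "\<And>\<rho>. \<rho> \<in> D.roots \<Longrightarrow> \<rho> \<in> D.Mov w \<Longrightarrow> fibroots \<rho> \<subseteq> A"
  shows "U.Mov (unfld w) \<subseteq> A"
proof -
  obtain rs where rs: "set rs \<subseteq> D.roots \<inter> D.Mov w" "D.wp (map D.rt rs) = w"
    using D.root_factorization assms(1) by blast
  have c: "D.wp (map D.rt rs) \<in> carrier W'" if "set rs \<subseteq> D.roots" for rs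
    using that by (intro D.reflection_word_closed) auto
  have "set rs \<subseteq> D.roots \<inter> D.Mov w \<Longrightarrow> U.Mov (unfld (D.wp (map D.rt rs))) \<subseteq> A" for rs
  proof (induction rs)
    case Nil
    then show ?case using real_vector.subspace_0[OF assms(2)] by simp
  next
    case (Cons \<rho> rs)
    have r: "\<rho> \<in> D.roots" "set rs \<subseteq> D.roots" "fibroots \<rho> \<subseteq> A" using Cons.prems assms(3) by auto
    have "unfld (D.wp (map D.rt (\<rho> # rs))) = unfld (D.rt \<rho>) \<otimes>\<^bsub>W\<^esub> unfld (D.wp (map D.rt rs))"
      using r c by simp
    moreover have "U.Mov (unfld (D.rt \<rho>)) \<subseteq> A"
      using Mov_unfold_rt[OF r(1)] real_vector.span_minimal[OF r(3) assms(2)] by blast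
    ultimately show ?case using Cons r c
      by (simp only:) (rule U.Mov_mult_subset[OF _ _ assms(2)], auto)
  qed
  then show ?thesis using rs by blast
qed

lemma phi_Mov:
  assumes "w \<in> carrier W'" "f \<in> D.Mov w"
  shows "phi f \<in> U.Mov (unfld w)"
proof -
  obtain g where g: "g \<in> D.V S'" "f = D.act w g - g" using assms by (auto simp: D.Mov_def)
  then have "phi f = U.act (unfld w) (phi g) - phi g"
    using phi_act[OF assms(1) g(1)] linear_diff[OF phi_linear] by simp
  then show ?thesis using U.MovI phi_VS by metis
qed

lemma eul_span_zero:
  assumes "U.bip Q" "\<And>a b. a \<in> X \<Longrightarrow> b \<in> Y \<Longrightarrow> U.eul Q a b = 0" "x \<in> span X" "y \<in> span Y"
  shows "U.eul Q x y = 0"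
proof -
  have 1: "U.eul Q x b = 0" if "b \<in> Y" for b
  proof -
    have "subspace {x. U.eul Q x b = 0}"
      by (simp add: real_vector.subspace_def U.eul_add_left U.eul_scale_left)
    then have "span X \<subseteq> {x. U.eul Q x b = 0}" using assms(2) that by (intro real_vector.span_minimal) auto
    then show ?thesis using assms(3) by blast
  qed
  have "subspace {y. U.eul Q x y = 0}"
    by (simp add: real_vector.subspace_def U.eul_add_right U.eul_scale_right assms(1))
  then have "span Y \<subseteq> {y. U.eul Q x y = 0}" using 1 by (intro real_vector.span_minimal) auto
  then show ?thesis using assms(4) by blast
qed

text \<open>The roots over \<open>Mov x\<close> and those over the moved space of its complement
  \<open>z\<close> are annihilated by \<open>E\<close>, so their spans are independent and the
  dimensions sum to at most \<open>card S\<close>. The ranks of the unfolded factors sum to at least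
  \<open>card S\<close>, since their product is the Coxeter element. Hence equality holds
  throughout.\<close>

lemma noncrossing_unfold:
  assumes "D.noncrossing P' x"
  shows "U.noncrossing (fibre P') (unfld x)"
    and "\<And>\<rho>. \<rho> \<in> D.roots \<Longrightarrow> \<rho> \<in> D.Mov x \<Longrightarrow> fibroots \<rho> \<subseteq> U.Mov (unfld x)"
proof -
  let ?P = "fibre P'"
  have bP: "U.bip ?P" using bip_fibre bip' by blast
  have x: "x \<in> carrier W'" using assms by (simp add: D.noncrossing_def)
  define z where "z = D.cox P' S' \<otimes>\<^bsub>W'\<^esub> inv\<^bsub>W'\<^esub> x"
  have z: "z \<in> carrier W'" using x bip' by (simp add: z_def)
  define X where "X = (\<Union>\<rho>\<in>D.roots \<inter> D.Mov x. fibroots \<rho>)"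
  define Z where "Z = (\<Union>\<rho>\<in>D.roots \<inter> D.Mov z. fibroots \<rho>)"
  have XV: "span X \<subseteq> U.V S" "span Z \<subseteq> U.V S"
    unfolding X_def Z_def using fibroots_roots U.roots_V
    by (intro real_vector.span_minimal U.V_subspace; blast)+
  have fd: "fin_dim (span X)" "fin_dim (span Z)" using XV U.fin_dim_VS fin_dim_subset by blast+
  have MX: "U.Mov (unfld x) \<subseteq> span X"
    by (rule Mov_unfold_subset[OF x real_vector.subspace_span])
       (auto simp: X_def intro!: real_vector.span_base)
  have MZ: "U.Mov (unfld z) \<subseteq> span Z"
    by (rule Mov_unfold_subset[OF z real_vector.subspace_span])
       (auto simp: Z_def intro!: real_vector.span_base)
  have gen: "U.eul ?P a b = 0" if "a \<in> Z" "b \<in> X" for a b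
  proof -
    from that(1) obtain \<rho> where \<rho>: "\<rho> \<in> D.roots" "\<rho> \<in> D.Mov z" "a \<in> fibroots \<rho>" unfolding Z_def by (elim UN_E IntE)
    from that(2) obtain \<sigma> where \<sigma>: "\<sigma> \<in> D.roots" "\<sigma> \<in> D.Mov x" "b \<in> fibroots \<sigma>" unfolding X_def by (elim UN_E IntE)
    note r = \<rho> \<sigma>
    have "D.eul P' \<rho> \<sigma> = 0"
      using D.Mov_right_annihilator[OF bip' assms] r(2,5) by (simp add: z_def)
    then show ?thesis using eul_fibroots_fibroots[OF bip' r(1,4) _ r(3,6)] by blast
  qed
  have "span Z \<inter> span X \<subseteq> {0}"
  proof (rule subsetI)
    fix v assume v: "v \<in> span Z \<inter> span X"
    then have "U.eul ?P v v = 0" using eul_span_zero[OF bP gen] by blast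
    moreover have "v \<in> U.V S" using v XV by blast
    ultimately show "v \<in> {0}" using U.eul_self[OF bP] U.bf_self_eq_0 by simp
  qed
  then have le: "dim (span Z) + dim (span X) \<le> dim (U.V S)"
    using XV by (intro dim_direct_le U.fin_dim_VS) (auto intro: real_vector.subspace_span)
  have rx: "U.rk (unfld x) \<le> dim (span X)" unfolding U.rk_def using MX fd(1) by (rule dim_mono_fin)
  have rz: "U.rk (unfld z) \<le> dim (span Z)" unfolding U.rk_def using MZ fd(2) by (rule dim_mono_fin)
  have uz: "unfld z = U.cox ?P S \<otimes>\<^bsub>W\<^esub> inv\<^bsub>W\<^esub> (unfld x)"
    using x bip' unfld_cox[OF bip' order_refl] by (simp add: z_def)
  have "U.cox ?P S = unfld z \<otimes>\<^bsub>W\<^esub> unfld x"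
    unfolding uz using x bP by (simp add: U.m_assoc)
  then have "card S \<le> U.rk (unfld z) + U.rk (unfld x)"
    using U.rk_mult[of "unfld z" "unfld x"] U.rk_cox[OF bP order_refl] x z by simp
  then have eq: "U.rk (unfld z) + U.rk (unfld x) = card S" "U.rk (unfld x) = dim (span X)"
    using le rx rz U.dim_V[of S] by auto
  show "U.noncrossing ?P (unfld x)" using eq(1) x by (simp add: U.noncrossing_def uz)
  have "U.Mov (unfld x) = span X"
    by (rule subspace_eq_of_dim[OF U.Mov_subspace MX fd(1)]) (use eq(2) x in \<open>auto simp: U.rk_def\<close>)
  then show "fibroots \<rho> \<subseteq> U.Mov (unfld x)" if "\<rho> \<in> D.roots" "\<rho> \<in> D.Mov x" for \<rho>
    using that by (auto simp: X_def intro!: real_vector.span_base)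
qed

subsection \<open>Decomposition of positive vectors\<close>

text \<open>\<open>x\<close> is noncrossing in the parabolic subgroup of \<open>J\<close>, where an
  inequality of ranks is enough by subadditivity, and moves \<open>v\<close>. The last clause
  carries the minimality of the unfolded \<open>x\<close> through the recursion, for all test roots
  \<open>\<sigma>\<close> at once.\<close>

definition dec :: "'b set \<Rightarrow> 'b set \<Rightarrow> ('b \<Rightarrow> real) \<Rightarrow> 'b \<Rightarrow> bool" where
  "dec Q J v x \<longleftrightarrow> x \<in> carrier W' \<and> D.rk (D.cox Q J \<otimes>\<^bsub>W'\<^esub> inv\<^bsub>W'\<^esub> x) + D.rk x \<le> card J \<and> v \<in> D.Mov x \<and>
     U.Mov (unfld x) \<subseteq> U.V (fibre J) \<and>
     (\<forall>\<sigma>\<in>U.roots \<inter> U.V (fibre J).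
        phi v \<in> cone_hull {\<rho> \<in> U.pos_roots \<inter> U.V (fibre J). U.eul (fibre Q) \<rho> \<sigma> = 0} \<longrightarrow>
        (\<forall>\<eta>\<in>U.Mov (unfld x). U.eul (fibre Q) \<eta> \<sigma> = 0))"

lemma dec_eul:
  assumes "dec Q J v x" "\<sigma> \<in> U.roots" "\<sigma> \<in> U.V (fibre J)"
    "phi v \<in> cone_hull {\<rho> \<in> U.pos_roots \<inter> U.V (fibre J). U.eul (fibre Q) \<rho> \<sigma> = 0}" "\<eta> \<in> U.Mov (unfld x)"
  shows "U.eul (fibre Q) \<eta> \<sigma> = 0"
  using assms unfolding dec_def by blast

lemma dec_zero:
  assumes "D.bip Q" "J \<subseteq> S'"
  shows "dec Q J 0 \<one>\<^bsub>W'\<^esub>"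
  using assms D.rk_cox[OF assms] bip_fibre[OF assms(1)] by (simp add: dec_def)

text \<open>Conjugation by the first half of \<open>J\<close> exchanges the order of the halves and
  preserves ranks. \<open>phi\<close> has positive weights, so the image of \<open>v\<close> remains
  nonnegative as well and \<open>cone_rotate\<close> transports the test clause.\<close>

lemma dec_rotate:
  assumes Q: "D.bip Q" and J: "J \<subseteq> S'" and v: "v \<in> D.V J"
    and nn: "nonneg (D.pra (J \<inter> Q) v)" and x: "dec (S' - Q) J (D.pra (J \<inter> Q) v) x"
  shows "dec Q J v (D.pr (J \<inter> Q) \<otimes>\<^bsub>W'\<^esub> x \<otimes>\<^bsub>W'\<^esub> D.pr (J \<inter> Q))"
proof -
  let ?c = "D.pr (J \<inter> Q)" and ?F = "fibre J" and ?R = "fibre Q"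
  let ?x = "?c \<otimes>\<^bsub>W'\<^esub> x \<otimes>\<^bsub>W'\<^esub> ?c"
  have o: "D.orth (J \<inter> Q)" using D.bip_orth Q J by blast
  have c: "?c \<in> carrier W'" "inv\<^bsub>W'\<^esub> ?c = ?c" using o by auto
  have bR: "U.bip ?R" using bip_fibre Q by blast
  have FS: "?F \<subseteq> S" by (rule fibre_S)
  have FR: "fibre (J \<inter> Q) = ?F \<inter> ?R" by (rule fibre_Int)
  have oU: "U.orth (?F \<inter> ?R)" using orth_fibre[OF o] by (simp add: FR)
  have xc: "x \<in> carrier W'" using x by (simp add: dec_def)
  have b: "D.bip (S' - Q)" using D.bip_compl Q by blast
  have mx: "?x = ?c \<otimes>\<^bsub>W'\<^esub> x \<otimes>\<^bsub>W'\<^esub> inv\<^bsub>W'\<^esub> ?c" using c by simp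
  have r1: "D.rk ?x = D.rk x" unfolding mx by (rule D.rk_conj[OF xc c(1)])
  have "D.cox Q J \<otimes>\<^bsub>W'\<^esub> inv\<^bsub>W'\<^esub> ?x = ?c \<otimes>\<^bsub>W'\<^esub> (D.cox (S' - Q) J \<otimes>\<^bsub>W'\<^esub> inv\<^bsub>W'\<^esub> x) \<otimes>\<^bsub>W'\<^esub> inv\<^bsub>W'\<^esub> ?c"
  proof -
    have cc: "?c \<otimes>\<^bsub>W'\<^esub> (?c \<otimes>\<^bsub>W'\<^esub> y) = y" if "y \<in> carrier W'" for y
      using that c(1) o by (simp add: D.m_assoc[symmetric])
    show ?thesis unfolding D.cox_rotate[OF Q J, symmetric]
      using c xc b J cc by (simp add: D.inv_mult_group D.m_assoc)
  qed
  then have r2: "D.rk (D.cox Q J \<otimes>\<^bsub>W'\<^esub> inv\<^bsub>W'\<^esub> ?x) = D.rk (D.cox (S' - Q) J \<otimes>\<^bsub>W'\<^esub> inv\<^bsub>W'\<^esub> x)"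
    using D.rk_conj[of "D.cox (S' - Q) J \<otimes>\<^bsub>W'\<^esub> inv\<^bsub>W'\<^esub> x" ?c] c xc b J by simp
  have vM: "v \<in> D.Mov ?x"
  proof -
    have "D.act ?c (D.pra (J \<inter> Q) v) \<in> D.act ?c ` D.Mov x" using x by (auto simp: dec_def)
    then show ?thesis unfolding mx D.Mov_conj[OF xc c(1)] using o D.pra_pra[OF o] by simp
  qed
  have uc: "unfld ?x = U.pr (?F \<inter> ?R) \<otimes>\<^bsub>W\<^esub> unfld x \<otimes>\<^bsub>W\<^esub> inv\<^bsub>W\<^esub> (U.pr (?F \<inter> ?R))"
    using c xc oU by (simp add: unfld_pr[OF o] FR)
  have UM: "U.Mov (unfld ?x) = U.pra (?F \<inter> ?R) ` U.Mov (unfld x)"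
    unfolding uc using U.Mov_conj[of "unfld x" "U.pr (?F \<inter> ?R)"] xc oU by (auto simp: image_def)
  have UV: "U.Mov (unfld ?x) \<subseteq> U.V ?F"
    unfolding UM using x U.pra_V[OF oU] by (auto simp: dec_def)
  have "U.eul ?R \<eta> \<sigma> = 0"
    if \<sigma>: "\<sigma> \<in> U.roots" "\<sigma> \<in> U.V ?F" and ph: "phi v \<in> cone_hull {\<rho> \<in> U.pos_roots \<inter> U.V ?F. U.eul ?R \<rho> \<sigma> = 0}"
      and \<eta>: "\<eta> \<in> U.Mov (unfld ?x)" for \<sigma> \<eta>
  proof -
    have vS: "v \<in> D.V S'" using v D.V_mono J by blast
    have pv: "phi (D.pra (J \<inter> Q) v) = U.pra (?F \<inter> ?R) (phi v)" using phi_pra[OF o vS] by (simp add: FR)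
    have nn': "nonneg (U.pra (?F \<inter> ?R) (phi v))"
      using nn xw_pos unfolding pv[symmetric] nonneg_def by (auto simp: phi_apply less_imp_le)
    have "phi (D.pra (J \<inter> Q) v) \<in> cone_hull {\<rho> \<in> U.pos_roots \<inter> U.V ?F. U.eul (fibre (S' - Q)) \<rho> (U.pra (?F \<inter> ?R) \<sigma>) = 0}"
      unfolding pv using U.cone_rotate[OF bR FS \<sigma> ph nn'] by (simp add: fibre_diff)
    moreover have "U.pra (?F \<inter> ?R) \<sigma> \<in> U.roots \<inter> U.V ?F" using U.pra_roots[OF oU \<sigma>(1)] U.pra_V[OF oU _ \<sigma>(2)] by blast
    ultimately have all: "U.eul (fibre (S' - Q)) \<zeta> (U.pra (?F \<inter> ?R) \<sigma>) = 0" if "\<zeta> \<in> U.Mov (unfld x)" for \<zeta>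
      using dec_eul[OF x] that by blast
    obtain \<eta>1 where e1: "\<eta>1 \<in> U.Mov (unfld x)" "\<eta> = U.pra (?F \<inter> ?R) \<eta>1" using \<eta> UM by auto
    have "U.eul ?R \<eta> \<sigma> = U.eul (S - ?R) (U.pra (?F \<inter> ?R) \<eta>) (U.pra (?F \<inter> ?R) \<sigma>)"
      using U.eul_rotate[OF bR FS _ \<sigma>(2), of \<eta>] \<eta> UV by auto
    also have "U.pra (?F \<inter> ?R) \<eta> = \<eta>1" using e1(2) U.pra_pra[OF oU] by simp
    finally show ?thesis using all[OF e1(1)] by (simp add: fibre_diff)
  qed
  then show ?thesis using r1 r2 x vM UV c xc by (auto simp: dec_def)
qed

text \<open>\<open>pr N\<close> splits off the Coxeter element of \<open>J\<close> on the left and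
  moves the coordinates of \<open>v\<close> in \<open>N\<close>, while \<open>x\<close> moves the
  rest. The image of \<open>v\<close> is negative on the whole fibre of \<open>N\<close>, which is
  what \<open>cone_strip\<close> asks for.\<close>

lemma dec_strip:
  assumes Q: "D.bip Q" and J: "J \<subseteq> S'" and v: "v \<in> D.V J" and N: "N \<subseteq> J \<inter> Q"
    and neg: "\<And>s. s \<in> N \<Longrightarrow> D.pra (J \<inter> Q) v s < 0" and x: "dec Q (J - N) (D.restr (J - N) v) x"
  shows "dec Q J v (D.pr N \<otimes>\<^bsub>W'\<^esub> x)"
proof -
  let ?F = "fibre J" and ?R = "fibre Q" and ?M = "fibre N" and ?x = "D.pr N \<otimes>\<^bsub>W'\<^esub> x"
  have oJ: "D.orth (J \<inter> Q)" using D.bip_orth Q J by blast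
  have o: "D.orth N" using D.orth_subset[OF oJ N] .
  have oU: "U.orth ?M" using orth_fibre o by blast
  have bR: "U.bip ?R" using bip_fibre Q by blast
  have FS: "?F \<subseteq> S" by (rule fibre_S)
  have MF: "?M \<subseteq> ?F \<inter> ?R" using fibre_mono[OF N] by (simp add: fibre_Int)
  have JN: "J - N \<subseteq> S'" using J by blast
  have fin: "finite J" "finite N" using J D.finite_S finite_subset D.orth_finite[OF o] by blast+
  have xc: "x \<in> carrier W'" "D.pr N \<in> carrier W'" using x o by (auto simp: dec_def)
  have cards: "card J = card N + card (J - N)"
    using card_Diff_subset[OF fin(2), of J] card_mono[OF fin(1), of N] N by auto
  have cox: "D.cox Q J = D.pr N \<otimes>\<^bsub>W'\<^esub> D.cox Q (J - N)"
  proof -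
    have "J \<inter> Q = N \<union> ((J - N) \<inter> Q)" "J - Q = J - N - Q" using N by auto
    then have "D.pr (J \<inter> Q) = D.pr N \<otimes>\<^bsub>W'\<^esub> D.pr ((J - N) \<inter> Q)" "D.pr (J - Q) = D.pr (J - N - Q)"
      using D.pr_Un[of N "(J - N) \<inter> Q"] oJ by auto
    then show ?thesis using D.bip_orth[OF Q JN] xc by (simp add: D.cox_def D.m_assoc)
  qed
  have cJ: "D.cox Q (J - N) \<in> carrier W'" using Q JN by simp
  have e: "D.cox Q J \<otimes>\<^bsub>W'\<^esub> inv\<^bsub>W'\<^esub> ?x = D.pr N \<otimes>\<^bsub>W'\<^esub> (D.cox Q (J - N) \<otimes>\<^bsub>W'\<^esub> inv\<^bsub>W'\<^esub> x) \<otimes>\<^bsub>W'\<^esub> inv\<^bsub>W'\<^esub> (D.pr N)"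
    unfolding cox using xc cJ by (simp only: D.inv_mult_group D.m_assoc D.inv_closed D.m_closed)
  have r2: "D.rk (D.cox Q J \<otimes>\<^bsub>W'\<^esub> inv\<^bsub>W'\<^esub> ?x) = D.rk (D.cox Q (J - N) \<otimes>\<^bsub>W'\<^esub> inv\<^bsub>W'\<^esub> x)"
    unfolding e using xc cJ by (intro D.rk_conj) auto
  have rx: "D.rk (D.cox Q (J - N) \<otimes>\<^bsub>W'\<^esub> inv\<^bsub>W'\<^esub> x) + D.rk x \<le> card (J - N)" using x by (simp add: dec_def)
  have rN: "D.rk (D.pr N) \<le> card N"
  proof -
    have "D.rk (D.pr N) \<le> card (simple_root ` N)"
      unfolding D.rk_def using D.Mov_pr(1)[OF o] fin(2) by (intro real_vector.dim_le_card) auto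
    then show ?thesis using card_image_le[OF fin(2), of simple_root] by linarith
  qed
  have rm: "D.rk ?x \<le> D.rk (D.pr N) + D.rk x" using D.rk_mult xc by blast
  have "card J \<le> D.rk (D.cox Q J \<otimes>\<^bsub>W'\<^esub> inv\<^bsub>W'\<^esub> ?x) + D.rk ?x"
  proof -
    have "D.cox Q J = (D.cox Q J \<otimes>\<^bsub>W'\<^esub> inv\<^bsub>W'\<^esub> ?x) \<otimes>\<^bsub>W'\<^esub> ?x" using Q J xc by (simp add: D.m_assoc)
    then show ?thesis using D.rk_mult[of "D.cox Q J \<otimes>\<^bsub>W'\<^esub> inv\<^bsub>W'\<^esub> ?x" ?x] D.rk_cox[OF Q J] Q J xc by simp
  qed
  then have add: "D.rk ?x = D.rk (D.pr N) + D.rk x" using r2 rx rN rm cards by linarith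
  have sub: "D.Mov (D.pr N) \<subseteq> D.Mov ?x" "D.Mov x \<subseteq> D.Mov ?x"
    using D.rk_add_Mov[OF xc(2,1) add] by auto
  have vM: "v \<in> D.Mov ?x"
  proof -
    have ve: "v = (\<Sum>s\<in>N. v s *\<^sub>R simple_root s) + D.restr (J - N) v"
    proof (rule ext)
      fix t
      have "(\<Sum>s\<in>N. v s *\<^sub>R simple_root s) t = (\<Sum>s\<in>N. if s = t then v t else 0)"
        unfolding sum_fun_apply by (intro sum.cong) (auto simp: simple_root_apply scaleR_fun_apply)
      then show "v t = ((\<Sum>s\<in>N. v s *\<^sub>R simple_root s) + D.restr (J - N) v) t"
        using fin(2) N v by (auto simp: plus_fun_apply D.restr_apply D.V_def)
    qed
    have sM: "subspace (D.Mov ?x)" using D.Mov_subspace xc by simp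
    have "(\<Sum>s\<in>N. v s *\<^sub>R simple_root s) \<in> D.Mov ?x"
      by (intro real_vector.subspace_sum[OF sM] real_vector.subspace_scale[OF sM])
         (use D.Mov_pr(2)[OF o] sub(1) in blast)
    moreover have "D.restr (J - N) v \<in> D.Mov ?x" using x sub(2) by (auto simp: dec_def)
    ultimately show ?thesis using ve real_vector.subspace_add[OF sM] by metis
  qed
  have ux: "unfld ?x = U.pr ?M \<otimes>\<^bsub>W\<^esub> unfld x" using xc o by (simp add: unfld_pr)
  have Ux: "U.Mov (unfld x) \<subseteq> U.V (?F - ?M)" using x by (simp add: dec_def fibre_diff)
  have UV: "U.Mov (unfld ?x) \<subseteq> U.V ?F"
    unfolding ux
  proof (rule U.Mov_mult_subset[OF _ _ U.V_subspace])
    have "span (simple_root ` ?M) \<subseteq> U.V ?F"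
      using MF U.simple_root_V by (intro real_vector.span_minimal[OF _ U.V_subspace]) blast
    then show "U.Mov (U.pr ?M) \<subseteq> U.V ?F" using U.Mov_pr(1)[OF oU] by blast
    show "U.Mov (unfld x) \<subseteq> U.V ?F" using Ux U.V_mono[of "?F - ?M" ?F] by blast
  qed (use xc oU in auto)
  have "U.Mov (unfld ?x) \<subseteq> {\<eta>. U.eul ?R \<eta> \<sigma> = 0}"
    if \<sigma>: "\<sigma> \<in> U.roots" "\<sigma> \<in> U.V ?F" and ph: "phi v \<in> cone_hull {\<rho> \<in> U.pos_roots \<inter> U.V ?F. U.eul ?R \<rho> \<sigma> = 0}" for \<sigma>
  proof -
    have vS: "v \<in> D.V S'" using v D.V_mono J by blast
    have pv: "phi (D.pra (J \<inter> Q) v) = U.pra (?F \<inter> ?R) (phi v)" using phi_pra[OF oJ vS] by (simp add: fibre_Int)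
    have neg': "U.pra (?F \<inter> ?R) (phi v) s < 0" if s: "s \<in> ?M" for s
    proof -
      have "s \<in> S" "fld s \<in> N" using s by (auto simp: fibre_def)
      then show ?thesis unfolding pv[symmetric] phi_apply using neg xw_pos by (simp add: mult_pos_neg)
    qed
    note st = U.cone_strip[OF bR FS MF \<sigma> ph neg']
    have re: "U.restr (?F - ?M) (phi v) = phi (D.restr (J - N) v)"
      by (rule ext) (auto simp: U.restr_apply D.restr_apply phi_apply fibre_def)
    have "U.eul ?R \<eta> \<sigma> = 0" if "\<eta> \<in> U.Mov (unfld x)" for \<eta>
      by (rule dec_eul[OF x \<sigma>(1) _ _ that]) (use st in \<open>simp_all only: re fibre_diff\<close>)
    then have all: "\<forall>\<eta>\<in>U.Mov (unfld x). U.eul ?R \<eta> \<sigma> = 0" by blast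
    have subs: "subspace {\<eta>. U.eul ?R \<eta> \<sigma> = 0}"
      by (simp add: real_vector.subspace_def U.eul_add_left U.eul_scale_left)
    show ?thesis unfolding ux
    proof (rule U.Mov_mult_subset[OF _ _ subs])
      have "U.eul ?R (simple_root s) \<sigma> = 0" if "s \<in> ?M" for s
      proof -
        have "s \<in> ?R" using that MF by blast
        moreover have "\<sigma> s = 0" using st(1) that by (auto simp: U.V_def)
        ultimately show ?thesis using U.eul_simple[OF bR, of s \<sigma>] by simp
      qed
      then have "span (simple_root ` ?M) \<subseteq> {\<eta>. U.eul ?R \<eta> \<sigma> = 0}"
        by (intro real_vector.span_minimal[OF _ subs]) auto
      then show "U.Mov (U.pr ?M) \<subseteq> {\<eta>. U.eul ?R \<eta> \<sigma> = 0}" using U.Mov_pr(1)[OF oU] by blast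
      show "U.Mov (unfld x) \<subseteq> {\<eta>. U.eul ?R \<eta> \<sigma> = 0}" using all by auto
    qed (use xc oU in auto)
  qed
  then have "\<forall>\<sigma>\<in>U.roots \<inter> U.V ?F. phi v \<in> cone_hull {\<rho> \<in> U.pos_roots \<inter> U.V ?F. U.eul ?R \<rho> \<sigma> = 0} \<longrightarrow>
      (\<forall>\<eta>\<in>U.Mov (unfld ?x). U.eul ?R \<eta> \<sigma> = 0)" by auto
  moreover have "D.rk (D.cox Q J \<otimes>\<^bsub>W'\<^esub> inv\<^bsub>W'\<^esub> ?x) + D.rk ?x \<le> card J" using r2 add rx rN cards by linarith
  moreover have "?x \<in> carrier W'" using xc by simp
  ultimately show ?thesis unfolding dec_def using vM UV by blast
qed

text \<open>Stripping makes \<open>J\<close> smaller, and between two strippings rotation ends by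
  \<open>rotation_induct\<close>.\<close>

lemma dec_exists:
  assumes "D.bip Q" "J \<subseteq> S'" "v \<in> D.V J" "nonneg v"
  shows "\<exists>x. dec Q J v x"
  using assms
proof (induction "card J" arbitrary: J Q v rule: less_induct)
  case (less J Q v)
  show ?case
  proof (cases "v = 0")
    case True
    then show ?thesis using dec_zero less.prems by blast
  next
    case False
    from less.prems(1,2) insertI1 less.prems(3,4) False show ?thesis
    proof (induction rule: D.rotation_induct)
      case (rotate Q v)
      let ?N = "{s \<in> J \<inter> Q. D.pra (J \<inter> Q) v s < 0}"
      have fin: "finite J" using less.prems(2) D.finite_S finite_subset by blast
      show ?case
      proof (cases "?N = {}")
        case True
        have "nonneg (D.pra (J \<inter> Q) v)"
          unfolding nonneg_def
        proof
          fix s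
          show "0 \<le> D.pra (J \<inter> Q) v s"
            using True rotate(4) fin by (cases "s \<in> J \<inter> Q") (auto simp: D.pra_coord nonneg_def not_less)
        qed
        then show ?thesis using rotate(6) dec_rotate[OF rotate(2) less.prems(2) rotate(3)] by blast
      next
        case False
        then have "J - ?N \<subset> J" by blast
        then have "card (J - ?N) < card J" by (rule psubset_card_mono[OF fin])
        moreover have "nonneg (D.restr (J - ?N) v)" using rotate(4) by (simp add: nonneg_def D.restr_apply)
        moreover have "J - ?N \<subseteq> S'" using less.prems(2) by blast
        ultimately obtain x where "dec Q (J - ?N) (D.restr (J - ?N) v) x"
          using less.hyps rotate(2) D.restr_V by blast
        then show ?thesis using dec_strip[OF rotate(2) less.prems(2) rotate(3), of ?N x] by blast
      qed
    qed
  qed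
qed

subsection \<open>Joins\<close>

text \<open>The unfolded element is compared with all noncrossing elements of the big group, and its
  moved space turns out to be least. \<open>Mov_subset_of_unfold\<close> later transfers leastness
  to the small group, so one \<open>x\<close> serves both joins.\<close>

lemma fold_join:
  assumes w: "w \<in> carrier W'"
  shows "\<exists>x. D.noncrossing P' x \<and> D.Mov w \<subseteq> D.Mov x \<and>
    (\<forall>y. U.noncrossing (fibre P') y \<longrightarrow> U.Mov (unfld w) \<subseteq> U.Mov y \<longrightarrow> U.Mov (unfld x) \<subseteq> U.Mov y)"
proof -
  let ?P = "fibre P'"
  have bP: "U.bip ?P" using bip_fibre bip' by blast
  define Z where "Z = {\<sigma> \<in> U.roots. \<forall>\<eta>\<in>U.Mov (unfld w). U.eul ?P \<eta> \<sigma> = 0}"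
  define A where "A = {\<rho> \<in> D.pos_roots. \<forall>\<sigma>\<in>Z. U.eul ?P (phi \<rho>) \<sigma> = 0}"
  \<comment> \<open>A vector avoiding these finitely many subspaces is generic: whatever element
    moves it moves all of \<open>A\<close>.\<close>
  let ?MM = "{D.Mov x | x. x \<in> carrier W' \<and> \<not> A \<subseteq> D.Mov x}"
  have "\<exists>v\<in>cone_hull A. \<forall>M\<in>?MM. v \<notin> M"
  proof (rule subspace_avoid)
    have "?MM \<subseteq> D.Mov ` carrier W'" by auto
    then show "finite ?MM" using D.finite_carrier finite_subset by blast
    show "subspace M" if "M \<in> ?MM" for M using that D.Mov_subspace by auto
    show "\<exists>x\<in>cone_hull A. x \<notin> M" if "M \<in> ?MM" for M using that cone_hull_base by auto
    show "cone_hull A \<noteq> {}" using cone_hull.zero by blast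
    show "x + r *\<^sub>R y \<in> cone_hull A" if "x \<in> cone_hull A" "y \<in> cone_hull A" "0 < r" for x y and r :: real
      using that by (intro cone_hull_add cone_hull_scale) auto
  qed
  then obtain v where v1: "v \<in> cone_hull A" and av: "\<forall>M\<in>?MM. v \<notin> M" by (elim bexE)
  have v2: "A \<subseteq> D.Mov x" if x: "x \<in> carrier W'" "v \<in> D.Mov x" for x
  proof (rule ccontr)
    assume "\<not> A \<subseteq> D.Mov x"
    then have "D.Mov x \<in> ?MM" using x(1) by auto
    from bspec[OF av this] show False using x(2) by simp
  qed
  note v = v1 v2
  have vV: "v \<in> D.V S'"
  proof -
    have "span A \<subseteq> D.V S'"
      by (rule real_vector.span_minimal[OF _ D.V_subspace]) (auto simp: A_def D.pos_roots_roots D.roots_V)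
    then show ?thesis using v(1) cone_hull_subset_span by blast
  qed
  have vn: "nonneg v" by (rule D.cone_hull_nonneg[OF v(1)]) (auto simp: A_def D.pos_roots_nonneg)
  obtain x where x: "dec P' S' v x" using dec_exists[OF bip' order_refl vV vn] by blast
  have xc: "x \<in> carrier W'" using x by (simp add: dec_def)
  have AM: "A \<subseteq> D.Mov x" using v(2)[OF xc] x by (simp add: dec_def)
  have nc: "D.noncrossing P' x"
  proof -
    have "D.cox P' S' = (D.cox P' S' \<otimes>\<^bsub>W'\<^esub> inv\<^bsub>W'\<^esub> x) \<otimes>\<^bsub>W'\<^esub> x" using bip' xc by (simp add: D.m_assoc)
    then have "card S' \<le> D.rk (D.cox P' S' \<otimes>\<^bsub>W'\<^esub> inv\<^bsub>W'\<^esub> x) + D.rk x"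
      using D.rk_mult[of "D.cox P' S' \<otimes>\<^bsub>W'\<^esub> inv\<^bsub>W'\<^esub> x" x] D.rk_cox[OF bip' order_refl] bip' xc by simp
    moreover have "D.rk (D.cox P' S' \<otimes>\<^bsub>W'\<^esub> inv\<^bsub>W'\<^esub> x) + D.rk x \<le> card S'" using x by (simp add: dec_def)
    ultimately show ?thesis using xc by (simp add: D.noncrossing_def)
  qed
  have xZ: "U.eul ?P \<eta> \<sigma> = 0" if \<sigma>: "\<sigma> \<in> Z" and \<eta>: "\<eta> \<in> U.Mov (unfld x)" for \<sigma> \<eta>
  proof -
    have r: "\<sigma> \<in> U.roots" using \<sigma> by (simp add: Z_def)
    have "phi v \<in> cone_hull {\<rho> \<in> U.pos_roots \<inter> U.V S. U.eul ?P \<rho> \<sigma> = 0}"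
    proof (rule cone_hull_image[OF v(1) phi_linear], rule image_subsetI)
      fix \<rho> assume \<rho>: "\<rho> \<in> A"
      have "U.pos_roots \<inter> fibroots \<rho> \<subseteq> {\<rho> \<in> U.pos_roots \<inter> U.V S. U.eul ?P \<rho> \<sigma> = 0}"
        using \<rho> \<sigma> eul_phi_fibroots_pos[OF bip' _ r] U.roots_V U.pos_roots_roots by (auto simp: A_def)
      then show "phi \<rho> \<in> cone_hull {\<rho> \<in> U.pos_roots \<inter> U.V S. U.eul ?P \<rho> \<sigma> = 0}"
        using phi_pos_root[of \<rho>] \<rho> cone_hull_mono by (auto simp: A_def)
    qed
    then show ?thesis using x r U.roots_V[OF r] \<eta> by (simp add: dec_def)
  qed
  have pw: "\<rho> \<in> D.Mov x" if \<rho>: "\<rho> \<in> D.pos_roots" "\<rho> \<in> D.Mov w" for \<rho>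
  proof -
    have "phi \<rho> \<in> U.Mov (unfld w)" using phi_Mov[OF w \<rho>(2)] .
    then have "\<rho> \<in> A" using \<rho>(1) by (simp add: A_def Z_def)
    then show ?thesis using AM by blast
  qed
  have sx: "subspace (D.Mov x)" using D.Mov_subspace xc by blast
  have "D.roots \<inter> D.Mov w \<subseteq> D.Mov x"
  proof (rule subsetI)
    fix \<rho> assume \<rho>: "\<rho> \<in> D.roots \<inter> D.Mov w"
    show "\<rho> \<in> D.Mov x"
    proof (cases "\<rho> \<in> D.pos_roots")
      case False
      then have "- \<rho> \<in> D.pos_roots" using D.roots_cases \<rho> by blast
      moreover have "- \<rho> \<in> D.Mov w" using \<rho> real_vector.subspace_neg[OF D.Mov_subspace[OF w]] by blast
      ultimately have "- \<rho> \<in> D.Mov x" by (rule pw)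
      then have "- (- \<rho>) \<in> D.Mov x" using real_vector.subspace_neg[OF sx] by blast
      then show ?thesis by simp
    qed (use pw \<rho> in blast)
  qed
  then have "D.Mov w \<subseteq> D.Mov x"
    using D.Mov_subset_span_roots[OF w] real_vector.span_minimal[OF _ sx] by blast
  moreover have "U.Mov (unfld x) \<subseteq> U.Mov y" if y: "U.noncrossing ?P y" "U.Mov (unfld w) \<subseteq> U.Mov y" for y
  proof (rule subsetI)
    fix \<eta> assume \<eta>: "\<eta> \<in> U.Mov (unfld x)"
    have yc: "y \<in> carrier W" using y(1) by (simp add: U.noncrossing_def)
    let ?z = "U.cox ?P S \<otimes>\<^bsub>W\<^esub> inv\<^bsub>W\<^esub> y"
    have zc: "?z \<in> carrier W" using bP yc by simp
    have \<eta>V: "\<eta> \<in> U.V S" using \<eta> U.Mov_V[of "unfld x"] xc by auto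
    show "\<eta> \<in> U.Mov y"
    proof (rule U.Mov_left_annihilator[OF bP yc \<eta>V])
      fix \<tau> assume \<tau>: "\<tau> \<in> U.Mov ?z"
      have root: "U.eul ?P \<tau> \<eta> = 0" if \<tau>: "\<tau> \<in> U.roots" "\<tau> \<in> U.Mov ?z" for \<tau>
      proof -
        \<comment> \<open>The inverse Coxeter element turns a left annihilator into a right one, up
          to sign, and so makes \<open>\<tau>\<close> a test root in \<open>Z\<close>.\<close>
        let ?\<sigma> = "U.act (inv\<^bsub>W\<^esub> (U.cox ?P S)) \<tau>"
        have c: "U.eul ?P f ?\<sigma> = - U.eul ?P \<tau> f" for f by (rule U.eul_inv_cox[OF bP])
        have "U.eul ?P \<tau> f = 0" if "f \<in> U.Mov (unfld w)" for f
          using U.Mov_right_annihilator[OF bP y(1) \<tau>(2)] y(2) that by blast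
        then have "?\<sigma> \<in> Z" using c \<tau>(1) bP by (simp add: Z_def)
        then show ?thesis using xZ[OF _ \<eta>] c[of \<eta>] by simp
      qed
      have "subspace {\<tau>. U.eul ?P \<tau> \<eta> = 0}"
        by (simp add: real_vector.subspace_def U.eul_add_left U.eul_scale_left)
      then have "span (U.roots \<inter> U.Mov ?z) \<subseteq> {\<tau>. U.eul ?P \<tau> \<eta> = 0}"
        using root by (intro real_vector.span_minimal) auto
      then show "U.eul ?P \<tau> \<eta> = 0" using U.Mov_subset_span_roots[OF zc] \<tau> by blast
    qed
  qed
  ultimately show ?thesis using nc by blast
qed

end

section \<open>Joins in the lattice and the pop operator\<close>

context irreducible_coxeter
begin

lemma noncrossing_iff_abs_le:
  "bip P \<Longrightarrow> noncrossing P y \<longleftrightarrow> y \<in> carrier G \<and> y \<preceq> cox P S"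
  using abs_le_iff[of y "cox P S"] rk_cox[of P S] by (auto simp: noncrossing_def)

lemma noncrossing_abs_le_iff:
  assumes "bip P" "noncrossing P x" "noncrossing P y"
  shows "x \<preceq> y \<longleftrightarrow> Mov x \<subseteq> Mov y"
proof -
  have c: "x \<in> carrier G" "y \<in> carrier G" using assms(2,3) by (auto simp: noncrossing_def)
  show ?thesis unfolding abs_le_iff[OF c] using abs_le_Mov(1)[OF c] noncrossing_le[OF assms] by blast
qed

lemma noncrossing_rt: "bip P \<Longrightarrow> \<rho> \<in> roots \<Longrightarrow> noncrossing P (rt \<rho>)"
  using noncrossing_iff_abs_le rt_abs_le_iff[of \<rho> "cox P S"] Mov_cox[of P S] roots_V by simp

lemma noncrossing_upper_iff:
  assumes P: "bip P" and w: "w \<in> carrier G" and y: "noncrossing P y"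
  shows "(\<forall>t\<in>reflections G S. t \<preceq> w \<longrightarrow> t \<preceq> y) \<longleftrightarrow> Mov w \<subseteq> Mov y"
proof
  have yc: "y \<in> carrier G" using y by (simp add: noncrossing_def)
  {
    assume u: "\<forall>t\<in>reflections G S. t \<preceq> w \<longrightarrow> t \<preceq> y"
    have "roots \<inter> Mov w \<subseteq> Mov y"
      using u rt_abs_le_iff[OF _ w] rt_abs_le_iff[OF _ yc] rt_reflections by blast
    then show "Mov w \<subseteq> Mov y"
      using Mov_subset_span_roots[OF w] real_vector.span_minimal[OF _ Mov_subspace[OF yc]] by blast
  next
    assume m: "Mov w \<subseteq> Mov y"
    show "\<forall>t\<in>reflections G S. t \<preceq> w \<longrightarrow> t \<preceq> y"
    proof (intro ballI impI)
      fix t assume t: "t \<in> reflections G S" "t \<preceq> w"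
      then obtain \<rho> where "\<rho> \<in> roots" "t = rt \<rho>" using reflection_is_rt pos_roots_roots by blast
      then show "t \<preceq> y" using t(2) m rt_abs_le_iff w yc by blast
    qed
  }
qed

text \<open>The join is defined by choice of a least upper bound, so uniqueness has to be supplied:
  noncrossing elements are determined by their moved spaces. Upper bounds are those whose moved
  space contains \<open>Mov w\<close>.\<close>

lemma pop_join_eqI:
  assumes P: "bip P" and w: "w \<in> carrier G" and x: "noncrossing P x" "Mov w \<subseteq> Mov x"
    and least: "\<And>y. noncrossing P y \<Longrightarrow> Mov w \<subseteq> Mov y \<Longrightarrow> Mov x \<subseteq> Mov y"
  shows "pop_join G (reflections G S) (cox P S) w = x"
proof -
  let ?L = "NC G (reflections G S) (cox P S)"
  let ?A = "{t \<in> reflections G S. t \<preceq> w}"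
  have carr: "carrier ?L = {y. noncrossing P y}"
    using noncrossing_iff_abs_le[OF P] by (auto simp: NC_def)
  have le: "le ?L = abs_le G (reflections G S)" by (simp add: NC_def)
  have "?A \<subseteq> carrier ?L"
  proof (rule subsetI)
    fix t assume "t \<in> ?A"
    then obtain \<rho> where "\<rho> \<in> pos_roots" "t = rt \<rho>" using reflection_is_rt[of t] by auto
    then show "t \<in> carrier ?L" using noncrossing_rt[OF P pos_roots_roots] by (simp add: carr)
  qed
  then have "y \<in> Upper ?L ?A \<longleftrightarrow> noncrossing P y \<and> (\<forall>t\<in>reflections G S. t \<preceq> w \<longrightarrow> t \<preceq> y)" for y
    by (auto simp only: Upper_def carr le mem_Collect_eq Int_iff subset_iff)
  then have up: "y \<in> Upper ?L ?A \<longleftrightarrow> noncrossing P y \<and> Mov w \<subseteq> Mov y" for y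
    using noncrossing_upper_iff[OF P w, of y] by (simp cong: conj_cong)
  have lst: "least ?L y (Upper ?L ?A) \<longleftrightarrow> noncrossing P y \<and> Mov w \<subseteq> Mov y \<and>
      (\<forall>z. noncrossing P z \<and> Mov w \<subseteq> Mov z \<longrightarrow> y \<preceq> z)" for y
  proof -
    have "Upper ?L ?A \<subseteq> carrier ?L" by simp
    then show ?thesis by (simp add: least_def up le Ball_def)
  qed
  have "least ?L x (Upper ?L ?A)"
    unfolding lst
  proof (intro conjI allI impI x)
    fix z assume z: "noncrossing P z \<and> Mov w \<subseteq> Mov z"
    then show "x \<preceq> z" using noncrossing_abs_le_iff[OF P x(1), of z] least[of z] by simp
  qed
  moreover have "y = x" if "least ?L y (Upper ?L ?A)" for y
  proof -
    have y: "noncrossing P y" "Mov w \<subseteq> Mov y" "y \<preceq> x" using that x unfolding lst by simp_all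
    have "Mov y = Mov x"
      using y(3) least[OF y(1,2)] noncrossing_abs_le_iff[OF P y(1) x(1)] by simp
    then show ?thesis by (rule noncrossing_Mov_inj[OF P y(1) x(1)])
  qed
  ultimately show ?thesis unfolding pop_join_def sup_def by (rule some_equality)
qed

end

context folding
begin

lemma Mov_unfold_noncrossing:
  assumes "w \<in> carrier W'" "D.noncrossing P' y" "D.Mov w \<subseteq> D.Mov y"
  shows "U.Mov (unfld w) \<subseteq> U.Mov (unfld y)"
proof (rule Mov_unfold_subset[OF assms(1)])
  show "subspace (U.Mov (unfld y))"
    using noncrossing_unfold(1)[OF assms(2)] U.Mov_subspace by (simp add: U.noncrossing_def)
  show "fibroots \<rho> \<subseteq> U.Mov (unfld y)" if "\<rho> \<in> D.roots" "\<rho> \<in> D.Mov w" for \<rho>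
    using noncrossing_unfold(2)[OF assms(2)] assms(3) that by blast
qed

text \<open>Write \<open>v\<close> as a part moved by \<open>y\<close> plus a part fixed by
  \<open>y\<close>. The image of the fixed part is both fixed and moved by \<open>unfld y\<close>,
  hence zero, and \<open>phi\<close> is injective on \<open>D.V S'\<close>.\<close>

lemma Mov_subset_of_unfold:
  assumes "x \<in> carrier W'" "y \<in> carrier W'" "U.Mov (unfld x) \<subseteq> U.Mov (unfld y)"
  shows "D.Mov x \<subseteq> D.Mov y"
proof (rule subsetI)
  fix v assume v: "v \<in> D.Mov x"
  then have vV: "v \<in> D.V S'" using D.Mov_V[OF assms(1)] by blast
  obtain m where m: "m \<in> D.Mov y" "v - m \<in> D.Fix y" using D.Mov_Fix_decomp[OF assms(2) vV] by blast
  have yc: "unfld y \<in> carrier W" using assms(2) by simp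
  have fV: "v - m \<in> D.V S'" using m(2) by (simp add: D.Fix_def)
  have fF: "phi (v - m) \<in> U.Fix (unfld y)"
    using phi_act[OF assms(2) fV] m(2) phi_VS by (simp add: U.Fix_def D.Fix_def)
  have "phi (v - m) = phi v - phi m" by (rule linear_diff[OF phi_linear])
  also have "\<dots> \<in> U.Mov (unfld y)"
    using phi_Mov[OF assms(1) v] phi_Mov[OF assms(2) m(1)] assms(3)
      real_vector.subspace_diff[OF U.Mov_subspace[OF yc]] by blast
  finally have "U.bf (phi (v - m)) (phi (v - m)) = 0"
    using U.Mov_orth_Fix[OF yc] fF by blast
  then have "phi (v - m) = 0" using U.bf_self_eq_0[OF phi_VS] by blast
  then have "v - m = 0" by (rule phi_eq_0[OF fV])
  then show "v \<in> D.Mov y" using m(1) by simp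
qed

lemma unfld_Pop:
  assumes "w \<in> carrier W'"
  shows "Pop W' (reflections W' S') (D.cox P' S') w \<in> carrier W'"
    and "unfld (Pop W' (reflections W' S') (D.cox P' S') w) =
      Pop W (reflections W S) (U.cox (fibre P') S) (unfld w)"
proof -
  obtain x where x: "D.noncrossing P' x" "D.Mov w \<subseteq> D.Mov x"
    "\<And>y. U.noncrossing (fibre P') y \<Longrightarrow> U.Mov (unfld w) \<subseteq> U.Mov y \<Longrightarrow> U.Mov (unfld x) \<subseteq> U.Mov y"
    using fold_join[OF assms] by blast
  have xc: "x \<in> carrier W'" using x(1) by (simp add: D.noncrossing_def)
  have U: "pop_join W (reflections W S) (U.cox (fibre P') S) (unfld w) = unfld x"
    using U.pop_join_eqI[OF bip_fibre[OF bip'] unfld_carrier[OF assms] noncrossing_unfold(1)[OF x(1)]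
        Mov_unfold_noncrossing[OF assms x(1,2)] x(3)] .
  have D: "pop_join W' (reflections W' S') (D.cox P' S') w = x"
  proof (rule D.pop_join_eqI[OF bip' assms x(1,2)])
    fix y assume y: "D.noncrossing P' y" "D.Mov w \<subseteq> D.Mov y"
    have "U.Mov (unfld x) \<subseteq> U.Mov (unfld y)"
      by (rule x(3)[OF noncrossing_unfold(1)[OF y(1)] Mov_unfold_noncrossing[OF assms y]])
    then show "D.Mov x \<subseteq> D.Mov y"
      using Mov_subset_of_unfold xc y(1) by (simp add: D.noncrossing_def)
  qed
  show "Pop W' (reflections W' S') (D.cox P' S') w \<in> carrier W'"
    using assms xc by (simp add: Pop_def D)
  show "unfld (Pop W' (reflections W' S') (D.cox P' S') w) =
      Pop W (reflections W S) (U.cox (fibre P') S) (unfld w)"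
    using assms xc by (simp add: Pop_def D U)
qed

end

theorem theorem4p8:
  fixes W :: "('a, 'm) monoid_scheme" and W' :: "('b, 'n) monoid_scheme"
    and S :: "'a set" and S' :: "'b set"
    and fld :: "'a \<Rightarrow> 'b" and unfld :: "'b \<Rightarrow> 'a"
    and c :: 'a and c' w' :: 'b and k :: nat
  assumes "irreducible_coxeter_system W S" and "finite (carrier W)"
    and "irreducible_coxeter_system W' S'" and "finite (carrier W')"
    and "folds_to W S W' S' fld unfld"
    and "bipartite_coxeter_element W' S' c'"
    and "c = unfld c'"
    and "w' \<in> carrier W'"
  shows "unfld ((Pop W' (reflections W' S') c' ^^ k) w') =
         (Pop W (reflections W S) c ^^ k) (unfld w')"
proof -
  interpret U: irreducible_coxeter W S
    using assms(1,2) by unfold_locales (auto simp: irreducible_coxeter_system_def)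
  interpret D: irreducible_coxeter W' S'
    using assms(3,4) by unfold_locales (auto simp: irreducible_coxeter_system_def)
  obtain A B where AB: "S' = A \<union> B" "A \<inter> B = {}" "pairwise_commuting W' A" "pairwise_commuting W' B"
    "c' = commuting_prod W' A \<otimes>\<^bsub>W'\<^esub> commuting_prod W' B"
    using assms(6) by (auto simp: bipartite_coxeter_element_def)
  have SA: "S' - A = B" "S' \<inter> A = A" "A \<subseteq> S'" "B \<subseteq> S'" using AB(1,2) by auto
  then have bip: "D.bip A" using AB(3,4) D.pairwise_commuting_orth by (simp add: D.bip_def)
  have c': "c' = D.cox A S'" using SA AB(5) by (simp add: D.cox_def D.pr_def)
  interpret folding W S W' S' fld unfld A by unfold_locales (use assms(5) bip in auto)
  have c: "c = U.cox (fibre A) S" using assms(7) c' unfld_cox[OF bip order_refl] by simp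
  have "(Pop W' (reflections W' S') c' ^^ k) w' \<in> carrier W' \<and> ?thesis"
    using assms(8) by (induction k) (auto simp: c' c unfld_Pop)
  then show ?thesis by blast
qed

end
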